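(* Let $f\in\mathcal{B}$ be a transcendental entire function of finite order, and let $r_0>0$ be such that all singular values of $f$ lie in $\{|z|\leq r_0\}$. Let $U=f^{-1}(\{z:|z|>r_0\})$ and $W=\exp^{-1}(U)=\{z\in\mathbb{C}: e^z\in U\}$. Suppose there exists $R_1>\max\{2\log r_0,\ \log r_0+64\pi\}$ such that $$W\subset\{z:\operatorname{Re} z>R_1\}.$$ Let $\theta(r)=\operatorname{meas}\{t\in[0,2\pi]: |f(re^{it})|<r_0\}$, and suppose that $\theta(r)\geq\theta_0(r)$ for large $r>0$, where $\theta_0$ is decreasing and $\sum_{k=1}^{\infty}\theta_0(E^k(0))=\infty$. Then the Julia set $\mathcal{J}(f)$ has Lebesgue measure zero.
   Context: $\operatorname{meas}$ is one-dimensional Lebesgue measure; $E(x)=e^x$, $E^k$ its $k$-th iterate. The order of $f$ is $\limsup_{r\to\infty}\log\log M(r,f)/\log r$, $M(r,f)=\max_{|z|=r}|f(z)|$. $\mathcal{B}$ is the class of transcendental entire functions whose set of singular values (closure in $\mathbb{C}$ of the critical and asymptotic values) is bounded. $\mathcal{J}(f)$ is the set of points where the iterates of $f$ do not form a normal family. *)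

theory Defs
  imports "HOL-Complex_Analysis.Complex_Analysis"
begin

definition entire :: "(complex \<Rightarrow> complex) \<Rightarrow> bool" where
  "entire f \<longleftrightarrow> f holomorphic_on UNIV"

definition transcendental_entire :: "(complex \<Rightarrow> complex) \<Rightarrow> bool" where
  "transcendental_entire f \<longleftrightarrow> entire f \<and> \<not> (\<exists>p. \<forall>z. f z = poly p z)"

definition max_modulus :: "(complex \<Rightarrow> complex) \<Rightarrow> real \<Rightarrow> real" where
  "max_modulus f r = Sup {norm (f z) | z. norm z = r}"

definition order_entire :: "(complex \<Rightarrow> complex) \<Rightarrow> ereal" where
  "order_entire f = Limsup at_top (\<lambda>r. ereal (ln (ln (max_modulus f r)) / ln r))"

definition finite_order :: "(complex \<Rightarrow> complex) \<Rightarrow> bool" where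
  "finite_order f \<longleftrightarrow> order_entire f < \<infinity>"

definition critical_values :: "(complex \<Rightarrow> complex) \<Rightarrow> complex set" where
  "critical_values f = {f z | z. deriv f z = 0}"

definition asymptotic_values :: "(complex \<Rightarrow> complex) \<Rightarrow> complex set" where
  "asymptotic_values f = {a. \<exists>\<gamma> :: real \<Rightarrow> complex.
      continuous_on {0..<1} \<gamma> \<and> filterlim \<gamma> at_infinity (at_left 1) \<and>
      ((\<lambda>t. f (\<gamma> t)) \<longlongrightarrow> a) (at_left 1)}"

definition singular_values :: "(complex \<Rightarrow> complex) \<Rightarrow> complex set" where
  "singular_values f = closure (critical_values f \<union> asymptotic_values f)"

definition class_B :: "(complex \<Rightarrow> complex) \<Rightarrow> bool" where
  "class_B f \<longleftrightarrow> transcendental_entire f \<and> bounded (singular_values f)"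

definition normal_family :: "(complex \<Rightarrow> complex) set \<Rightarrow> complex set \<Rightarrow> bool" where
  "normal_family F V \<longleftrightarrow>
    (\<forall>g :: nat \<Rightarrow> complex \<Rightarrow> complex. (\<forall>n. g n \<in> F) \<longrightarrow>
      (\<exists>r. strict_mono r \<and>
        ((\<exists>h. \<forall>K. compact K \<and> K \<subseteq> V \<longrightarrow> uniform_limit K (\<lambda>n. g (r n)) h sequentially) \<or>
         (\<forall>K. compact K \<and> K \<subseteq> V \<longrightarrow>
            (\<forall>B. \<forall>\<^sub>F n in sequentially. \<forall>z\<in>K. B \<le> norm (g (r n) z))))))"

definition fatou_set :: "(complex \<Rightarrow> complex) \<Rightarrow> complex set" where
  "fatou_set f = {z. \<exists>V. open V \<and> z \<in> V \<and> normal_family (range (\<lambda>n. f ^^ n)) V}"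

definition julia_set :: "(complex \<Rightarrow> complex) \<Rightarrow> complex set" where
  "julia_set f = - fatou_set f"

definition iter_exp :: "nat \<Rightarrow> real" where
  "iter_exp k = (exp ^^ k) 0"

end

theory Submission
  imports Defs
begin

text \<open>
  Since \<open>f\<close> maps the disc of radius \<open>exp R1\<close> into the disc of radius \<open>r0 < exp R1\<close>, Montel's theorem
  shows that the orbit of a point of the Julia set never enters that disc. In the coordinate \<open>z\<close> with
  \<open>u = exp z\<close>, the map \<open>f\<close> has inverse branches \<open>G\<close> on the half-plane \<open>Re w > ln r0\<close>; they are
  univalent because \<open>f\<close> is not a polynomial, and Bloch's theorem gives
  \<open>|G' w| \<le> 12 \<pi> / (Re w - ln r0)\<close>, so that they contract where \<open>Re w \<ge> ln r0 + 32 \<pi>\<close>.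

  Tile the latter half-plane by rectangles of height \<open>2 \<pi>\<close> and fixed width. The images of the
  rectangles under compositions of \<open>n\<close> branches are disjoint, have diameter \<open>O((3/8)\<^sup>n)\<close> and,
  by a Koebe-type theorem, bounded distortion. By finite order, a rectangle reached after \<open>n\<close> steps from a
  bounded set lies to the left of \<open>E\<^sup>n\<^sup>+\<^sup>m(0)\<close>, so at least a fraction comparable to
  \<open>\<theta>0 (E\<^sup>n\<^sup>+\<^sup>m\<^sup>+\<^sup>1(0))\<close> of it is mapped into the disc of radius \<open>r0\<close> by the next step. The product
  of the surviving fractions vanishes because the sum of the \<open>\<theta>0 (E\<^sup>k(0))\<close> diverges.
\<close>

section \<open>Normality and the Julia set\<close>

text \<open>Branches live on the whole half-plane \<open>H\<close>, not on discs. It is simply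
  connected and \<open>exp\<close> maps it into the regular values, so any composition of branches
  is one univalent map on \<open>H\<close>; a single distortion constant then serves every level n.
  Even \<open>exp\<close> of a branch is univalent, so a branch range contains no two distinct
  points that differ by 2 pi i, hence no disc of radius above pi. Bloch's theorem turns this into
  the derivative bound.

  The bound by \<theta>0 is given only from some radius on, which dictates the width of the
  rectangles: it is so large that every column except the leftmost lies beyond that radius. In the
  leftmost column the strip between \<open>a\<close> and \<open>R1\<close> is lost entirely, because
  W lies to the right of \<open>R1\<close>.

  Tiles of successive levels need not be nested, since a branch may carry one rectangle across
  several others. The tiles are therefore confined to a shrinking sequence of balls around a fixed
  point, and area is compared ball by ball. The shift m depends on this point but not on n, so it
  does not affect divergence.\<close>

lemma holomorphic_on_funpow:
  assumes "f holomorphic_on UNIV"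
  shows "(f ^^ n) holomorphic_on UNIV"
proof (induction n)
  case 0
  then show ?case by (simp add: id_def)
next
  case (Suc n)
  then show ?case
    using assms holomorphic_on_compose_gen[of "f ^^ n" UNIV f UNIV] by (simp add: o_def)
qed

lemma Montel_normal_family:
  assumes "open V"
    and hol: "\<And>h. h \<in> F \<Longrightarrow> h holomorphic_on V"
    and bdd: "\<And>K. compact K \<Longrightarrow> K \<subseteq> V \<Longrightarrow> \<exists>B. \<forall>h\<in>F. \<forall>z\<in>K. norm (h z) \<le> B"
  shows "normal_family F V"
  unfolding normal_family_def
proof (intro allI impI)
  fix g :: "nat \<Rightarrow> complex \<Rightarrow> complex"
  assume g: "\<forall>n. g n \<in> F"
  obtain h r where "strict_mono (r :: nat \<Rightarrow> nat)"
    and "\<And>K. compact K \<Longrightarrow> K \<subseteq> V \<Longrightarrow> uniform_limit K (g \<circ> r) h sequentially"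
    by (rule Montel[OF \<open>open V\<close> hol bdd, of g]) (use g in auto)
  then show "\<exists>r. strict_mono r \<and>
        ((\<exists>h. \<forall>K. compact K \<and> K \<subseteq> V \<longrightarrow> uniform_limit K (\<lambda>n. g (r n)) h sequentially) \<or>
         (\<forall>K. compact K \<and> K \<subseteq> V \<longrightarrow>
            (\<forall>B. \<forall>\<^sub>F n in sequentially. \<forall>z\<in>K. B \<le> norm (g (r n) z))))"
    unfolding o_def by blast
qed

text \<open>An iterate that enters the ball does so on a neighbourhood, where all later iterates are
  bounded by r. The finitely many earlier ones are bounded on compact sets, so Montel's theorem
  applies there.\<close>

lemma julia_set_subset_escaping_ball:
  assumes f: "f holomorphic_on UNIV"
    and contr: "\<And>z. norm z < R \<Longrightarrow> norm (f z) \<le> r"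
    and "r < R"
  shows "julia_set f \<subseteq> {z. \<forall>n. R \<le> norm ((f ^^ n) z)}"
proof
  fix z assume z: "z \<in> julia_set f"
  have hol: "(f ^^ n) holomorphic_on UNIV" for n
    by (rule holomorphic_on_funpow[OF f])
  have cont: "continuous_on A (f ^^ n)" for n A
    using hol holomorphic_on_imp_continuous_on continuous_on_subset by blast
  have False if "norm ((f ^^ k) z) < R" for k
  proof -
    define V where "V = {v. norm ((f ^^ k) v) < R}"
    have "open V"
      unfolding V_def by (intro open_Collect_less continuous_intros cont)
    have tail: "norm ((f ^^ (Suc m + k)) v) \<le> r" if "v \<in> V" for v m
    proof (induction m)
      case 0
      then show ?case using that contr by (simp add: V_def)
    next
      case (Suc m)
      then show ?case using contr[of "(f ^^ (Suc m + k)) v"] \<open>r < R\<close> by simp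
    qed
    have "normal_family (range (\<lambda>n. f ^^ n)) V"
    proof (rule Montel_normal_family[OF \<open>open V\<close>])
      fix h assume "h \<in> range (\<lambda>n. f ^^ n)"
      then show "h holomorphic_on V"
        using hol holomorphic_on_subset by blast
    next
      fix K assume K: "compact K" "K \<subseteq> V"
      have "\<exists>B. \<forall>z\<in>K. norm ((f ^^ n) z) \<le> B" for n
        using compact_imp_bounded[OF compact_continuous_image[OF cont \<open>compact K\<close>], of n]
        by (auto simp: bounded_iff)
      then obtain B where B: "\<And>n z. z \<in> K \<Longrightarrow> norm ((f ^^ n) z) \<le> B n"
        by metis
      define C where "C = max r (Max (B ` {..k}))"
      have "norm ((f ^^ n) z) \<le> C" if "z \<in> K" for n z
      proof (cases "n \<le> k")
        case True
        then have "B n \<le> Max (B ` {..k})" by simp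
        then show ?thesis using B[OF that, of n] by (simp add: C_def)
      next
        case False
        then have "n = Suc (n - Suc k) + k" by simp
        then show ?thesis
          using tail[of z "n - Suc k"] that K by (auto simp: C_def le_max_iff_disj)
      qed
      then show "\<exists>B. \<forall>h\<in>range (\<lambda>n. f ^^ n). \<forall>z\<in>K. norm (h z) \<le> B"
        by blast
    qed
    then have "z \<in> fatou_set f"
      unfolding fatou_set_def using \<open>open V\<close> that V_def by blast
    with z show False by (simp add: julia_set_def)
  qed
  then show "z \<in> {z. \<forall>n. R \<le> norm ((f ^^ n) z)}"
    by (auto simp: not_less[symmetric])
qed

section \<open>Distortion of univalent functions\<close>

text \<open>If the image contained the closed unit disc, the inverse would map that disc onto a
  compact part of the open unit disc. Its maximum modulus would be below 1, against Cauchy's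
  inequality and derivative 1 at 0.\<close>

lemma univalent_omits_unit_value:
  assumes hol: "f holomorphic_on ball 0 1" and inj: "inj_on f (ball 0 1)"
    and f0: "f 0 = 0" and df0: "deriv f 0 = 1"
  obtains a where "norm a \<le> 1" "a \<notin> f ` ball 0 1"
proof (rule ccontr)
  assume "\<not> thesis"
  then have sub: "cball 0 1 \<subseteq> f ` ball 0 1"
    using that by (force simp: subset_eq)
  obtain g where g: "g holomorphic_on (f ` ball 0 1)"
    and dg: "\<And>z. z \<in> ball 0 1 \<Longrightarrow> deriv f z * deriv g (f z) = 1"
    and gf: "\<And>z. z \<in> ball 0 1 \<Longrightarrow> g (f z) = z"
    using holomorphic_has_inverse[OF hol open_ball inj] by metis
  have contg: "continuous_on (cball 0 1) g"
    using g sub holomorphic_on_imp_continuous_on continuous_on_subset by blast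
  have "compact (g ` cball 0 1)"
    by (rule compact_continuous_image[OF contg compact_cball])
  moreover have "g ` cball 0 1 \<noteq> {}" by simp
  ultimately obtain y where y: "y \<in> g ` cball 0 1" and ymax: "\<And>x. x \<in> g ` cball 0 1 \<Longrightarrow> norm x \<le> norm y"
    using continuous_attains_sup[of "g ` cball 0 1" norm] continuous_on_norm_id by blast
  have "norm y < 1"
    using y sub gf by force
  have "norm ((deriv ^^ 1) g 0) \<le> fact 1 * norm y / 1 ^ 1"
  proof (rule Cauchy_inequality)
    show "g holomorphic_on ball 0 1"
      using g sub holomorphic_on_subset ball_subset_cball by blast
    show "norm (g x) \<le> norm y" if "norm (0 - x) = 1" for x
      using ymax that by auto
  qed (use contg in auto)
  moreover have "deriv g 0 = 1"
    using dg[of 0] f0 df0 by simp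
  ultimately show False using \<open>norm y < 1\<close> by simp
qed

text \<open>If \<open>f\<close> omits \<open>a\<close>, the branch \<open>h\<close> of the square root of \<open>1 - f / a\<close> with
  \<open>h 0 = 1\<close> omits both \<open>0\<close> and \<open>-1\<close>, so that Schottky's theorem applies to \<open>-h\<close>.\<close>

lemma univalent_growth:
  obtains C :: real where "C > 0"
    "\<And>f z. f holomorphic_on ball 0 1 \<Longrightarrow> inj_on f (ball 0 1) \<Longrightarrow> f 0 = 0 \<Longrightarrow> deriv f 0 = 1 \<Longrightarrow>
       norm z \<le> 1 / 2 \<Longrightarrow> norm (f z) \<le> C"
proof
  \<comment> \<open>Schottky's bound for a function of modulus at most 1 at the origin, evaluated on
    the disc of radius 2/3.\<close>
  define C0 where "C0 = exp (pi * exp (pi * (2 + 2 * 1 + 12 * (2/3) / (1 - 2/3))))"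
  show "1 + C0\<^sup>2 > 0"
    by (simp add: add_pos_nonneg)
  fix f z
  assume hol: "f holomorphic_on ball 0 1" and inj: "inj_on f (ball 0 1)"
    and f0: "f 0 = 0" and df0: "deriv f 0 = 1" and z: "norm (z :: complex) \<le> 1 / 2"
  obtain a where a: "norm a \<le> 1" "a \<notin> f ` ball 0 1"
    using univalent_omits_unit_value[OF hol inj f0 df0] .
  have "a \<noteq> 0" using a f0 by force
  have q: "(\<lambda>z. 1 - f z / a) holomorphic_on ball 0 1" "\<And>z. z \<in> ball 0 1 \<Longrightarrow> 1 - f z / a \<noteq> 0"
    using a \<open>a \<noteq> 0\<close> by (auto intro!: holomorphic_intros hol)
  obtain l where l: "l holomorphic_on ball 0 1" "\<And>z. z \<in> ball 0 1 \<Longrightarrow> 1 - f z / a = exp (l z)"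
    using contractible_imp_holomorphic_log[OF q(1) _ q(2)] convex_imp_contractible convex_ball by metis
  define h where "h = (\<lambda>z. exp ((l z - l 0) / 2))"
  have el0: "exp (l 0) = 1" using l(2)[of 0] f0 by simp
  have hsq: "(h z)\<^sup>2 = 1 - f z / a" if "z \<in> ball 0 1" for z
  proof -
    have "(h z)\<^sup>2 = exp (2 * ((l z - l 0) / 2))"
      unfolding h_def by (rule exp_double[symmetric])
    also have "2 * ((l z - l 0) / 2) = l z - l 0"
      by (metis nonzero_mult_div_cancel_left times_divide_eq_right zero_neq_numeral)
    finally have "(h z)\<^sup>2 = exp (l z - l 0)" .
    then show ?thesis using l(2)[OF that] el0 by (simp add: exp_diff)
  qed
  \<comment> \<open>The value -1 would force \<open>f z = 0\<close>, hence \<open>z = 0\<close> by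
    injectivity, but \<open>h 0 = 1\<close>.\<close>
  have h1: "h z \<noteq> -1" if "z \<in> ball 0 1" for z
  proof
    assume "h z = -1"
    with hsq[OF that] \<open>a \<noteq> 0\<close> have "f z = f 0" using f0 by simp
    then have "z = 0" using inj that by (simp add: inj_on_def)
    with \<open>h z = -1\<close> show False by (simp add: h_def)
  qed
  \<comment> \<open>Schottky's theorem asks for holomorphy on the closed unit disc. Scaling by 3/4
    provides it and turns the radius 1/2 into 2/3.\<close>
  define F where "F = (\<lambda>u. - h (3/4 * u))"
  have in_ball: "3/4 * u \<in> ball 0 1" if "u \<in> cball 0 1" for u :: complex
    using that by (simp add: norm_mult)
  have holh: "h holomorphic_on ball 0 1"
    unfolding h_def by (auto intro!: holomorphic_intros l)
  have "(h \<circ> (\<lambda>u. 3/4 * u)) holomorphic_on cball 0 1"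
    by (rule holomorphic_on_compose_gen[OF _ holh]) (use in_ball in \<open>auto intro!: holomorphic_intros\<close>)
  then have "F holomorphic_on cball 0 1"
    unfolding F_def o_def by (rule holomorphic_on_minus)
  moreover have "norm (F 0) \<le> 1" by (simp add: F_def h_def)
  moreover have "\<not> (F u = 0 \<or> F u = 1)" if "u \<in> cball 0 1" for u
    using h1[OF in_ball[OF that]] by (auto simp: F_def h_def minus_equation_iff)
  moreover have "norm (4/3 * z) \<le> 2/3" using z by (simp add: norm_mult)
  ultimately have "norm (F (4/3 * z)) \<le> C0"
    unfolding C0_def by (intro Schottky) auto
  then have hz: "norm (h z) \<le> C0" by (simp add: F_def)
  have zb: "z \<in> ball 0 1" using z by simp
  have "f z = a * (1 - (h z)\<^sup>2)" using hsq[OF zb] \<open>a \<noteq> 0\<close> by simp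
  also have "norm \<dots> \<le> 1 * (1 + C0\<^sup>2)"
    unfolding norm_mult
  proof (rule mult_mono[OF a(1)])
    have "norm (1 - (h z)\<^sup>2) \<le> 1 + norm ((h z)\<^sup>2)"
      by (metis norm_one norm_triangle_ineq4)
    also have "\<dots> \<le> 1 + C0\<^sup>2" using hz by (simp add: norm_power power_mono)
    finally show "norm (1 - (h z)\<^sup>2) \<le> 1 + C0\<^sup>2" .
  qed auto
  finally show "norm (f z) \<le> 1 + C0\<^sup>2" by simp
qed

text \<open>After normalisation the growth bound controls \<phi> on the disc of radius \<rho>/2.
  Cauchy's inequality on the disc of radius \<rho>/4 about \<open>u\<close> costs the factor 4.
  Having \<open>K \<ge> 1\<close> lets the estimate be iterated along a chain of discs.\<close>

lemma univalent_deriv_distortion: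
  obtains K :: real where "K \<ge> 1"
    "\<And>\<phi> w \<rho> u. \<phi> holomorphic_on ball w \<rho> \<Longrightarrow> inj_on \<phi> (ball w \<rho>) \<Longrightarrow> 0 < \<rho> \<Longrightarrow>
       dist w u \<le> \<rho> / 4 \<Longrightarrow> norm (deriv \<phi> u) \<le> K * norm (deriv \<phi> w)"
proof -
  obtain C :: real where "C > 0" and C: "\<And>f z. f holomorphic_on ball 0 1 \<Longrightarrow> inj_on f (ball 0 1) \<Longrightarrow> f 0 = 0 \<Longrightarrow> deriv f 0 = 1 \<Longrightarrow>
       norm z \<le> 1 / 2 \<Longrightarrow> norm (f z) \<le> C"
    using univalent_growth by metis
  show ?thesis
  proof
    show "max 1 (4 * C) \<ge> 1" by simp
    fix \<phi> w \<rho> u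
    assume hol: "\<phi> holomorphic_on ball w \<rho>" and inj: "inj_on \<phi> (ball w \<rho>)" and "(0::real) < \<rho>"
      and u: "dist w u \<le> \<rho> / 4"
    define d where "d = deriv \<phi> w"
    have "d \<noteq> 0"
      unfolding d_def using \<open>0 < \<rho>\<close> by (intro holomorphic_injective_imp_regular[OF hol open_ball inj]) auto
    define f where "f = (\<lambda>z. (\<phi> (w + of_real \<rho> * z) - \<phi> w) / (of_real \<rho> * d))"
    have inb: "w + of_real \<rho> * z \<in> ball w \<rho>" if "z \<in> ball 0 1" for z
      using that \<open>0 < \<rho>\<close> by (simp add: dist_norm norm_mult)
    have "(\<phi> \<circ> (\<lambda>z. w + of_real \<rho> * z)) holomorphic_on ball 0 1"
      by (rule holomorphic_on_compose_gen[OF _ hol]) (use inb in \<open>auto intro!: holomorphic_intros\<close>)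
    then have "f holomorphic_on ball 0 1"
      unfolding f_def o_def using \<open>0 < \<rho>\<close> \<open>d \<noteq> 0\<close> by (auto intro!: holomorphic_intros)
    moreover have "inj_on f (ball 0 1)"
      unfolding f_def using \<open>0 < \<rho>\<close> \<open>d \<noteq> 0\<close>
      by (intro inj_onI) (auto dest!: inj_onD[OF inj] intro: inb simp: divide_simps)
    moreover have "f 0 = 0" by (simp add: f_def)
    moreover have "deriv f 0 = 1"
    proof (rule DERIV_imp_deriv)
      have "(\<phi> has_field_derivative d) (at (w + of_real \<rho> * 0))"
        unfolding d_def using hol \<open>0 < \<rho>\<close> by (simp add: holomorphic_derivI[OF _ open_ball])
      then show "(f has_field_derivative 1) (at 0)"
        unfolding f_def using \<open>0 < \<rho>\<close> \<open>d \<noteq> 0\<close>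
        by (auto intro!: derivative_eq_intros DERIV_chain2[of \<phi>])
    qed
    ultimately have fC: "norm (f z) \<le> C" if "norm z \<le> 1/2" for z
      using C that by blast
    have bound: "norm (\<phi> v - \<phi> w) \<le> C * (\<rho> * norm d)" if "dist w v \<le> \<rho> / 2" for v
    proof -
      define z where "z = (v - w) / of_real \<rho>"
      have "norm z \<le> 1/2"
        using that \<open>0 < \<rho>\<close> by (simp add: z_def norm_divide dist_norm norm_minus_commute field_simps)
      moreover have "\<phi> v - \<phi> w = f z * (of_real \<rho> * d)"
        unfolding f_def z_def using \<open>0 < \<rho>\<close> \<open>d \<noteq> 0\<close> by simp
      ultimately show ?thesis
        using fC[of z] \<open>0 < \<rho>\<close> by (simp add: norm_mult mult_right_mono)
    qed
    have sub: "cball u (\<rho>/4) \<subseteq> ball w \<rho>"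
    proof
      fix x assume "x \<in> cball u (\<rho>/4)"
      then show "x \<in> ball w \<rho>"
        using u dist_triangle[of w x u] \<open>0 < \<rho>\<close> by simp
    qed
    have "norm ((deriv ^^ 1) (\<lambda>v. \<phi> v - \<phi> w) u) \<le> fact 1 * (C * (\<rho> * norm d)) / (\<rho>/4) ^ 1"
    proof (rule Cauchy_inequality)
      show "(\<lambda>v. \<phi> v - \<phi> w) holomorphic_on ball u (\<rho>/4)"
        by (intro holomorphic_intros holomorphic_on_subset[OF hol]) (use sub in auto)
      show "continuous_on (cball u (\<rho>/4)) (\<lambda>v. \<phi> v - \<phi> w)"
        by (intro continuous_intros continuous_on_subset[OF holomorphic_on_imp_continuous_on[OF hol]] sub)
      show "norm (\<phi> x - \<phi> w) \<le> C * (\<rho> * norm d)" if "norm (u - x) = \<rho> / 4" for x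
        using that u dist_triangle[of w x u] by (intro bound) (simp add: dist_norm)
    qed (use \<open>0 < \<rho>\<close> in auto)
    moreover have "deriv (\<lambda>v. \<phi> v - \<phi> w) u = deriv \<phi> u"
    proof (rule DERIV_imp_deriv)
      have "u \<in> cball u (\<rho>/4)" using \<open>0 < \<rho>\<close> by simp
      then have "u \<in> ball w \<rho>" using sub by blast
      then show "((\<lambda>v. \<phi> v - \<phi> w) has_field_derivative deriv \<phi> u) (at u)"
        by (auto intro!: derivative_eq_intros holomorphic_derivI[OF hol open_ball])
    qed
    ultimately have "norm (deriv \<phi> u) \<le> 4 * C * norm d"
      using \<open>0 < \<rho>\<close> by simp
    also have "\<dots> \<le> max 1 (4 * C) * norm d" by (simp add: mult_right_mono)
    finally show "norm (deriv \<phi> u) \<le> max 1 (4 * C) * norm (deriv \<phi> w)" by (simp add: d_def)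
  qed
qed

section \<open>Inverse branches over regular discs\<close>

lemma holomorphic_on_locally:
  assumes "\<And>z. z \<in> S \<Longrightarrow> \<exists>U h. open U \<and> z \<in> U \<and> h holomorphic_on U \<and> (\<forall>w\<in>U. g w = h w)"
  shows "g holomorphic_on S"
  unfolding holomorphic_on_def
proof
  fix z assume "z \<in> S"
  then obtain U h where U: "open U" "z \<in> U" "h holomorphic_on U" "\<And>w. w \<in> U \<Longrightarrow> g w = h w"
    using assms by metis
  then have "g holomorphic_on U"
    by (metis holomorphic_transform)
  then show "g field_differentiable at z within S"
    using U by (meson field_differentiable_at_within holomorphic_on_imp_differentiable_at)
qed

text \<open>One common value at a noncritical point of \<open>p\<close> suffices: local injectivity
  gives equality nearby and the identity theorem spreads it over \<open>S\<close>. It is applied to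
  \<open>f\<close> itself and to iterates of \<open>f\<close> after \<open>exp\<close>.\<close>

lemma lift_unique:
  assumes p: "p holomorphic_on UNIV"
    and S: "open S" "connected S"
    and g: "g1 holomorphic_on S" "g2 holomorphic_on S"
    and eq: "\<And>z. z \<in> S \<Longrightarrow> p (g1 z) = p (g2 z)"
    and w: "w \<in> S" "g1 w = g2 w" "deriv p (g1 w) \<noteq> 0"
    and z: "z \<in> S"
  shows "g1 z = g2 z"
proof -
  obtain r where r: "r > 0" "inj_on p (ball (g1 w) r)"
    using has_complex_derivative_locally_injective[OF p _ open_UNIV w(3)] by auto
  define U where "U = (S \<inter> g1 -` ball (g1 w) r) \<inter> (S \<inter> g2 -` ball (g1 w) r)"
  have "open U"
    unfolding U_def using g S
    by (intro open_Int continuous_open_preimage holomorphic_on_imp_continuous_on open_ball)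
  moreover have "w \<in> U" using w r by (simp add: U_def)
  moreover have "g1 x = g2 x" if "x \<in> U" for x
    using inj_onD[OF r(2) eq] that by (auto simp: U_def)
  moreover have "U \<subseteq> S" by (auto simp: U_def)
  ultimately show ?thesis
    using analytic_continuation_open[of U S g1 g2 z] S g z by blast
qed

lemma local_inverse:
  assumes f: "f holomorphic_on UNIV" and "deriv f z0 \<noteq> 0"
  obtains \<delta> \<epsilon> L where "\<delta> > 0" "\<epsilon> > 0" "L holomorphic_on ball (f z0) \<epsilon>"
    "\<And>w. w \<in> ball (f z0) \<epsilon> \<Longrightarrow> f (L w) = w"
    "\<And>z. z \<in> ball z0 \<delta> \<Longrightarrow> L (f z) = z"
proof -
  obtain r where r: "r > 0" "open (f ` ball z0 r)" "inj_on f (ball z0 r)"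
    using has_complex_derivative_locally_invertible[OF f _ open_UNIV assms(2)] by auto
  have holb: "f holomorphic_on ball z0 r"
    using f holomorphic_on_subset by blast
  obtain L where L: "L holomorphic_on f ` ball z0 r" "\<And>z. z \<in> ball z0 r \<Longrightarrow> L (f z) = z"
    using holomorphic_has_inverse[OF holb open_ball r(3)] by metis
  obtain \<epsilon> where "\<epsilon> > 0" "ball (f z0) \<epsilon> \<subseteq> f ` ball z0 r"
    using r openE[OF r(2), of "f z0"] by (metis centre_in_ball imageI)
  then show ?thesis
    using that[OF r(1) \<open>\<epsilon> > 0\<close>, of L] L holomorphic_on_subset by force
qed

text \<open>Strict convexity of the disc, by the parallelogram law. Two overlapping discs of equal
  radius centred on a circle therefore share a point inside the circle.\<close>

lemma norm_midpoint_less: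
  fixes a b :: "'a::real_inner"
  assumes "norm a = R" "norm b = R" "a \<noteq> b"
  shows "norm ((1/2) *\<^sub>R (a + b)) < R"
proof -
  have "(norm (a + b))\<^sup>2 + (norm (a - b))\<^sup>2 = (2 * R)\<^sup>2"
  proof -
    have "(norm (a + b))\<^sup>2 + (norm (a - b))\<^sup>2 = 2 * (norm a)\<^sup>2 + 2 * (norm b)\<^sup>2"
      by (simp add: power2_norm_eq_inner inner_add inner_diff inner_commute)
    then show ?thesis using assms by (simp add: power_mult_distrib)
  qed
  moreover have "(norm (a - b))\<^sup>2 > 0" using assms by simp
  ultimately have "(norm (a + b))\<^sup>2 < (2 * R)\<^sup>2" by linarith
  then have "norm (a + b) < 2 * R"
    using assms(1) by (intro power2_less_imp_less[of _ "2 * R"]) auto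
  then show ?thesis by simp
qed

section \<open>Continuation of inverse branches over discs of regular values\<close>

locale entire_inverse_branches =
  fixes f :: "complex \<Rightarrow> complex" and D :: "complex set"
  assumes f: "f holomorphic_on UNIV"
    and D: "open D"
    and regular: "D \<inter> (critical_values f \<union> asymptotic_values f) = {}"
begin

definition branch :: "complex \<Rightarrow> complex \<Rightarrow> real \<Rightarrow> (complex \<Rightarrow> complex) \<Rightarrow> bool" where
  "branch u w r g \<longleftrightarrow> g holomorphic_on ball w r \<and> g w = u \<and> (\<forall>z\<in>ball w r. f (g z) = z)"

lemma deriv_nonzero: "f z \<in> D \<Longrightarrow> deriv f z \<noteq> 0"
  using regular by (auto simp: critical_values_def)

lemma lifts_unique:
  assumes "open S" "connected S" "S \<subseteq> D" "g1 holomorphic_on S" "g2 holomorphic_on S"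
    and "\<And>z. z \<in> S \<Longrightarrow> f (g1 z) = z" "\<And>z. z \<in> S \<Longrightarrow> f (g2 z) = z"
    and "w \<in> S" "g1 w = g2 w" "z \<in> S"
  shows "g1 z = g2 z"
  using lift_unique[OF f assms(1,2,4,5), of w z] assms deriv_nonzero[of "g1 w"] by auto

text \<open>A bounded sequence on the image of a radius suffices here: at a single point of it the local
  inverse already agrees with the branch.\<close>

lemma branch_extends_at_boundary:
  assumes g: "branch u w R g" and "0 < R" and RD: "cball w R \<subseteq> D" and \<zeta>: "dist w \<zeta> = R"
  obtains \<epsilon> L where "\<epsilon> > 0" "L holomorphic_on ball \<zeta> \<epsilon>" "\<And>z. z \<in> ball \<zeta> \<epsilon> \<Longrightarrow> f (L z) = z"
    "\<And>z. z \<in> ball \<zeta> \<epsilon> \<Longrightarrow> z \<in> ball w R \<Longrightarrow> L z = g z"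
proof -
  define p where "p = (\<lambda>t::real. w + of_real t * (\<zeta> - w))"
  have nz: "norm (\<zeta> - w) = R" using \<zeta> by (simp add: dist_norm norm_minus_commute)
  have pb: "p t \<in> ball w R" if "0 \<le> t" "t < 1" for t
    using that nz \<open>0 < R\<close> by (simp add: p_def dist_norm norm_mult)
  have fg: "f (g (p t)) = p t" if "0 \<le> t" "t < 1" for t
    using g pb[OF that] by (auto simp: branch_def)
  have contp: "continuous_on A p" for A
    unfolding p_def by (intro continuous_intros)
  have contg: "continuous_on (ball w R) g"
    using g holomorphic_on_imp_continuous_on by (auto simp: branch_def)
  have plim: "(p \<longlongrightarrow> \<zeta>) (at_left 1)"
    unfolding p_def by (auto intro!: tendsto_eq_intros)
  have ev: "eventually (\<lambda>t::real. 0 \<le> t \<and> t < 1) (at_left 1)"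
    using eventually_at_left[of 0 "1::real"] by (auto intro!: exI[of _ 0])
  \<comment> \<open>Otherwise the image of the radius would be a path to infinity along which
    \<open>f\<close> tends to \<zeta>, making \<zeta> an asymptotic value in
    \<open>D\<close>.\<close>
  have "\<not> filterlim (\<lambda>t. g (p t)) at_infinity (at_left 1)"
  proof
    assume inf: "filterlim (\<lambda>t. g (p t)) at_infinity (at_left 1)"
    have "continuous_on {0..<1} (\<lambda>t. g (p t))"
      by (rule continuous_on_compose2[OF contg contp]) (use pb in auto)
    moreover have "((\<lambda>t. f (g (p t))) \<longlongrightarrow> \<zeta>) (at_left 1)"
      by (rule Lim_transform_eventually[OF plim]) (use ev fg in \<open>auto elim!: eventually_mono\<close>)
    ultimately have "\<zeta> \<in> asymptotic_values f"
      unfolding asymptotic_values_def using inf by auto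
    moreover have "\<zeta> \<in> D" using RD \<zeta> by auto
    ultimately show False using regular by auto
  qed
  then obtain B where "B > 0" and "\<not> eventually (\<lambda>t. B \<le> norm (g (p t))) (at_left 1)"
    by (auto simp: filterlim_at_infinity[of 0])
  then have fr: "frequently (\<lambda>t. norm (g (p t)) < B) (at_left 1)"
    by (simp add: frequently_def not_less)
  have "\<exists>t. 0 \<le> t \<and> t < 1 \<and> 1 - 1 / real (Suc n) < t \<and> norm (g (p t)) < B" for n
  proof -
    have "eventually (\<lambda>t::real. 1 - 1 / real (Suc n) < t) (at_left 1)"
      by (auto simp: eventually_at_left[of 0] intro!: exI[of _ "1 - 1 / real (Suc n)"])
    then have "frequently (\<lambda>t. norm (g (p t)) < B \<and> (1 - 1 / real (Suc n) < t \<and> (0 \<le> t \<and> t < 1))) (at_left 1)"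
      using frequently_eventually_frequently[OF fr eventually_conj[OF _ ev]] by blast
    then show ?thesis using frequently_ex by blast
  qed
  then obtain t where t: "\<And>n. 0 \<le> t n" "\<And>n. t n < 1" "\<And>n. 1 - 1 / real (Suc n) < t n"
    "\<And>n. norm (g (p (t n))) < B"
    by metis
  have "bounded (range (\<lambda>n. g (p (t n))))"
    using t(4) by (auto simp: bounded_iff intro!: exI[of _ B] less_imp_le)
  then obtain z s where s: "strict_mono (s :: nat \<Rightarrow> nat)" "((\<lambda>n. g (p (t n))) \<circ> s) \<longlonglongrightarrow> z"
    using bounded_imp_convergent_subsequence by blast
  have "t \<longlonglongrightarrow> 1"
  proof (rule tendsto_sandwich)
    show "eventually (\<lambda>n. 1 - 1 / real (Suc n) \<le> t n) sequentially"
      using t(3) by (intro always_eventually allI less_imp_le)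
    show "eventually (\<lambda>n. t n \<le> 1) sequentially"
      using t(2) by (intro always_eventually allI less_imp_le)
    show "(\<lambda>n. 1 - 1 / real (Suc n)) \<longlonglongrightarrow> 1"
      using tendsto_diff[OF tendsto_const LIMSEQ_Suc[OF lim_1_over_n], of 1] by simp
  qed simp
  then have ts: "(\<lambda>n. t (s n)) \<longlonglongrightarrow> 1"
    using LIMSEQ_subseq_LIMSEQ[OF _ s(1)] by (simp add: o_def)
  then have ps: "(\<lambda>n. p (t (s n))) \<longlonglongrightarrow> \<zeta>"
    unfolding p_def by (auto intro!: tendsto_eq_intros)
  have gs: "(\<lambda>n. g (p (t (s n)))) \<longlonglongrightarrow> z"
    using s(2) by (simp add: o_def)
  have "isCont f z"
    using holomorphic_on_imp_continuous_on[OF f] by (simp add: continuous_on_eq_continuous_at)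
  then have "(\<lambda>n. f (g (p (t (s n))))) \<longlonglongrightarrow> f z"
    using gs by (rule isCont_tendsto_compose)
  then have "(\<lambda>n. p (t (s n))) \<longlonglongrightarrow> f z"
    using fg t by simp
  then have fz: "f z = \<zeta>"
    using ps LIMSEQ_unique by blast
  have "\<zeta> \<in> D" using RD \<zeta> by auto
  then obtain \<delta> \<epsilon> L where L: "\<delta> > 0" "\<epsilon> > 0" "L holomorphic_on ball \<zeta> \<epsilon>"
    "\<And>x. x \<in> ball \<zeta> \<epsilon> \<Longrightarrow> f (L x) = x" "\<And>x. x \<in> ball z \<delta> \<Longrightarrow> L (f x) = x"
    using local_inverse[OF f deriv_nonzero, of z] unfolding fz by blast
  have "eventually (\<lambda>n. g (p (t (s n))) \<in> ball z \<delta> \<and> p (t (s n)) \<in> ball \<zeta> \<epsilon>) sequentially"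
    by (intro eventually_conj topological_tendstoD[OF gs] topological_tendstoD[OF ps]) (use L in auto)
  then obtain n where n: "g (p (t (s n))) \<in> ball z \<delta>" "p (t (s n)) \<in> ball \<zeta> \<epsilon>"
    by (auto dest: eventually_happens)
  define x where "x = p (t (s n))"
  have x: "x \<in> ball w R \<inter> ball \<zeta> \<epsilon>" "L x = g x"
    using n L(5)[OF n(1)] pb fg t unfolding x_def by auto
  have "L y = g y" if "y \<in> ball w R \<inter> ball \<zeta> \<epsilon>" for y
  proof (rule lifts_unique[of "ball w R \<inter> ball \<zeta> \<epsilon>" L g x])
    show "L holomorphic_on ball w R \<inter> ball \<zeta> \<epsilon>" "g holomorphic_on ball w R \<inter> ball \<zeta> \<epsilon>"
      using L(3) g holomorphic_on_subset by (auto simp: branch_def)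
  qed (use x that L g RD in \<open>auto simp: branch_def intro!: convex_connected convex_Int\<close>)
  then show ?thesis
    using that[OF L(2,3,4)] by blast
qed

text \<open>The local extensions at the points of the boundary circle are first cut down to a common
  radius \<open>e\<close>, so that midpoints of centres decide whether they agree, and are then
  glued.\<close>

lemma branch_extends:
  assumes g: "branch u w R g" and "0 < R" and RD: "cball w R \<subseteq> D"
  obtains R' g' where "R' > R" "branch u w R' g'"
proof -
  define Q where "Q = (\<lambda>\<zeta> e M. M holomorphic_on ball \<zeta> e \<and> (\<forall>z\<in>ball \<zeta> e. f (M z) = z) \<and>
      (\<forall>z\<in>ball \<zeta> e. z \<in> ball w R \<longrightarrow> M z = g z))"
  have Q_ex: "\<exists>\<epsilon> M. \<epsilon> > 0 \<and> Q \<zeta> \<epsilon> M" if "\<zeta> \<in> sphere w R" for \<zeta>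
  proof -
    have "dist w \<zeta> = R" using that by simp
    then obtain \<epsilon> M where "\<epsilon> > 0" "M holomorphic_on ball \<zeta> \<epsilon>" "\<And>z. z \<in> ball \<zeta> \<epsilon> \<Longrightarrow> f (M z) = z"
      "\<And>z. z \<in> ball \<zeta> \<epsilon> \<Longrightarrow> z \<in> ball w R \<Longrightarrow> M z = g z"
      using branch_extends_at_boundary[OF assms] by blast
    then show ?thesis unfolding Q_def by blast
  qed
  have Q_mono: "Q \<xi> d M" if "Q \<zeta> e M" "ball \<xi> d \<subseteq> ball \<zeta> e" for \<zeta> \<xi> d e M
    using that holomorphic_on_subset unfolding Q_def by blast
  from Q_ex obtain \<epsilon> L where L: "\<And>\<zeta>. \<zeta> \<in> sphere w R \<Longrightarrow> \<epsilon> \<zeta> > (0::real)"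
    "\<And>\<zeta>. \<zeta> \<in> sphere w R \<Longrightarrow> Q \<zeta> (\<epsilon> \<zeta>) (L \<zeta>)"
    by metis
  \<comment> \<open>A Lebesgue number of the cover of the circle by the discs of varying
    radius.\<close>
  obtain e1 where e1: "e1 > 0" "\<And>\<zeta>. \<zeta> \<in> sphere w R \<Longrightarrow> \<exists>\<xi>\<in>sphere w R. ball \<zeta> e1 \<subseteq> ball \<xi> (\<epsilon> \<xi>)"
  proof (rule Heine_Borel_lemma[OF compact_sphere, of w R "(\<lambda>\<xi>. ball \<xi> (\<epsilon> \<xi>)) ` sphere w R"])
    show "sphere w R \<subseteq> \<Union> ((\<lambda>\<xi>. ball \<xi> (\<epsilon> \<xi>)) ` sphere w R)"
      using L(1) by (intro subsetI UN_I) (assumption, simp)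
  qed (use that in \<open>force+\<close>)
  obtain e2 where e2: "e2 > 0" "\<And>\<zeta>. \<zeta> \<in> sphere w R \<Longrightarrow> ball \<zeta> e2 \<subseteq> D"
  proof (rule Heine_Borel_lemma[OF compact_sphere, of w R "{D}"])
    show "sphere w R \<subseteq> \<Union> {D}" using RD sphere_cball by force
  qed (use that D in \<open>auto\<close>)
  define e where "e = min e1 e2"
  have "e > 0" using e1 e2 by (simp add: e_def)
  have "\<exists>M. Q \<zeta> e M" if \<zeta>: "\<zeta> \<in> sphere w R" for \<zeta>
  proof -
    obtain \<xi> where \<xi>: "\<xi> \<in> sphere w R" "ball \<zeta> e1 \<subseteq> ball \<xi> (\<epsilon> \<xi>)"
      using e1(2)[OF \<zeta>] by blast
    then have "ball \<zeta> e \<subseteq> ball \<xi> (\<epsilon> \<xi>)" by (auto simp: e_def)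
    then show ?thesis using Q_mono[OF L(2)[OF \<xi>(1)]] by blast
  qed
  then obtain M where QM: "\<And>\<zeta>. \<zeta> \<in> sphere w R \<Longrightarrow> Q \<zeta> e (M \<zeta>)"
    by metis
  have M: "M \<zeta> holomorphic_on ball \<zeta> e" "z \<in> ball \<zeta> e \<Longrightarrow> f (M \<zeta> z) = z"
    "z \<in> ball \<zeta> e \<Longrightarrow> z \<in> ball w R \<Longrightarrow> M \<zeta> z = g z" if "\<zeta> \<in> sphere w R" for \<zeta> z
    using QM[OF that] by (simp_all add: Q_def)
  \<comment> \<open>The overlap of the two discs contains the midpoint of their centres, which lies
    inside the old disc, where both functions equal \<open>g\<close>.\<close>
  have Magree: "M \<zeta> z = M \<xi> z"
    if "\<zeta> \<in> sphere w R" "\<xi> \<in> sphere w R" "z \<in> ball \<zeta> e" "z \<in> ball \<xi> e" for \<zeta> \<xi> z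
  proof (cases "\<zeta> = \<xi>")
    case False
    define m where "m = midpoint \<zeta> \<xi>"
    have "m - w = (1/2) *\<^sub>R ((\<zeta> - w) + (\<xi> - w))"
      by (simp add: m_def midpoint_def complex_eq_iff algebra_simps)
    then have "norm (m - w) < R"
      using norm_midpoint_less[of "\<zeta> - w" R "\<xi> - w"] that False
      by (simp add: dist_norm norm_minus_commute)
    then have mw: "m \<in> ball w R" by (simp add: dist_norm norm_minus_commute)
    have "dist \<zeta> \<xi> < 2 * e"
      using that dist_triangle[of \<zeta> \<xi> z] by (simp add: dist_commute)
    then have m: "m \<in> ball \<zeta> e \<inter> ball \<xi> e"
      by (simp add: m_def dist_midpoint)
    show ?thesis
    proof (rule lifts_unique[of "ball \<zeta> e \<inter> ball \<xi> e" "M \<zeta>" "M \<xi>" m])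
      show "M \<zeta> holomorphic_on ball \<zeta> e \<inter> ball \<xi> e" "M \<xi> holomorphic_on ball \<zeta> e \<inter> ball \<xi> e"
        using M(1)[OF that(1)] M(1)[OF that(2)] holomorphic_on_subset by (meson Int_lower1 Int_lower2)+
      show "ball \<zeta> e \<inter> ball \<xi> e \<subseteq> D" using e2(2)[OF that(1)] by (auto simp: e_def)
      show "M \<zeta> m = M \<xi> m" using M(3)[OF that(1), of m] M(3)[OF that(2), of m] m mw by simp
    qed (use m that M(2)[OF that(1)] M(2)[OF that(2)] in \<open>auto intro!: convex_connected convex_Int\<close>)
  qed auto
  \<comment> \<open>Radial projection to the circle selects, for each new point, the local extension
    to be used there.\<close>
  define \<pi> where "\<pi> = (\<lambda>z. w + of_real (R / dist w z) * (z - w))"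
  have \<pi>: "\<pi> z \<in> sphere w R" "z \<in> ball (\<pi> z) e" if "R \<le> dist w z" "dist w z < R + e" for z
  proof -
    have pos: "dist w z > 0" using that \<open>0 < R\<close> by linarith
    show "\<pi> z \<in> sphere w R"
      using pos \<open>0 < R\<close> by (simp add: \<pi>_def dist_norm norm_mult norm_divide norm_minus_commute)
    have "z - \<pi> z = of_real (1 - R / dist w z) * (z - w)"
      by (simp add: \<pi>_def algebra_simps)
    then have "norm (z - \<pi> z) = \<bar>1 - R / dist w z\<bar> * dist w z"
      by (simp only: norm_mult norm_of_real dist_norm norm_minus_commute)
    also have "\<dots> = dist w z - R"
      using that pos by (simp add: field_simps abs_if)
    finally show "z \<in> ball (\<pi> z) e" using that by (simp add: dist_norm norm_minus_commute)
  qed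
  define g' where "g' = (\<lambda>z. if dist w z < R then g z else M (\<pi> z) z)"
  have g'_eq: "g' z = M \<zeta> z" if "\<zeta> \<in> sphere w R" "z \<in> ball \<zeta> e" "dist w z < R + e" for \<zeta> z
  proof (cases "dist w z < R")
    case True
    then show ?thesis using M(3)[OF that(1,2)] by (simp add: g'_def)
  next
    case False
    then have "\<pi> z \<in> sphere w R" "z \<in> ball (\<pi> z) e" using \<pi>[of z] that(3) by simp_all
    then show ?thesis using Magree[OF _ that(1) _ that(2)] False by (simp add: g'_def)
  qed
  have "g' holomorphic_on ball w (R + e)"
  proof (rule holomorphic_on_locally)
    fix z assume z: "z \<in> ball w (R + e)"
    show "\<exists>U h. open U \<and> z \<in> U \<and> h holomorphic_on U \<and> (\<forall>w\<in>U. g' w = h w)"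
    proof (cases "dist w z < R")
      case True
      have "g holomorphic_on ball w R" using g by (simp add: branch_def)
      moreover have "\<forall>x\<in>ball w R. g' x = g x" by (simp add: g'_def)
      moreover have "z \<in> ball w R" using True by simp
      ultimately show ?thesis using open_ball by blast
    next
      case False
      then have \<zeta>: "\<pi> z \<in> sphere w R" "z \<in> ball (\<pi> z) e" using \<pi>[of z] z by simp_all
      define U where "U = ball (\<pi> z) e \<inter> ball w (R + e)"
      have "open U" "z \<in> U" using \<zeta>(2) z by (simp_all add: U_def open_Int)
      moreover have "M (\<pi> z) holomorphic_on U"
        using M(1)[OF \<zeta>(1)] by (rule holomorphic_on_subset) (simp add: U_def)
      moreover have "\<forall>x\<in>U. g' x = M (\<pi> z) x"
        using g'_eq[OF \<zeta>(1)] by (simp add: U_def)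
      ultimately show ?thesis by blast
    qed
  qed
  moreover have "f (g' z) = z" if "z \<in> ball w (R + e)" for z
  proof (cases "dist w z < R")
    case True
    then show ?thesis using g by (simp add: g'_def branch_def)
  next
    case False
    then have "\<pi> z \<in> sphere w R" "z \<in> ball (\<pi> z) e" using \<pi>[of z] that by simp_all
    then show ?thesis using M(2) False by (simp add: g'_def)
  qed
  moreover have "g' w = u" using g \<open>0 < R\<close> by (simp add: g'_def branch_def)
  ultimately have "branch u w (R + e) g'" by (simp add: branch_def)
  then show ?thesis using that[of "R + e" g'] \<open>e > 0\<close> by simp
qed

lemma branch_unique:
  assumes "branch u w r g" "branch u w r' g'" "ball w r \<subseteq> D" "z \<in> ball w r" "z \<in> ball w r'"
  shows "g z = g' z"
proof (rule lifts_unique[of "ball w r \<inter> ball w r'" g g' w])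
  have "0 < r" "0 < r'" using assms(4,5) by (simp_all add: le_less_trans[OF zero_le_dist])
  then show "w \<in> ball w r \<inter> ball w r'" by simp
  show "g holomorphic_on ball w r \<inter> ball w r'" "g' holomorphic_on ball w r \<inter> ball w r'"
    using assms holomorphic_on_subset by (auto simp: branch_def)
qed (use assms in \<open>auto simp: branch_def intro!: convex_connected convex_Int\<close>)

text \<open>Continuation in the radius: branches of different radii agree, so they combine to a
  branch on the disc whose radius \<open>R\<close> is the supremum. If \<open>R\<close> were below
  \<rho>, \<open>branch_extends\<close> would contradict maximality.\<close>

lemma branch_exists:
  assumes "ball w \<rho> \<subseteq> D" "0 < \<rho>" "f u = w"
  obtains g where "branch u w \<rho> g"
proof -
  define A where "A = {r. 0 < r \<and> r \<le> \<rho> \<and> (\<exists>g. branch u w r g)}"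
  have "w \<in> D" using assms by auto
  obtain \<delta> \<epsilon> L where L: "\<delta> > 0" "\<epsilon> > 0" "L holomorphic_on ball w \<epsilon>"
    "\<And>x. x \<in> ball w \<epsilon> \<Longrightarrow> f (L x) = x" "\<And>x. x \<in> ball u \<delta> \<Longrightarrow> L (f x) = x"
    using local_inverse[OF f deriv_nonzero, of u] assms(3) \<open>w \<in> D\<close> by metis
  have "L holomorphic_on ball w (min \<epsilon> \<rho>)"
    by (rule holomorphic_on_subset[OF L(3)]) auto
  then have "branch u w (min \<epsilon> \<rho>) L"
    using L(1,4) L(5)[of u] assms(3) by (auto simp: branch_def)
  then have "min \<epsilon> \<rho> \<in> A"
    unfolding A_def using L(2) assms(2) by auto
  then have "A \<noteq> {}" by blast
  have bdd: "bdd_above A" by (auto simp: A_def bdd_above_def)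
  define R where "R = Sup A"
  have "R > 0"
    using cSup_upper[OF \<open>min \<epsilon> \<rho> \<in> A\<close> bdd] L(2) assms(2) by (auto simp: R_def)
  have "R \<le> \<rho>"
    unfolding R_def by (rule cSup_least[OF \<open>A \<noteq> {}\<close>]) (auto simp: A_def)
  have "\<exists>r g. s < r \<and> r \<le> \<rho> \<and> branch u w r g" if "s < R" for s
    using less_cSupD[OF \<open>A \<noteq> {}\<close>] that by (force simp: R_def A_def)
  then obtain r g where rg: "\<And>s. s < R \<Longrightarrow> s < r s" "\<And>s. s < R \<Longrightarrow> r s \<le> \<rho>" "\<And>s. s < R \<Longrightarrow> branch u w (r s) (g s)"
    by metis
  \<comment> \<open>The branch indexed by \<open>dist w z\<close> lives on a disc of larger radius,
    so it is defined at \<open>z\<close>.\<close>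
  define G where "G = (\<lambda>z. g (dist w z) z)"
  have agree: "G z = g s z" if "s < R" "z \<in> ball w (r s)" "dist w z < R" for s z
    unfolding G_def
  proof (rule branch_unique[OF rg(3)[OF that(3)] rg(3)[OF that(1)]])
    show "ball w (r (dist w z)) \<subseteq> D"
      using rg(2)[OF that(3)] assms(1) by (meson order_trans subset_ball)
    show "z \<in> ball w (r (dist w z))" using rg(1)[OF that(3)] by simp
  qed (use that in auto)
  have "branch u w R G"
    unfolding branch_def
  proof (intro conjI ballI)
    show "G holomorphic_on ball w R"
    proof (rule holomorphic_on_locally)
      fix z assume "z \<in> ball w R"
      then have zR: "dist w z < R" by simp
      have "g (dist w z) holomorphic_on ball w (r (dist w z))"
        using rg(3)[OF zR] by (simp add: branch_def)
      then have "g (dist w z) holomorphic_on ball w (r (dist w z)) \<inter> ball w R"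
        by (rule holomorphic_on_subset) simp
      then show "\<exists>U h. open U \<and> z \<in> U \<and> h holomorphic_on U \<and> (\<forall>w\<in>U. G w = h w)"
        by (intro exI[of _ "ball w (r (dist w z)) \<inter> ball w R"] exI[of _ "g (dist w z)"])
          (use agree[OF zR] rg(1)[OF zR] zR in auto)
    qed
    show "G w = u" using rg(3)[of 0] \<open>R > 0\<close> by (simp add: G_def branch_def)
    show "f (G z) = z" if "z \<in> ball w R" for z
      using rg(1,3)[of "dist w z"] that by (simp add: G_def branch_def)
  qed
  moreover have "R = \<rho>"
  proof (rule ccontr)
    assume "R \<noteq> \<rho>"
    then have "R < \<rho>" using \<open>R \<le> \<rho>\<close> by simp
    then have "cball w R \<subseteq> ball w \<rho>" by auto
    then obtain R' g' where R': "R' > R" "branch u w R' g'"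
      using branch_extends[OF \<open>branch u w R G\<close> \<open>R > 0\<close>] assms(1) by (metis subset_trans)
    have "g' holomorphic_on ball w (min R' \<rho>)"
      by (rule holomorphic_on_subset[of g' "ball w R'"]) (use R'(2) in \<open>auto simp: branch_def\<close>)
    then have "branch u w (min R' \<rho>) g'"
      using R'(2) by (simp add: branch_def)
    then have "min R' \<rho> \<in> A" using R'(1) \<open>R > 0\<close> assms(2) by (auto simp: A_def)
    then have "min R' \<rho> \<le> R" unfolding R_def using cSup_upper bdd by blast
    then show False using R'(1) \<open>R < \<rho>\<close> by simp
  qed
  ultimately show ?thesis using that by blast
qed

section \<open>The covering property over the regular values, and lifting\<close>

lemma ball_subset_range:
  assumes "ball w \<rho> \<subseteq> D" "w \<in> range f"
  shows "ball w \<rho> \<subseteq> range f"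
proof (cases "0 < \<rho>")
  case True
  obtain u where "f u = w" using assms(2) by auto
  then obtain g where "branch u w \<rho> g" using branch_exists[OF assms(1) True] by blast
  then have "z = f (g z)" if "z \<in> ball w \<rho>" for z using that by (auto simp: branch_def)
  then show ?thesis by blast
qed (simp add: ball_empty)

text \<open>A neighbourhood is evenly covered as soon as every preimage of each of its points
  carries a branch defined on all of it; the images of these branches are the sheets.\<close>

lemma covering_space_preimage: "covering_space (f -` D) f (D \<inter> range f)"
proof (rule covering_spaceI)
  show "continuous_on (f -` D) f"
    using f holomorphic_on_imp_continuous_on continuous_on_subset by blast
  show "f ` (f -` D) = D \<inter> range f" by auto
  fix x assume x: "x \<in> D \<inter> range f"
  then obtain \<rho> where "\<rho> > 0" "ball x \<rho> \<subseteq> D" using D by (meson IntD1 openE)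
  \<comment> \<open>Each point of the \<delta>-disc \<open>T\<close> is then the centre of a disc of
    radius 2 \<delta> that contains \<open>T\<close> and stays in \<open>D\<close>.\<close>
  then obtain \<delta> where \<delta>: "\<delta> > 0" "ball x (3 * \<delta>) \<subseteq> D"
    using that[of "\<rho> / 3"] by simp
  define T where "T = ball x \<delta>"
  have TD: "T \<subseteq> D" using \<delta> by (auto simp: T_def)
  have "T \<subseteq> range f" using ball_subset_range[of x \<delta>] TD x by (auto simp: T_def)
  have "\<exists>g. g holomorphic_on T \<and> g (f u) = u \<and> (\<forall>z\<in>T. f (g z) = z)" if u: "f u \<in> T" for u
  proof -
    have sub: "ball (f u) (2 * \<delta>) \<subseteq> D"
    proof
      fix y assume "y \<in> ball (f u) (2 * \<delta>)"
      then have "y \<in> ball x (3 * \<delta>)"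
        using u dist_triangle[of x y "f u"] by (simp add: T_def)
      then show "y \<in> D" using \<delta>(2) by blast
    qed
    obtain g where g: "branch u (f u) (2 * \<delta>) g"
      using branch_exists[OF sub _ refl] \<delta>(1) by auto
    have "T \<subseteq> ball (f u) (2 * \<delta>)"
    proof
      fix y assume "y \<in> T"
      then show "y \<in> ball (f u) (2 * \<delta>)"
        using u dist_triangle[of "f u" y x] by (simp add: T_def dist_commute)
    qed
    then show ?thesis using g holomorphic_on_subset unfolding branch_def by blast
  qed
  then obtain g where g: "\<And>u. f u \<in> T \<Longrightarrow> g u holomorphic_on T"
    "\<And>u. f u \<in> T \<Longrightarrow> g u (f u) = u" "\<And>u z. f u \<in> T \<Longrightarrow> z \<in> T \<Longrightarrow> f (g u z) = z"
    by metis
  have conn: "connected T" "open T" by (auto simp: T_def)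
  \<comment> \<open>Different \<open>u\<close> may yield the same sheet. As a set of images the
    sheets are pairwise disjoint, since sheets that meet coincide by uniqueness.\<close>
  define v where "v = (\<lambda>u. g u ` T) ` (f -` T)"
  have "\<Union> v = f -` D \<inter> f -` T"
  proof (intro equalityI subsetI)
    fix y assume "y \<in> \<Union> v"
    then obtain u z where "f u \<in> T" "z \<in> T" "y = g u z" by (auto simp: v_def)
    then show "y \<in> f -` D \<inter> f -` T" using g(3)[of u z] TD by auto
  next
    fix y assume "y \<in> f -` D \<inter> f -` T"
    then have "f y \<in> T" "g y (f y) = y" using g(2) by auto
    then show "y \<in> \<Union> v" unfolding v_def by (intro UN_I[of y]) (auto intro!: image_eqI[of y "g y" "f y"])
  qed
  moreover have "openin (top_of_set (f -` D)) A" if A: "A \<in> v" for A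
  proof -
    obtain u where u: "f u \<in> T" "A = g u ` T" using A by (auto simp: v_def)
    have "inj_on (g u) T" using g(3)[OF u(1)] by (metis inj_onI)
    then have "open A"
      using open_mapping_thm3[OF g(1)[OF u(1)] conn(2)] u by simp
    moreover have "A \<subseteq> f -` D" using u g(3) TD by auto
    ultimately show ?thesis by (simp add: open_subset)
  qed
  moreover have "pairwise disjnt v"
    unfolding pairwise_def
  proof (intro ballI impI)
    fix A B assume "A \<in> v" "B \<in> v" "A \<noteq> B"
    then obtain u u' where u: "f u \<in> T" "A = g u ` T" and u': "f u' \<in> T" "B = g u' ` T"
      by (auto simp: v_def)
    show "disjnt A B"
    proof (rule ccontr)
      assume "\<not> disjnt A B"
      then obtain a b where ab: "a \<in> T" "b \<in> T" "g u a = g u' b"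
        using u u' by (auto simp: disjnt_def)
      then have "a = b" using g(3) u u' by metis
      have "g u z = g u' z" if "z \<in> T" for z
        by (rule lifts_unique[of T "g u" "g u'" a])
          (use ab \<open>a = b\<close> that conn TD g(1)[OF u(1)] g(1)[OF u'(1)] g(3)[OF u(1)] g(3)[OF u'(1)] in auto)
      then show False using u u' \<open>A \<noteq> B\<close> by auto
    qed
  qed
  moreover have "\<exists>q. homeomorphism A T f q" if A: "A \<in> v" for A
  proof -
    obtain u where u: "f u \<in> T" "A = g u ` T" using A by (auto simp: v_def)
    have "homeomorphism A T f (g u)"
      unfolding homeomorphism_def u(2)
    proof (intro conjI)
      show "continuous_on (g u ` T) f"
        by (rule continuous_on_subset[OF holomorphic_on_imp_continuous_on[OF f]]) simp
      show "continuous_on T (g u)"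
        by (rule holomorphic_on_imp_continuous_on[OF g(1)[OF u(1)]])
    qed (use g(3)[OF u(1)] in \<open>simp_all add: image_image\<close>)
    then show ?thesis by blast
  qed
  moreover have "x \<in> T" "openin (top_of_set (D \<inter> range f)) T"
    using \<delta>(1) TD \<open>T \<subseteq> range f\<close> conn(2) by (auto simp: T_def intro: open_subset)
  ultimately show "\<exists>T. x \<in> T \<and> openin (top_of_set (D \<inter> range f)) T \<and>
      (\<exists>v. \<Union> v = f -` D \<inter> f -` T \<and> (\<forall>u\<in>v. openin (top_of_set (f -` D)) u) \<and>
        pairwise disjnt v \<and> (\<forall>u\<in>v. \<exists>q. homeomorphism u T f q))"
    by (intro exI[of _ T] conjI exI[of _ v] ballI)
qed

text \<open>Both \<open>D \<inter> range f\<close> and \<open>D - range f\<close> are open: a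
  regular disc centred at a value consists of values, so a value too close to a point of
  \<open>D\<close> would make that point a value.\<close>

lemma subset_range:
  assumes "connected D" "D \<inter> range f \<noteq> {}"
  shows "D \<subseteq> range f"
proof (rule ccontr)
  assume "\<not> D \<subseteq> range f"
  have "open (D \<inter> range f)"
    unfolding open_contains_ball
  proof
    fix y assume y: "y \<in> D \<inter> range f"
    then obtain \<rho> where \<rho>: "\<rho> > 0" "ball y \<rho> \<subseteq> D" using D by (meson IntD1 openE)
    then show "\<exists>e>0. ball y e \<subseteq> D \<inter> range f"
      using ball_subset_range[of y \<rho>] y by (intro exI[of _ \<rho>]) auto
  qed
  moreover have "open (D - range f)"
    unfolding open_contains_ball
  proof
    fix y assume y: "y \<in> D - range f"
    then obtain \<rho> where \<rho>: "\<rho> > 0" "ball y \<rho> \<subseteq> D" using D by (meson DiffD1 openE)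
    have "x \<notin> range f" if x: "x \<in> ball y (\<rho>/2)" for x
    proof
      assume "x \<in> range f"
      have "ball x (\<rho>/2) \<subseteq> D"
      proof
        fix z assume "z \<in> ball x (\<rho>/2)"
        then have "z \<in> ball y \<rho>" using x dist_triangle[of y z x] by simp
        then show "z \<in> D" using \<rho> by blast
      qed
      then have "ball x (\<rho>/2) \<subseteq> range f" using ball_subset_range \<open>x \<in> range f\<close> by blast
      moreover have "y \<in> ball x (\<rho>/2)" using x by (simp add: dist_commute)
      ultimately show False using y by blast
    qed
    then show "\<exists>e>0. ball y e \<subseteq> D - range f"
      using \<rho> by (intro exI[of _ "\<rho>/2"]) fastforce
  qed
  ultimately show False
    using connectedD[OF assms(1), of "D \<inter> range f" "D - range f"] assms(2) \<open>\<not> D \<subseteq> range f\<close> by blast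
qed

text \<open>A convex \<open>S\<close> is simply connected, so \<open>h\<close> lifts continuously
  through the covering; locally the lift is a holomorphic inverse of \<open>f\<close> after
  \<open>h\<close>.\<close>

lemma lift_exists:
  assumes "connected D" and S: "convex S" "open S"
    and h: "h holomorphic_on S" "h ` S \<subseteq> D" and w: "w \<in> S" "f u = h w"
  obtains g where "g holomorphic_on S" "g w = u" "\<And>z. z \<in> S \<Longrightarrow> f (g z) = h z"
proof -
  have "h w \<in> D \<inter> range f" using h(2) w by (metis IntI imageI rangeI subsetD)
  then have "D \<subseteq> range f" using subset_range[OF assms(1)] by blast
  then have hS: "h \<in> S \<rightarrow> D \<inter> range f" using h(2) by auto
  obtain g where g: "continuous_on S g" "g \<in> S \<rightarrow> f -` D" "g w = u" "\<And>z. z \<in> S \<Longrightarrow> f (g z) = h z"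
  proof (rule covering_space_lift_strong[OF covering_space_preimage, of u w S h])
    show "u \<in> f -` D" using w h(2) by auto
    show "simply_connected S" using S(1) by (rule convex_imp_simply_connected)
    show "locally path_connected S" using S(1) by (rule convex_imp_locally_path_connected)
    show "continuous_on S h" using h(1) by (rule holomorphic_on_imp_continuous_on)
  qed (use w hS that in auto)
  have "g holomorphic_on S"
  proof (rule holomorphic_on_locally)
    fix z assume z: "z \<in> S"
    then have "f (g z) \<in> D" using g(2) by auto
    then obtain \<delta> \<epsilon> L where L: "\<delta> > 0" "\<epsilon> > 0" "L holomorphic_on ball (f (g z)) \<epsilon>"
      "\<And>x. x \<in> ball (g z) \<delta> \<Longrightarrow> L (f x) = x"
      using local_inverse[OF f deriv_nonzero] by metis
    define U where "U = (S \<inter> g -` ball (g z) \<delta>) \<inter> (S \<inter> h -` ball (h z) \<epsilon>)"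
    have "open U"
      unfolding U_def
      by (rule open_Int; rule continuous_open_preimage)
        (use g(1) holomorphic_on_imp_continuous_on[OF h(1)] S in auto)
    moreover have "z \<in> U" using z L by (simp add: U_def)
    moreover have "(L \<circ> h) holomorphic_on U"
    proof (rule holomorphic_on_compose_gen)
      show "h holomorphic_on U" using h(1) by (rule holomorphic_on_subset) (auto simp: U_def)
      show "L holomorphic_on ball (h z) \<epsilon>" using L(3) g(4)[OF z] by simp
    qed (auto simp: U_def)
    moreover have "g x = (L \<circ> h) x" if "x \<in> U" for x
      using that L(4)[of "g x"] g(4)[of x] by (auto simp: U_def)
    ultimately show "\<exists>U h. open U \<and> z \<in> U \<and> h holomorphic_on U \<and> (\<forall>w\<in>U. g w = h w)"
      by blast
  qed
  then show ?thesis using that g by blast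
qed

end

section \<open>Logarithmic coordinates\<close>

text \<open>For the reciprocal of a periodic lift. The singularity is removable with value 0: the
  open mapping theorem then gives every small value, and the Lipschitz bound on the extension keeps
  its preimage from being too small.\<close>

lemma puncture_extension:
  fixes \<psi> :: "complex \<Rightarrow> complex"
  assumes "0 < s" and hol: "\<psi> holomorphic_on ball 0 s - {0}" and lim: "(\<psi> \<longlongrightarrow> 0) (at 0)"
    and nz: "\<And>\<xi>. \<xi> \<in> ball 0 s - {0} \<Longrightarrow> \<psi> \<xi> \<noteq> 0"
  obtains C \<eta> where "C > 0" "\<eta> > 0"
    "\<And>y. y \<noteq> 0 \<Longrightarrow> norm y < \<eta> \<Longrightarrow> \<exists>\<xi>\<in>ball 0 s - {0}. \<psi> \<xi> = y \<and> norm y \<le> C * norm \<xi>"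
proof -
  have "eventually (\<lambda>z. norm (\<psi> z) \<le> 1) (at 0)"
    using tendstoD[OF lim zero_less_one] by (auto elim!: eventually_mono)
  then obtain \<Psi> where \<Psi>: "\<Psi> holomorphic_on ball 0 s" "\<And>z. z \<in> ball 0 s - {0} \<Longrightarrow> \<Psi> z = \<psi> z"
    using holomorphic_on_extend_bounded[OF hol] \<open>0 < s\<close> by auto
  have \<Psi>0: "\<Psi> 0 = 0"
  proof (rule tendsto_unique[of "at 0" \<Psi>])
    have "isCont \<Psi> 0"
      using \<Psi>(1) \<open>0 < s\<close> holomorphic_on_imp_continuous_on[OF \<Psi>(1)]
      by (auto simp: continuous_on_eq_continuous_at)
    then show "(\<Psi> \<longlongrightarrow> \<Psi> 0) (at 0)" by (simp add: isCont_def)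
    show "(\<Psi> \<longlongrightarrow> 0) (at 0)"
      by (rule Lim_transform_within_open[OF lim open_ball[of 0 s]]) (use \<Psi>(2) \<open>0 < s\<close> in auto)
  qed simp
  define t where "t = s / 2"
  have t: "0 < t" "cball 0 t \<subseteq> ball (0::complex) s" using \<open>0 < s\<close> by (auto simp: t_def)
  have "continuous_on (cball 0 t) (deriv \<Psi>)"
    by (rule continuous_on_subset[OF holomorphic_on_imp_continuous_on[OF holomorphic_deriv[OF \<Psi>(1) open_ball]] t(2)])
  then have "bounded (deriv \<Psi> ` cball 0 t)"
    using compact_continuous_image compact_cball compact_imp_bounded by blast
  then obtain C where C: "C > 0" "\<And>z. z \<in> cball 0 t \<Longrightarrow> norm (deriv \<Psi> z) \<le> C"
    unfolding bounded_pos by auto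
  have lip: "norm (\<Psi> \<xi>) \<le> C * norm \<xi>" if "\<xi> \<in> ball 0 t" for \<xi>
  proof -
    have "norm (\<Psi> \<xi> - \<Psi> 0) \<le> C * norm (\<xi> - 0)"
    proof (rule field_differentiable_bound[of "ball 0 t" \<Psi> "deriv \<Psi>"])
      show "(\<Psi> has_field_derivative deriv \<Psi> z) (at z within ball 0 t)" if "z \<in> ball 0 t" for z
        using that \<open>0 < s\<close> by (intro holomorphic_derivI[OF \<Psi>(1) open_ball]) (simp add: t_def)
      show "norm (deriv \<Psi> z) \<le> C" if "z \<in> ball 0 t" for z using C(2) that by auto
    qed (use that t in auto)
    then show ?thesis by (simp add: \<Psi>0)
  qed
  have "open (\<Psi> ` ball 0 t)"
  proof (rule open_mapping_thm[of \<Psi> "ball 0 s"])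
    show "\<not> \<Psi> constant_on ball 0 s"
    proof
      assume "\<Psi> constant_on ball 0 s"
      then have "\<Psi> (of_real t) = \<Psi> 0"
        using t \<open>0 < s\<close> by (auto simp: constant_on_def t_def)
      moreover have "of_real t \<in> ball 0 s - {0 :: complex}" using \<open>0 < s\<close> by (simp add: t_def)
      ultimately show False using \<Psi>(2) nz \<Psi>0 by metis
    qed
  qed (use \<Psi>(1) t in auto)
  moreover have "0 \<in> \<Psi> ` ball 0 t" using \<Psi>0 t by (force simp: image_iff)
  ultimately obtain \<eta> where \<eta>: "\<eta> > 0" "ball 0 \<eta> \<subseteq> \<Psi> ` ball 0 t" by (meson openE)
  show ?thesis
  proof (rule that[OF C(1) \<eta>(1)])
    fix y :: complex assume y: "y \<noteq> 0" "norm y < \<eta>"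
    then obtain \<xi> where \<xi>: "\<xi> \<in> ball 0 t" "y = \<Psi> \<xi>" using \<eta>(2) by force
    moreover have "\<xi> \<noteq> 0" using \<xi>(2) \<Psi>0 y(1) by auto
    ultimately show "\<exists>\<xi>\<in>ball 0 s - {0}. \<psi> \<xi> = y \<and> norm y \<le> C * norm \<xi>"
      using \<Psi>(2)[of \<xi>] lip[of \<xi>] t(2) by (intro bexI[of _ \<xi>]) (auto simp: subset_iff)
  qed
qed

locale log_coordinates =
  fixes f :: "complex \<Rightarrow> complex" and c R1 :: real
  assumes entire_f: "f holomorphic_on UNIV"
    and transc: "\<not> (\<exists>p. \<forall>z. f z = poly p z)"
    and c_pos: "0 < c"
    and regular_values: "{w. c < norm w} \<inter> (critical_values f \<union> asymptotic_values f) = {}"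
    and R1: "ln c + 64 * pi < R1"
    and tract: "\<And>z. c < norm (f (exp z)) \<Longrightarrow> R1 < Re z"
begin

section \<open>Lifts of the exponential through f, and their univalence\<close>

definition H :: "complex set" where "H = {w. ln c < Re w}"

definition log_branch :: "(complex \<Rightarrow> complex) \<Rightarrow> bool" where
  "log_branch G \<longleftrightarrow> G holomorphic_on H \<and> (\<forall>w\<in>H. f (exp (G w)) = exp w)"

lemma open_H: "open H" and convex_H: "convex H" and connected_H: "connected H"
proof -
  show "open H" unfolding H_def by (rule open_halfspace_Re_gt)
  show "convex H" unfolding H_def by (rule convex_halfspace_Re_gt)
  then show "connected H" by (rule convex_connected)
qed

lemma norm_exp_gt: "w \<in> H \<Longrightarrow> c < norm (exp w)"
  using c_pos by (simp add: H_def) (metis exp_less_mono exp_ln)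

sublocale entire_inverse_branches f "{w. c < norm w}"
proof
  show "open {w. c < norm w}" by (intro open_Collect_less continuous_intros)
qed (use entire_f regular_values in auto)

lemma norm_f_ball: "norm z < exp R1 \<Longrightarrow> norm (f z) \<le> c"
proof -
  have *: "norm (f z) \<le> c" if "z \<noteq> 0" "norm z < exp R1" for z
  proof -
    have "Re (Ln z) < R1"
      using that by (metis Re_Ln exp_gt_zero ln_exp ln_less_cancel_iff zero_less_norm_iff)
    then show ?thesis using tract[of "Ln z"] that(1) by fastforce
  qed
  \<comment> \<open>The origin is not a value of \<open>exp\<close>, so it is reached by
    continuity.\<close>
  have "norm (f 0) \<le> c"
  proof (rule tendsto_upperbound)
    have "isCont f 0"
      using holomorphic_on_imp_continuous_on[OF entire_f] by (simp add: continuous_on_eq_continuous_at)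
    then show "((\<lambda>z. norm (f z)) \<longlongrightarrow> norm (f 0)) (at 0)"
      by (intro tendsto_norm) (simp add: isCont_def)
    show "eventually (\<lambda>z. norm (f z) \<le> c) (at 0)"
      unfolding eventually_at by (intro exI[of _ "exp R1"]) (use * in auto)
  qed simp
  with * show "norm z < exp R1 \<Longrightarrow> norm (f z) \<le> c" by (cases "z = 0") auto
qed

text \<open>This permits both the reciprocal and the logarithm of a lift.\<close>

lemma lift_nonzero: "w \<in> H \<Longrightarrow> f (g w) = exp w \<Longrightarrow> g w \<noteq> 0"
  using norm_f_ball[of 0] norm_exp_gt[of w] by auto

lemma lift_tendsto_infinity:
  assumes "\<And>w. w \<in> H \<Longrightarrow> f (g w) = exp w"
  obtains X where "\<And>w. X < Re w \<Longrightarrow> B < norm (g w)"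
proof -
  have "continuous_on (cball 0 B) f"
    using holomorphic_on_imp_continuous_on[OF entire_f] continuous_on_subset by blast
  then have "bounded (f ` cball 0 B)"
    using compact_continuous_image compact_cball compact_imp_bounded by blast
  then obtain M where M: "M > 0" "\<And>z. norm z \<le> B \<Longrightarrow> norm (f z) \<le> M"
    unfolding bounded_pos by auto
  have "B < norm (g w)" if "max (ln c) (ln M) < Re w" for w
  proof (rule ccontr)
    assume "\<not> B < norm (g w)"
    then have "norm (f (g w)) \<le> M" using M by simp
    moreover have "f (g w) = exp w" using assms that by (simp add: H_def)
    ultimately have "exp (Re w) \<le> M" by simp
    then have "Re w \<le> ln M" using M(1) by (simp add: ln_ge_iff)
    then show False using that by simp
  qed
  then show ?thesis using that by blast
qed

text \<open>A lift of the exponential with a period \<open>2 \<pi> i k\<close> is a function of \<open>\<xi> = exp (- w / k)\<close>.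
  Its reciprocal extends by \<open>0\<close> to the origin, whence \<open>f\<close> grows at most like a polynomial
  of degree \<open>k\<close>.\<close>

lemma periodic_lift_imp_False:
  assumes hol: "g holomorphic_on H" and lift: "\<And>w. w \<in> H \<Longrightarrow> f (g w) = exp w"
    and "k > (0::nat)"
    and per: "\<And>w. w \<in> H \<Longrightarrow> g (w + 2 * pi * \<i> * of_nat k) = g w"
  shows False
proof -
  define s where "s = exp (- ln c / k)"
  have "s > 0" by (simp add: s_def)
  define \<psi> where "\<psi> = (\<lambda>\<xi>. inverse (g (- of_nat k * Ln \<xi>)))"
  have inH: "- of_nat k * Ln \<xi> \<in> H" if "\<xi> \<in> ball 0 s - {0}" for \<xi>
  proof -
    have "ln (norm \<xi>) < - ln c / k"
      using that by (simp add: s_def) (metis exp_gt_zero ln_exp ln_less_cancel_iff zero_less_norm_iff)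
    then show ?thesis using that \<open>k > 0\<close> by (simp add: H_def field_simps)
  qed
  \<comment> \<open>The second formula is analytic across the negative real axis, where
    \<open>Ln\<close> jumps. By the period of \<open>g\<close> it agrees with the first.\<close>
  have \<psi>_eq: "\<psi> \<xi> = inverse (g (- of_nat k * Ln (- \<xi>) + of_nat k * \<i> * pi))"
    if "\<xi> \<in> ball 0 s - {0}" for \<xi>
  proof -
    have Ln_cases: "Ln (-\<xi>) = Ln \<xi> + \<i> * pi \<or> Ln (-\<xi>) = Ln \<xi> - \<i> * pi"
      using Ln_minus[of \<xi>] that by auto
    then show ?thesis
    proof
      assume A: "Ln (-\<xi>) = Ln \<xi> + \<i> * pi"
      have "- of_nat k * Ln (- \<xi>) + of_nat k * \<i> * pi = - of_nat k * Ln \<xi>"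
        unfolding A by (simp add: algebra_simps)
      then show ?thesis by (simp only: \<psi>_def)
    next
      assume A: "Ln (-\<xi>) = Ln \<xi> - \<i> * pi"
      have "- of_nat k * Ln (- \<xi>) + of_nat k * \<i> * pi = - of_nat k * Ln \<xi> + 2 * pi * \<i> * of_nat k"
        unfolding A by (simp add: algebra_simps)
      then show ?thesis using per[OF inH[OF that]] by (simp only: \<psi>_def)
    qed
  qed
  have inH': "- of_nat k * Ln (- \<xi>) + of_nat k * \<i> * pi \<in> H" if "\<xi> \<in> ball 0 s - {0}" for \<xi>
    using inH[of "-\<xi>"] that by (simp add: H_def)
  have hol\<psi>: "\<psi> holomorphic_on ball 0 s - {0}"
  proof (rule holomorphic_on_locally)
    fix \<xi> :: complex assume \<xi>: "\<xi> \<in> ball 0 s - {0}"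
    let ?B = "ball 0 s - {0} :: complex set"
    have opB: "open ?B" by (rule open_delete) simp
    show "\<exists>U h. open U \<and> \<xi> \<in> U \<and> h holomorphic_on U \<and> (\<forall>w\<in>U. \<psi> w = h w)"
    proof (cases "\<xi> \<in> \<real>\<^sub>\<le>\<^sub>0")
      case False
      have "(g \<circ> (\<lambda>\<xi>. - of_nat k * Ln \<xi>)) holomorphic_on (?B - \<real>\<^sub>\<le>\<^sub>0)"
        by (rule holomorphic_on_compose_gen[OF _ hol]) (use inH in \<open>force intro!: holomorphic_intros\<close>)+
      then have "(\<lambda>\<xi>. inverse ((g \<circ> (\<lambda>\<xi>. - of_nat k * Ln \<xi>)) \<xi>)) holomorphic_on (?B - \<real>\<^sub>\<le>\<^sub>0)"
        by (rule holomorphic_on_inverse) (use inH lift_nonzero lift in auto)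
      moreover have "open (?B - \<real>\<^sub>\<le>\<^sub>0)" using opB closed_nonpos_Reals_complex by blast
      ultimately show ?thesis
        using \<xi> False by (intro exI[of _ "?B - \<real>\<^sub>\<le>\<^sub>0"] exI[of _ "\<lambda>\<xi>. inverse ((g \<circ> (\<lambda>\<xi>. - of_nat k * Ln \<xi>)) \<xi>)"])
          (auto simp: \<psi>_def)
    next
      case True
      define U where "U = ?B \<inter> uminus -` (- \<real>\<^sub>\<le>\<^sub>0)"
      have "(g \<circ> (\<lambda>\<xi>. - of_nat k * Ln (- \<xi>) + of_nat k * \<i> * pi)) holomorphic_on U"
        by (rule holomorphic_on_compose_gen[OF _ hol])
          (use inH' in \<open>force intro!: holomorphic_intros simp: U_def\<close>)+
      then have "(\<lambda>\<xi>. inverse ((g \<circ> (\<lambda>\<xi>. - of_nat k * Ln (- \<xi>) + of_nat k * \<i> * pi)) \<xi>)) holomorphic_on U"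
        by (rule holomorphic_on_inverse) (use inH' lift_nonzero lift in \<open>auto simp: U_def\<close>)
      moreover have "open U"
        unfolding U_def
        by (intro open_Int opB continuous_open_vimage open_Compl closed_nonpos_Reals_complex continuous_intros)
      moreover have "\<xi> \<in> U"
        using \<xi> True by (auto simp: U_def complex_nonpos_Reals_iff complex_eq_iff)
      ultimately show ?thesis
        using \<psi>_eq by (intro exI[of _ U] exI[of _ "\<lambda>\<xi>. inverse ((g \<circ> (\<lambda>\<xi>. - of_nat k * Ln (- \<xi>) + of_nat k * \<i> * pi)) \<xi>)"])
          (auto simp: U_def)
    qed
  qed
  have lim: "(\<psi> \<longlongrightarrow> 0) (at 0)"
  proof (rule tendstoI)
    fix e :: real assume "e > 0"
    obtain X where X: "\<And>w. X < Re w \<Longrightarrow> inverse e < norm (g w)"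
      using lift_tendsto_infinity[of g "inverse e"] lift by blast
    have "dist (\<psi> \<xi>) 0 < e" if "\<xi> \<noteq> 0" "dist \<xi> 0 < exp (- X / k)" for \<xi>
    proof -
      have "ln (norm \<xi>) < - X / k"
        using that by simp (metis exp_gt_zero ln_exp ln_less_cancel_iff zero_less_norm_iff)
      then have "X < Re (- of_nat k * Ln \<xi>)"
        using that \<open>k > 0\<close> by (simp add: field_simps)
      then have "inverse e < norm (g (- of_nat k * Ln \<xi>))" by (rule X)
      then have "inverse (norm (g (- of_nat k * Ln \<xi>))) < inverse (inverse e)"
        using \<open>e > 0\<close> by (intro less_imp_inverse_less) auto
      then show ?thesis by (simp add: \<psi>_def norm_inverse)
    qed
    then show "eventually (\<lambda>\<xi>. dist (\<psi> \<xi>) 0 < e) (at 0)"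
      unfolding eventually_at by (intro exI[of _ "exp (- X / k)"]) auto
  qed
  have nz: "\<psi> \<xi> \<noteq> 0" if "\<xi> \<in> ball 0 s - {0}" for \<xi>
    using inH[OF that] lift lift_nonzero by (simp add: \<psi>_def)
  obtain C \<eta> where C: "C > 0" "\<eta> > 0"
    "\<And>y. y \<noteq> 0 \<Longrightarrow> norm y < \<eta> \<Longrightarrow> \<exists>\<xi>\<in>ball 0 s - {0}. \<psi> \<xi> = y \<and> norm y \<le> C * norm \<xi>"
    using puncture_extension[OF \<open>s > 0\<close> hol\<psi> lim nz] by blast
  \<comment> \<open>For large \<open>z\<close> the reciprocal is some \<open>\<psi> \<xi>\<close>,
    so \<open>z = g (- k Ln \<xi>)\<close>. Then |f z| is the k-th power of 1/|\<xi>|, and |\<xi>|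
    is at least 1/(C |z|).\<close>
  have growth: "norm (f z) \<le> C ^ k * norm z ^ k" if z: "2 / \<eta> \<le> norm z" for z
  proof -
    have "norm z > 0" using z C(2) by (meson divide_pos_pos less_le_trans zero_less_numeral)
    then have iz: "inverse z \<noteq> 0" by auto
    have "norm (inverse z) < \<eta>"
    proof -
      have "1 / \<eta> < norm z" using z C(2) by (simp add: field_simps)
      then have "1 / norm z < \<eta>" using C(2) \<open>norm z > 0\<close> by (simp add: field_simps)
      then show ?thesis by (simp add: norm_inverse inverse_eq_divide norm_divide)
    qed
    then obtain \<xi> where \<xi>: "\<xi> \<in> ball 0 s - {0}" "\<psi> \<xi> = inverse z" "norm (inverse z) \<le> C * norm \<xi>"
      using C(3)[OF iz] by blast
    have "g (- of_nat k * Ln \<xi>) = z" using \<xi>(2) by (simp add: \<psi>_def)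
    then have "f z = exp (- of_nat k * Ln \<xi>)" using lift[OF inH[OF \<xi>(1)]] by simp
    also have "\<dots> = inverse \<xi> ^ k"
      using \<xi>(1) by (simp add: exp_minus exp_of_nat_mult power_inverse)
    finally have "norm (f z) = (inverse (norm \<xi>)) ^ k" by (simp add: norm_power norm_inverse)
    also have "\<dots> \<le> (C * norm z) ^ k"
    proof (rule power_mono)
      have "norm \<xi> > 0" using \<xi>(1) by simp
      then show "inverse (norm \<xi>) \<le> C * norm z"
        using \<xi>(3) \<open>norm z > 0\<close> by (simp add: norm_inverse norm_divide field_simps)
    qed simp
    finally show ?thesis by (simp add: power_mult_distrib)
  qed
  have "f z = poly (\<Sum>j\<le>k. monom ((deriv ^^ j) f 0 / fact j) j) z" for z
    using Liouville_polynomial[OF entire_f growth, where \<xi> = z] by (simp add: poly_sum poly_monom)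
  then show False using transc by blast
qed

text \<open>Points with a common value have the same exponential, so they differ by 2 pi i k.
  Uniqueness of lifts turns this one coincidence into a period, which is impossible for a
  transcendental \<open>f\<close>.\<close>

lemma lift_inj_on:
  assumes hol: "g holomorphic_on H" and lift: "\<And>w. w \<in> H \<Longrightarrow> f (g w) = exp w"
  shows "inj_on g H"
proof -
  have "w1 = w2" if w: "w1 \<in> H" "w2 \<in> H" "g w1 = g w2" "Im w1 \<le> Im w2" for w1 w2
  proof (rule ccontr)
    assume "w1 \<noteq> w2"
    have "exp w2 = exp w1" using lift w by metis
    then obtain n :: int where n: "w2 = w1 + (of_int (2 * n) * pi) * \<i>" using exp_eq by blast
    then have "Im w2 = Im w1 + 2 * n * pi" by simp
    then have "0 \<le> pi * real_of_int n" using w(4) by simp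
    then have "n \<ge> 0" using pi_gt_zero by (simp add: zero_le_mult_iff)
    moreover have "n \<noteq> 0" using n \<open>w1 \<noteq> w2\<close> by auto
    ultimately obtain k :: nat where k: "k > 0" "n = int k"
      by (metis of_nat_0_less_iff order_le_less zero_le_imp_eq_int)
    define P where "P = 2 * pi * \<i> * of_nat k"
    have P: "w2 = w1 + P" unfolding n k P_def by (simp add: algebra_simps)
    have PH: "w + P \<in> H" if "w \<in> H" for w using that by (simp add: H_def P_def)
    have expP: "exp (w + P) = exp w" for w
      unfolding P_def by (metis exp_plus_2pin mult.commute mult.left_commute of_int_of_nat_eq of_real_mult of_real_numeral)
    have "g w = g (w + P)" if "w \<in> H" for w
    proof (rule lift_unique[OF entire_f open_H connected_H hol, of "\<lambda>w. g (w + P)" w1 w])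
      have "(g \<circ> (\<lambda>w. w + P)) holomorphic_on H"
        by (rule holomorphic_on_compose_gen[OF _ hol]) (use PH in \<open>auto intro!: holomorphic_intros\<close>)
      then show "(\<lambda>w. g (w + P)) holomorphic_on H" by (simp add: o_def)
      show "f (g z) = f (g (z + P))" if "z \<in> H" for z using lift PH[OF that] that expP by simp
      show "deriv f (g w1) \<noteq> 0"
        using deriv_nonzero[of "g w1"] lift[OF w(1)] norm_exp_gt[OF w(1)] by simp
    qed (use w P that in auto)
    then show False using periodic_lift_imp_False[OF hol lift k(1)] P_def by metis
  qed
  then show ?thesis
    by (intro inj_onI) (metis linear)
qed

text \<open>The exponential on \<open>H\<close> lifts through \<open>f\<close>, and the lift has a
  logarithm because it never vanishes.\<close>

lemma log_branch_exists:
  assumes "w \<in> H" "f (exp z) = exp w"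
  obtains G where "log_branch G" "G w = z"
proof -
  have "connected {w::complex. c < norm w}"
  proof -
    have "{w::complex. c < norm w} = - cball 0 c" by auto
    then show ?thesis
      using connected_complement_bounded_convex[of "cball (0::complex) c"] by simp
  qed
  then obtain g where g: "g holomorphic_on H" "g w = exp z" "\<And>w. w \<in> H \<Longrightarrow> f (g w) = exp w"
  proof (rule lift_exists[of H exp w "exp z"])
    show "exp ` H \<subseteq> {w. c < norm w}" using norm_exp_gt by blast
  qed (use convex_H open_H assms holomorphic_on_exp in auto)
  obtain l where l: "l holomorphic_on H" "\<And>w. w \<in> H \<Longrightarrow> g w = exp (l w)"
    using contractible_imp_holomorphic_log[OF g(1)] convex_imp_contractible[OF convex_H] lift_nonzero g(3) by metis
  \<comment> \<open>\<open>z - l w\<close> is a multiple of 2 pi i, because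
    \<open>exp (l w) = exp z\<close>.\<close>
  have *: "exp (l u + (z - l w)) = g u" if "u \<in> H" for u
    using l(2) g(2) assms(1) that by (simp add: exp_add exp_diff)
  have "log_branch (\<lambda>u. l u + (z - l w))"
    unfolding log_branch_def using * g(3) by (auto intro!: holomorphic_intros l)
  then show ?thesis using that by force
qed

section \<open>Range, univalence and contraction of logarithmic branches\<close>

lemma log_branch_range: "log_branch G \<Longrightarrow> w \<in> H \<Longrightarrow> R1 < Re (G w)"
  by (rule tract) (use norm_exp_gt in \<open>auto simp: log_branch_def\<close>)

lemma log_branch_in_H: "log_branch G \<Longrightarrow> w \<in> H \<Longrightarrow> G w \<in> H"
  using log_branch_range[of G w] R1 pi_gt_zero unfolding H_def mem_Collect_eq by linarith

lemma log_branch_exp_inj: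
  assumes "log_branch G"
  shows "inj_on (\<lambda>w. exp (G w)) H"
  by (rule lift_inj_on) (use assms in \<open>auto simp: log_branch_def intro!: holomorphic_intros\<close>)

lemma log_branch_inj: "log_branch G \<Longrightarrow> inj_on G H"
  using log_branch_exp_inj by (metis (mono_tags, lifting) inj_on_def)

text \<open>By Bloch's theorem a larger derivative would put a disc of radius above pi into the
  range of \<open>G\<close>. Its points pi i above and below the centre have the same exponential,
  against \<open>log_branch_exp_inj\<close>.\<close>

lemma log_branch_deriv:
  assumes G: "log_branch G" and w: "w \<in> H"
  shows "norm (deriv G w) \<le> 12 * pi / (Re w - ln c)"
proof (rule ccontr)
  assume large: "\<not> ?thesis"
  define \<rho> where "\<rho> = Re w - ln c"
  have "\<rho> > 0" using w by (simp add: \<rho>_def H_def)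
  have sub: "ball w \<rho> \<subseteq> H"
  proof
    fix z assume "z \<in> ball w \<rho>"
    then have "\<bar>Re (w - z)\<bar> < \<rho>" using abs_Re_le_cmod[of "w - z"] by (simp add: dist_norm)
    then show "z \<in> H" by (simp add: \<rho>_def H_def)
  qed
  define r where "r = \<rho> * norm (deriv G w) / 12"
  have "r > pi"
    using large \<open>\<rho> > 0\<close> unfolding r_def \<rho>_def[symmetric] not_le
    by (simp add: pos_divide_less_eq mult.commute)
  have holG: "G holomorphic_on H" using G by (simp add: log_branch_def)
  obtain b where b: "ball b r \<subseteq> G ` ball w \<rho>"
  proof (rule Bloch_general[of G "ball w \<rho>" w \<rho> r])
    show "G holomorphic_on ball w \<rho>" using holG sub by (rule holomorphic_on_subset)
    show "\<rho> \<le> dist w z" if "z \<in> frontier (ball w \<rho>)" for z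
      using that \<open>\<rho> > 0\<close> by simp
    show "r \<le> \<rho> * norm (deriv G w) / 12" by (simp add: r_def)
    show "w \<in> ball w \<rho>" using \<open>\<rho> > 0\<close> by simp
  qed
  have "b + of_real pi * \<i> \<in> ball b r" "b - of_real pi * \<i> \<in> ball b r"
    using \<open>r > pi\<close> pi_gt_zero by (simp_all add: dist_norm norm_mult)
  then have "b + of_real pi * \<i> \<in> G ` H" "b - of_real pi * \<i> \<in> G ` H"
    using b sub by blast+
  then obtain u v where uv: "u \<in> H" "v \<in> H" "G u = b + of_real pi * \<i>" "G v = b - of_real pi * \<i>"
    by (metis imageE)
  have "exp (G u) = exp (G v)"
    unfolding uv exp_eq by (intro exI[of _ 1]) (simp add: algebra_simps)
  then have "u = v" using inj_onD[OF log_branch_exp_inj[OF G]] uv(1,2) by blast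
  then have "Im (b + of_real pi * \<i>) = Im (b - of_real pi * \<i>)" using uv(3,4) by metis
  then show False using pi_gt_zero by simp
qed

text \<open>The points with \<open>Re w \<ge> a\<close> are the centres of discs of radius \<open>32 \<pi>\<close> in \<open>H\<close>, which leaves
  room for both the contraction and the distortion estimate.\<close>

definition a :: real where "a = ln c + 32 * pi"

lemma halfplane_subset_H: "a \<le> Re w \<Longrightarrow> w \<in> H"
  using pi_gt_zero unfolding a_def H_def mem_Collect_eq by linarith

lemma log_branch_contraction:
  assumes G: "log_branch G" and "a \<le> Re u" "a \<le> Re v"
  shows "norm (G u - G v) \<le> 3/8 * norm (u - v)"
proof (rule field_differentiable_bound[of "{w. a \<le> Re w}" G "deriv G"])
  show "convex {w. a \<le> Re w}" by (rule convex_halfspace_Re_ge)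
  show "(G has_field_derivative deriv G z) (at z within {w. a \<le> Re w})" if "z \<in> {w. a \<le> Re w}" for z
  proof (rule holomorphic_derivI[OF _ open_H])
    show "G holomorphic_on H" using G by (simp add: log_branch_def)
    show "z \<in> H" using halfplane_subset_H that by blast
  qed
  show "norm (deriv G z) \<le> 3/8" if "z \<in> {w. a \<le> Re w}" for z
  proof -
    have "32 * pi \<le> Re z - ln c" using that by (simp add: a_def)
    then have "12 * pi / (Re z - ln c) \<le> 12 * pi / (32 * pi)"
      using pi_gt_zero by (intro frac_le) linarith+
    moreover have "12 * pi / (32 * pi) = 3/8" by simp
    moreover have "z \<in> H" using halfplane_subset_H that by blast
    ultimately show ?thesis
      using log_branch_deriv[OF G, of z] by linarith
  qed
qed (use assms in auto)

end

section \<open>Area of conformal images\<close>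

text \<open>Area estimates by Jacobian determinants are made on \<open>real^2\<close>; this isometry
  carries them to the complex plane.\<close>

definition complex_of_vec :: "real^2 \<Rightarrow> complex" where
  "complex_of_vec v = Complex (vec_nth v 1) (vec_nth v 2)"

definition vec_of_complex :: "complex \<Rightarrow> real^2" where
  "vec_of_complex z = (\<chi> i. if i = 1 then Re z else Im z)"

lemma complex_of_vec_inverse [simp]:
  "complex_of_vec (vec_of_complex z) = z" "vec_of_complex (complex_of_vec v) = v"
  by (simp_all add: complex_of_vec_def vec_of_complex_def vec_eq_iff forall_2)

lemma bounded_linear_complex_of_vec: "bounded_linear complex_of_vec"
  unfolding complex_of_vec_def
  by (intro linear_conv_bounded_linear[THEN iffD1] linearI) (simp_all add: complex_eq_iff)

lemma bounded_linear_vec_of_complex: "bounded_linear vec_of_complex"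
  unfolding vec_of_complex_def
  by (intro linear_conv_bounded_linear[THEN iffD1] linearI) (simp_all add: vec_eq_iff)

lemma continuous_on_complex_of_vec: "continuous_on A complex_of_vec"
  by (rule linear_continuous_on[OF bounded_linear_complex_of_vec])

lemma distr_complex_of_vec: "distr lborel borel complex_of_vec = lborel"
proof (rule lborel_eqI[symmetric])
  have Basis2: "(Basis :: (real^2) set) = {axis 1 1, axis 2 1}"
    by (auto simp: Basis_vec_def UNIV_2)
  have meas: "complex_of_vec \<in> borel_measurable lborel"
    using borel_measurable_continuous_onI[OF continuous_on_complex_of_vec] by simp
  fix l u :: complex assume le: "\<And>b. b \<in> Basis \<Longrightarrow> l \<bullet> b \<le> u \<bullet> b"
  have le': "Re l \<le> Re u" "Im l \<le> Im u"
    using le[of 1] le[of \<i>] by (auto simp: Basis_complex_def)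
  have pre: "complex_of_vec -` box l u = box (vec_of_complex l) (vec_of_complex u)"
    by (auto simp: in_box_complex_iff mem_box_cart complex_of_vec_def vec_of_complex_def forall_2)
  have "emeasure (distr lborel borel complex_of_vec) (box l u) =
      emeasure lborel (box (vec_of_complex l) (vec_of_complex u))"
    by (subst emeasure_distr[OF meas]) (simp_all add: pre)
  also have "\<dots> = (\<Prod>b\<in>Basis. (vec_of_complex u - vec_of_complex l) \<bullet> b)"
    by (rule emeasure_lborel_box) (use le' in \<open>auto simp: Basis2 inner_axis vec_of_complex_def\<close>)
  also have "(\<Prod>b\<in>Basis. (vec_of_complex u - vec_of_complex l) \<bullet> b) = (\<Prod>b\<in>Basis. (u - l) \<bullet> b)"
    by (simp add: Basis2 Basis_complex_def axis_eq_axis inner_axis vec_of_complex_def)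
  finally show "emeasure (distr lborel borel complex_of_vec) (box l u) = (\<Prod>b\<in>Basis. (u - l) \<bullet> b)" .
qed simp

lemma distr_Complex: "distr (lborel \<Otimes>\<^sub>M lborel) borel (\<lambda>(x, y). Complex x y) = lborel"
proof (rule lborel_eqI[symmetric])
  have "continuous_on UNIV (\<lambda>p. Complex (fst p) (snd p))"
    by (intro continuous_intros)
  then have meas: "(\<lambda>(x, y). Complex x y) \<in> borel_measurable (lborel \<Otimes>\<^sub>M lborel)"
    using borel_measurable_continuous_onI[of "\<lambda>p. Complex (fst p) (snd p)"]
    by (simp add: case_prod_beta' lborel_prod)
  fix l u :: complex assume le: "\<And>b. b \<in> Basis \<Longrightarrow> l \<bullet> b \<le> u \<bullet> b"
  have le': "Re l \<le> Re u" "Im l \<le> Im u"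
    using le[of 1] le[of \<i>] by (auto simp: Basis_complex_def)
  have pre: "(\<lambda>(x, y). Complex x y) -` box l u = {Re l<..<Re u} \<times> {Im l<..<Im u}"
    by (auto simp: in_box_complex_iff)
  have "emeasure (distr (lborel \<Otimes>\<^sub>M lborel) borel (\<lambda>(x, y). Complex x y)) (box l u) =
      emeasure (lborel \<Otimes>\<^sub>M lborel) ({Re l<..<Re u} \<times> {Im l<..<Im u})"
    by (subst emeasure_distr[OF meas]) (simp_all add: pre space_pair_measure)
  also have "\<dots> = ennreal (Re u - Re l) * ennreal (Im u - Im l)"
    using le' by (subst lborel.emeasure_pair_measure_Times) auto
  also have "\<dots> = (\<Prod>b\<in>Basis. (u - l) \<bullet> b)"
    using le' by (simp add: Basis_complex_def ennreal_mult)
  finally show "emeasure (distr (lborel \<Otimes>\<^sub>M lborel) borel (\<lambda>(x, y). Complex x y)) (box l u) = (\<Prod>b\<in>Basis. (u - l) \<bullet> b)" .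
qed simp

text \<open>Tonelli's theorem, with a half-open range of abscissae to match the rectangles of the
  tiling.\<close>

lemma emeasure_complex_ge_slices:
  assumes A: "A \<in> sets borel" and "p \<le> q"
    and slice: "\<And>x. p \<le> x \<Longrightarrow> x < q \<Longrightarrow> t \<le> emeasure lborel {y. Complex x y \<in> A}"
  shows "t * ennreal (q - p) \<le> emeasure lborel A"
proof -
  have "continuous_on UNIV (\<lambda>p. Complex (fst p) (snd p))"
    by (intro continuous_intros)
  then have meas: "(\<lambda>(x, y). Complex x y) \<in> borel_measurable (lborel \<Otimes>\<^sub>M lborel)"
    using borel_measurable_continuous_onI[of "\<lambda>p. Complex (fst p) (snd p)"]
    by (simp add: case_prod_beta' lborel_prod)
  define A' where "A' = (\<lambda>(x, y). Complex x y) -` A"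
  have A': "A' \<in> sets (lborel \<Otimes>\<^sub>M lborel)"
    using measurable_sets[OF meas A] by (simp add: A'_def space_pair_measure)
  have "t * ennreal (q - p) = (\<integral>\<^sup>+x. t * indicator {p..<q} x \<partial>lborel)"
    using \<open>p \<le> q\<close> by (subst nn_integral_cmult_indicator) auto
  also have "\<dots> \<le> (\<integral>\<^sup>+x. emeasure lborel (Pair x -` A') \<partial>lborel)"
  proof (rule nn_integral_mono)
    fix x
    show "t * indicator {p..<q} x \<le> emeasure lborel (Pair x -` A')"
      using slice[of x] by (auto simp: indicator_def A'_def vimage_def)
  qed
  also have "\<dots> = emeasure (lborel \<Otimes>\<^sub>M lborel) A'"
    using A' by (subst lborel.emeasure_pair_measure_alt) auto
  also have "\<dots> = emeasure (distr (lborel \<Otimes>\<^sub>M lborel) borel (\<lambda>(x, y). Complex x y)) A"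
    using A by (subst emeasure_distr[OF meas]) (auto simp: A'_def space_pair_measure)
  also have "\<dots> = emeasure lborel A" by (simp add: distr_Complex)
  finally show ?thesis .
qed

text \<open>The image is a preimage under the holomorphic inverse.\<close>

lemma holomorphic_injective_image_borel:
  assumes hol: "\<phi> holomorphic_on S" and S: "open S" and inj: "inj_on \<phi> S"
    and X: "X \<in> sets borel" "X \<subseteq> S"
  shows "\<phi> ` X \<in> sets borel"
proof -
  obtain \<psi> where \<psi>: "\<psi> holomorphic_on \<phi> ` S" "\<And>z. z \<in> S \<Longrightarrow> \<psi> (\<phi> z) = z"
    using holomorphic_has_inverse[OF hol S inj] by metis
  have opn: "open (\<phi> ` S)" by (rule open_mapping_thm3[OF hol S inj])
  have "\<psi> \<in> borel_measurable (restrict_space borel (\<phi> ` S))"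
    by (rule borel_measurable_continuous_on_restrict[OF holomorphic_on_imp_continuous_on[OF \<psi>(1)]])
  then have "\<psi> -` X \<inter> \<phi> ` S \<in> sets (restrict_space borel (\<phi> ` S))"
    using X(1) measurable_sets[of \<psi> "restrict_space borel (\<phi> ` S)" borel X] by (simp add: space_restrict_space)
  then have "\<psi> -` X \<inter> \<phi> ` S \<in> sets borel"
    using opn by (subst (asm) sets_restrict_space_iff) auto
  moreover have "\<psi> -` X \<inter> \<phi> ` S = \<phi> ` X" using \<psi>(2) X(2) by auto
  ultimately show ?thesis by simp
qed

lemma emeasure_lborel_vimage:
  "A \<in> sets borel \<Longrightarrow> emeasure lborel (complex_of_vec -` A) = emeasure lborel A"
  using borel_measurable_continuous_onI[OF continuous_on_complex_of_vec]
  by (subst distr_complex_of_vec[symmetric], subst emeasure_distr) simp_all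

lemma vimage_complex_of_vec_borel: "A \<in> sets borel \<Longrightarrow> complex_of_vec -` A \<in> sets borel"
  using measurable_sets[OF borel_measurable_continuous_onI[OF continuous_on_complex_of_vec], of A] by simp

lemma emeasure_holomorphic_image_le:
  assumes hol: "\<phi> holomorphic_on S" and S: "open S" and inj: "inj_on \<phi> S"
    and X: "X \<in> sets borel" "X \<subseteq> S" "emeasure lborel X < \<infinity>"
    and B: "\<And>x. x \<in> X \<Longrightarrow> norm (deriv \<phi> x) \<le> B"
  shows "emeasure lborel (\<phi> ` X) \<le> ennreal (B\<^sup>2) * emeasure lborel X"
proof -
  define V where "V = complex_of_vec -` X"
  define F where "F = vec_of_complex \<circ> \<phi> \<circ> complex_of_vec"
  define F' where "F' = (\<lambda>v h. vec_of_complex (deriv \<phi> (complex_of_vec v) * complex_of_vec h))"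
  have VX: "emeasure lborel V = emeasure lborel X"
    unfolding V_def by (rule emeasure_lborel_vimage[OF X(1)])
  have Vb: "V \<in> sets borel" unfolding V_def by (rule vimage_complex_of_vec_borel[OF X(1)])
  have V: "V \<in> lmeasurable"
    using Vb VX X(3) by (intro fmeasurableI) auto
  have FV: "F ` V = complex_of_vec -` (\<phi> ` X)"
  proof (intro equalityI subsetI)
    fix v assume "v \<in> complex_of_vec -` (\<phi> ` X)"
    then obtain x where x: "x \<in> X" "complex_of_vec v = \<phi> x" by auto
    then have "v = F (vec_of_complex x)" using complex_of_vec_inverse(2)[of v] by (simp add: F_def)
    then show "v \<in> F ` V" using x by (simp add: V_def)
  qed (auto simp: F_def V_def)
  have bX: "\<phi> ` X \<in> sets borel"
    by (rule holomorphic_injective_image_borel[OF hol S inj X(1,2)])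
  \<comment> \<open>By the Cauchy-Riemann equations the real Jacobian determinant of a holomorphic
    map is the squared modulus of its derivative.\<close>
  have det: "det (matrix (F' v)) = (norm (deriv \<phi> (complex_of_vec v)))\<^sup>2" for v
    unfolding cmod_power2
    by (simp add: det_2 matrix_def F'_def vec_of_complex_def complex_of_vec_def axis_def power2_eq_square)
  have der: "(F has_derivative F' v) (at v within V)" if "v \<in> V" for v
  proof -
    have "complex_of_vec v \<in> S" using that X(2) by (auto simp: V_def)
    then have "(\<phi> has_derivative (\<lambda>h. deriv \<phi> (complex_of_vec v) * h)) (at (complex_of_vec v))"
      using holomorphic_derivI[OF hol S] by (simp add: has_field_derivative_def)
    moreover have "(complex_of_vec has_derivative complex_of_vec) (at v within V)"
      by (rule bounded_linear_imp_has_derivative[OF bounded_linear_complex_of_vec])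
    ultimately have "((\<lambda>v. \<phi> (complex_of_vec v)) has_derivative (\<lambda>h. deriv \<phi> (complex_of_vec v) * complex_of_vec h)) (at v within V)"
      using has_derivative_compose by blast
    from bounded_linear.has_derivative[OF bounded_linear_vec_of_complex this]
    show ?thesis by (simp add: F_def F'_def o_def)
  qed
  have cont: "continuous_on V (\<lambda>v. \<bar>det (matrix (F' v))\<bar>)"
    unfolding det
    by (intro continuous_intros continuous_on_compose2[OF holomorphic_on_imp_continuous_on[OF holomorphic_deriv[OF hol S]]]
        continuous_on_complex_of_vec) (use X(2) in \<open>auto simp: V_def\<close>)
  have B0: "\<bar>det (matrix (F' v))\<bar> \<le> B\<^sup>2" if "v \<in> V" for v
    unfolding det using B[of "complex_of_vec v"] that by (simp add: V_def power_mono)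
  have "(\<lambda>v. \<bar>det (matrix (F' v))\<bar>) absolutely_integrable_on V"
  proof (rule measurable_bounded_by_integrable_imp_absolutely_integrable)
    show "(\<lambda>v. \<bar>det (matrix (F' v))\<bar>) \<in> borel_measurable (lebesgue_on V)"
      by (rule continuous_imp_measurable_on_sets_lebesgue[OF cont]) (use V in auto)
    show "(\<lambda>v. B\<^sup>2) integrable_on V" by (rule integrable_on_const[OF V])
  qed (use V B0 in auto)
  then have int: "(\<lambda>v. \<bar>det (matrix (F' v))\<bar>) integrable_on V"
    using absolutely_integrable_on_def by blast
  have FVm: "F ` V \<in> lmeasurable"
    by (rule measurable_bounded_differentiable_image[OF V der int B0])
  have "measure lebesgue (F ` V) \<le> B\<^sup>2 * measure lebesgue V"
    by (rule measure_bounded_differentiable_image[OF V der int B0])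
  then have "ennreal (measure lebesgue (F ` V)) \<le> ennreal (B\<^sup>2) * ennreal (measure lebesgue V)"
    by (simp flip: ennreal_mult)
  then have "emeasure lebesgue (F ` V) \<le> ennreal (B\<^sup>2) * emeasure lebesgue V"
    using V FVm by (simp add: emeasure_eq_measure2)
  moreover have "emeasure lebesgue (F ` V) = emeasure lborel (\<phi> ` X)"
    unfolding FV using emeasure_lborel_vimage[OF bX] vimage_complex_of_vec_borel[OF bX] by simp
  ultimately show ?thesis using VX Vb by simp
qed

text \<open>The upper estimate applied to the inverse map; there is nothing to show when the image
  has infinite area.\<close>

lemma emeasure_holomorphic_image_ge:
  assumes hol: "\<phi> holomorphic_on S" and S: "open S" and inj: "inj_on \<phi> S"
    and X: "X \<in> sets borel" "X \<subseteq> S"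
    and b: "0 < b" "\<And>x. x \<in> X \<Longrightarrow> b \<le> norm (deriv \<phi> x)"
  shows "ennreal (b\<^sup>2) * emeasure lborel X \<le> emeasure lborel (\<phi> ` X)"
proof (cases "emeasure lborel (\<phi> ` X) < \<infinity>")
  case True
  obtain \<psi> where \<psi>: "\<psi> holomorphic_on \<phi> ` S" "\<And>z. z \<in> S \<Longrightarrow> deriv \<phi> z * deriv \<psi> (\<phi> z) = 1"
    "\<And>z. z \<in> S \<Longrightarrow> \<psi> (\<phi> z) = z"
    using holomorphic_has_inverse[OF hol S inj] by metis
  have "inj_on \<psi> (\<phi> ` S)" using \<psi>(3) by (simp add: inj_on_def)
  have "emeasure lborel (\<psi> ` \<phi> ` X) \<le> ennreal ((1/b)\<^sup>2) * emeasure lborel (\<phi> ` X)"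
  proof (rule emeasure_holomorphic_image_le[OF \<psi>(1) open_mapping_thm3[OF hol S inj] \<open>inj_on \<psi> (\<phi> ` S)\<close>])
    show "\<phi> ` X \<in> sets borel" by (rule holomorphic_injective_image_borel[OF hol S inj X])
    fix y assume "y \<in> \<phi> ` X"
    then obtain x where x: "x \<in> X" "y = \<phi> x" by auto
    have "norm (deriv \<phi> x) * norm (deriv \<psi> y) = 1"
      using \<psi>(2)[of x] x X(2) by (metis norm_mult norm_one subsetD)
    moreover have "b \<le> norm (deriv \<phi> x)" using b(2) x by blast
    ultimately have "b * norm (deriv \<psi> y) \<le> 1"
      by (metis mult_right_mono norm_ge_zero)
    then show "norm (deriv \<psi> y) \<le> 1 / b" using b(1) by (simp add: field_simps)
  qed (use X(2) True in auto)
  moreover have "\<psi> ` \<phi> ` X = X" using \<psi>(3) X(2) by (force simp: image_image)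
  ultimately have "ennreal (b\<^sup>2) * emeasure lborel X \<le> ennreal (b\<^sup>2) * (ennreal ((1/b)\<^sup>2) * emeasure lborel (\<phi> ` X))"
    by (simp add: mult_left_mono)
  also have "\<dots> = ennreal (b\<^sup>2 * (1/b)\<^sup>2) * emeasure lborel (\<phi> ` X)"
    by (simp add: ennreal_mult mult.assoc)
  also have "b\<^sup>2 * (1/b)\<^sup>2 = 1" using b(1) by (simp add: power_divide)
  finally show ?thesis by simp
qed (simp add: not_less top_unique)

section \<open>Growth of iterates\<close>

lemma iter_exp_Suc: "iter_exp (Suc n) = exp (iter_exp n)"
  by (simp add: iter_exp_def)

lemma iter_exp_ge: "real n \<le> iter_exp n"
proof (induction n)
  case 0
  then show ?case by (simp add: iter_exp_def)
next
  case (Suc n)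
  have "1 + iter_exp n \<le> exp (iter_exp n)" by (rule exp_ge_add_one_self)
  with Suc show ?case unfolding iter_exp_Suc of_nat_Suc by linarith
qed

lemma norm_le_max_modulus:
  assumes "f holomorphic_on UNIV"
  shows "norm (f z) \<le> max_modulus f (norm z)"
  unfolding max_modulus_def
proof (rule cSup_upper)
  have "continuous_on (sphere 0 (norm z)) f"
    using holomorphic_on_imp_continuous_on[OF assms] continuous_on_subset by blast
  then have "bounded (f ` sphere 0 (norm z))"
    using compact_continuous_image compact_sphere compact_imp_bounded by blast
  then show "bdd_above {norm (f u) |u. norm u = norm z}"
    unfolding bounded_iff bdd_above_def by fastforce
qed auto

text \<open>With r = exp s, the growth exp(r^\<rho>) becomes a double exponential of \<rho> s. The
  constant \<open>A\<close> absorbs the disc on which the limit superior says nothing.\<close>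

lemma finite_order_growth:
  assumes f: "f holomorphic_on UNIV" and "finite_order f"
  obtains \<rho> A where "1 \<le> \<rho>" "0 \<le> A"
    "\<And>s u. norm u \<le> exp s \<Longrightarrow> norm (f u) \<le> exp (A + exp (\<rho> * s))"
proof -
  have "order_entire f < \<infinity>" using assms by (simp add: finite_order_def)
  then obtain \<rho>0 :: real where "order_entire f < ereal \<rho>0"
    by (metis ereal_dense2)
  then have ev: "eventually (\<lambda>r. ereal (ln (ln (max_modulus f r)) / ln r) < ereal \<rho>0) at_top"
    unfolding order_entire_def by (rule Limsup_lessD)
  define \<rho> where "\<rho> = max 1 \<rho>0"
  obtain r1 where r1: "\<And>r. r1 \<le> r \<Longrightarrow> ln (ln (max_modulus f r)) / ln r < \<rho>0"
    using ev by (auto simp: eventually_at_top_linorder)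
  define r2 where "r2 = max r1 2"
  have "continuous_on (cball 0 r2) f"
    using holomorphic_on_imp_continuous_on[OF f] continuous_on_subset by blast
  then have "bounded (f ` cball 0 r2)"
    using compact_continuous_image compact_cball compact_imp_bounded by blast
  then obtain M where M: "M > 0" "\<And>u. norm u \<le> r2 \<Longrightarrow> norm (f u) \<le> M"
    unfolding bounded_pos by auto
  define A where "A = max 0 (ln M)"
  have MA: "M \<le> exp A"
    using M(1) by (metis A_def exp_le_cancel_iff exp_ln max.cobounded2)
  have main: "norm (f u) \<le> exp (A + exp (\<rho> * s))" if u: "norm u \<le> exp s" for s u
  proof (cases "norm u \<le> r2")
    case True
    then have "norm (f u) \<le> exp A" using M(2) MA by force
    also have "\<dots> \<le> exp (A + exp (\<rho> * s))" by simp
    finally show ?thesis .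
  next
    case False
    define r where "r = norm u"
    have r: "r1 \<le> r" "2 < r" using False by (auto simp: r_def r2_def)
    have "ln r > 0" using r by simp
    have lnr: "ln r \<le> s" using u r by (metis exp_le_cancel_iff exp_ln order_less_trans r_def zero_less_numeral)
    have "max_modulus f r \<le> exp (exp (\<rho> * s))"
    proof (cases "1 < max_modulus f r")
      case True
      then have pos: "0 < ln (max_modulus f r)" by simp
      have "ln (ln (max_modulus f r)) < \<rho>0 * ln r"
        using r1[OF r(1)] \<open>ln r > 0\<close> by (simp add: pos_divide_less_eq)
      also have "\<dots> \<le> \<rho> * ln r" using \<open>ln r > 0\<close> by (simp add: \<rho>_def mult_right_mono)
      also have "\<dots> \<le> \<rho> * s" using lnr by (intro mult_left_mono) (auto simp: \<rho>_def)
      finally have "ln (max_modulus f r) \<le> exp (\<rho> * s)"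
        using pos by (metis exp_le_cancel_iff exp_ln less_imp_le)
      then show ?thesis using True by (metis exp_le_cancel_iff exp_ln less_trans zero_less_one)
    next
      \<comment> \<open>The iterated logarithm carries no information here, but the modulus is at
        most 1.\<close>
      case False
      then show ?thesis by (meson exp_ge_zero not_less one_le_exp_iff order_trans)
    qed
    then have "norm (f u) \<le> exp (exp (\<rho> * s))"
      using norm_le_max_modulus[OF f, of u] by (simp add: r_def)
    also have "\<dots> \<le> exp (A + exp (\<rho> * s))" by (simp add: A_def)
    finally show ?thesis .
  qed
  have "1 \<le> \<rho>" "0 \<le> A" by (simp_all add: \<rho>_def A_def)
  then show ?thesis using main by (rule that)
qed

text \<open>The induction carries the bound \<open>exp (iter_exp (n + m) / (2 \<rho>))\<close>: the factor
  \<open>2 \<rho>\<close> absorbs the order of growth, because \<open>A + exp (X / 2) \<le> exp X / (2 \<rho>)\<close> for large \<open>X\<close>.\<close>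

lemma iterate_growth:
  fixes f :: "complex \<Rightarrow> complex"
  assumes "1 \<le> \<rho>" "0 \<le> A" and growth: "\<And>s u. norm u \<le> exp s \<Longrightarrow> norm (f u) \<le> exp (A + exp (\<rho> * s))"
  obtains m where "\<And>n u. norm u \<le> B \<Longrightarrow> norm ((f ^^ n) u) \<le> exp (iter_exp (n + m) - d)"
proof -
  \<comment> \<open>The entries serve, in this order, the induction step, the final subtraction of
    \<open>d\<close>, the start of the induction and the sign of the iterated exponentials.\<close>
  define Y where "Y = Max {4 * \<rho> * (A + 1), 2 * d, 2 * \<rho> * ln (max 1 B), 0}"
  obtain m where m: "Y \<le> real m" using real_arch_simple by blast
  have Y: "Y \<le> iter_exp (n + m)" for n
    using m iter_exp_ge[of "n + m"] by simp
  have step: "A + exp (X / 2) \<le> exp X / (2 * \<rho>)" if "Y \<le> X" for X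
  proof -
    define y where "y = exp (X / 2)"
    have "4 * \<rho> * (A + 1) \<le> X" "0 \<le> X" using that by (simp_all add: Y_def)
    moreover have "1 + X / 2 \<le> y" unfolding y_def by (rule exp_ge_add_one_self)
    ultimately have y: "2 * \<rho> * (A + 1) \<le> y" "1 \<le> y" by linarith+
    have "(A + y) * (2 * \<rho>) \<le> (A * y + y) * (2 * \<rho>)"
      using y(2) \<open>0 \<le> A\<close> \<open>1 \<le> \<rho>\<close> by (intro mult_right_mono add_mono) (auto simp: mult_le_cancel_left1)
    also have "\<dots> = (2 * \<rho> * (A + 1)) * y" by (simp add: algebra_simps)
    also have "\<dots> \<le> y * y" using y by (intro mult_right_mono) auto
    also have "\<dots> = exp X" by (simp add: y_def flip: exp_add)
    finally show ?thesis using \<open>1 \<le> \<rho>\<close> by (simp add: y_def pos_le_divide_eq)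
  qed
  have bound: "norm ((f ^^ n) u) \<le> exp (iter_exp (n + m) / (2 * \<rho>))" if u: "norm u \<le> B" for n u
  proof (induction n)
    case 0
    have "2 * \<rho> * ln (max 1 B) \<le> iter_exp (0 + m)" using Y[of 0] by (simp add: Y_def)
    then have "ln (max 1 B) \<le> iter_exp (0 + m) / (2 * \<rho>)"
      using \<open>1 \<le> \<rho>\<close> by (simp add: field_simps)
    then have "max 1 B \<le> exp (iter_exp (0 + m) / (2 * \<rho>))"
      by (metis exp_le_cancel_iff exp_ln less_max_iff_disj zero_less_one)
    then show ?case using u by simp
  next
    case (Suc n)
    have "norm (f ((f ^^ n) u)) \<le> exp (A + exp (\<rho> * (iter_exp (n + m) / (2 * \<rho>))))"
      by (rule growth[OF Suc])
    also have "\<rho> * (iter_exp (n + m) / (2 * \<rho>)) = iter_exp (n + m) / 2"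
      using \<open>1 \<le> \<rho>\<close> by simp
    finally have "norm (f ((f ^^ n) u)) \<le> exp (A + exp (iter_exp (n + m) / 2))" .
    also have "\<dots> \<le> exp (iter_exp (Suc n + m) / (2 * \<rho>))"
      using step[OF Y[of n]] by (simp add: iter_exp_Suc)
    finally show ?case by simp
  qed
  have "norm ((f ^^ n) u) \<le> exp (iter_exp (n + m) - d)" if u: "norm u \<le> B" for n u
  proof -
    have X: "2 * d \<le> iter_exp (n + m)" "0 \<le> iter_exp (n + m)" using Y[of n] by (auto simp: Y_def)
    have "iter_exp (n + m) / (2 * \<rho>) \<le> iter_exp (n + m) / 2"
      using X(2) \<open>1 \<le> \<rho>\<close> by (intro divide_left_mono) auto
    also have "\<dots> \<le> iter_exp (n + m) - d" using X(1) by simp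
    finally show ?thesis using bound[OF u, of n] by (meson exp_le_cancel_iff order_trans)
  qed
  then show ?thesis using that by blast
qed

text \<open>On the line Re z = x the function \<open>f\<close> after \<open>exp\<close> has period 2
  pi i, so the angular set on the circle of radius exp x can be translated into any vertical period
  interval.\<close>

lemma emeasure_vertical_slice_ge:
  fixes f :: "complex \<Rightarrow> complex"
  assumes cont: "continuous_on UNIV f"
  shows "ennreal (measure lebesgue {t \<in> {0..2*pi}. norm (f (of_real (exp x) * exp (\<i> * of_real t))) < c})
    \<le> emeasure lborel {y. 2 * pi * real_of_int k \<le> y \<and> y < 2 * pi * (real_of_int k + 1) \<and> norm (f (exp (Complex x y))) \<le> c}"
    (is "ennreal (measure lebesgue ?S) \<le> emeasure lborel ?T")
proof -
  have expC: "of_real (exp x) * exp (\<i> * of_real t) = exp (Complex x t)" for t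
    by (simp add: Complex_eq exp_add exp_of_real)
  define h where "h = (\<lambda>t. norm (f (exp (Complex x t))))"
  have conth: "continuous_on UNIV h"
    unfolding h_def Complex_eq
    by (intro continuous_intros continuous_on_compose2[OF cont]) auto
  have [measurable]: "h \<in> borel_measurable borel"
    by (rule borel_measurable_continuous_onI[OF conth])
  have T: "?T = {2 * pi * k..<2 * pi * (k + 1)} \<inter> {y. h y \<le> c}" by (auto simp: h_def)
  have S: "?S = {0..2*pi} \<inter> {t. h t < c}" by (auto simp: expC h_def)
  have Sb: "?S \<in> sets borel" unfolding S by measurable
  \<comment> \<open>Dropping the endpoint 2 pi costs no measure and lets the translate fit the
    half-open interval.\<close>
  define S' where "S' = {0..<2*pi} \<inter> {t. h t < c}"
  have Sb': "S' \<in> sets borel" unfolding S'_def by measurable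
  have "emeasure lborel ?S \<le> emeasure lborel {0..2*pi}"
    by (rule emeasure_mono) auto
  also have "\<dots> < \<infinity>" by simp
  finally have "emeasure lborel ?S < \<infinity>" .
  then have "ennreal (measure lebesgue ?S) = emeasure lborel ?S"
    using Sb by (simp add: emeasure_eq_ennreal_measure less_top)
  also have "\<dots> \<le> emeasure lborel (S' \<union> {2*pi})"
  proof (rule emeasure_mono)
    show "?S \<subseteq> S' \<union> {2*pi}" unfolding S S'_def by auto
  qed (use Sb' in auto)
  also have "\<dots> \<le> emeasure lborel S' + emeasure lborel {2*pi}"
    by (rule emeasure_subadditive) (use Sb' in auto)
  also have "\<dots> = emeasure lborel S'" by simp
  also have "\<dots> = emeasure lebesgue ((+) (2 * pi * k) ` S')"
    using Sb' emeasure_lebesgue_affine[of 1 "2 * pi * k" S'] by (simp add: ac_simps cong: image_cong_simp)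
  also have "\<dots> \<le> emeasure lebesgue ?T"
  proof (rule emeasure_mono)
    have per: "h (2 * pi * k + t) = h t" for t
    proof -
      have "Complex x (2 * pi * k + t) = Complex x t + 2 * pi * of_int k * \<i>"
        by (simp add: complex_eq_iff)
      then have "exp (Complex x (2 * pi * k + t)) = exp (Complex x t)"
        unfolding exp_eq by (intro exI[of _ k]) simp
      then show ?thesis by (simp add: h_def)
    qed
    show "(+) (2 * pi * k) ` S' \<subseteq> ?T"
      unfolding T using per by (auto simp: S'_def distrib_left)
    show "?T \<in> sets lebesgue" unfolding T by simp
  qed
  also have "\<dots> = emeasure lborel ?T"
    unfolding T by simp
  finally show ?thesis .
qed

section \<open>Tilings by inverse iterates\<close>

context log_coordinates
begin

text \<open>New branches are composed on the inside, so the range at level \<open>Suc n\<close> lies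
  in a range at level \<open>n\<close>, where the area already lost can be compared.\<close>

inductive inverse_iterate :: "nat \<Rightarrow> (complex \<Rightarrow> complex) \<Rightarrow> bool" where
  inverse_iterate_0: "inverse_iterate 0 (\<lambda>w. w)"
| inverse_iterate_Suc: "inverse_iterate n \<phi> \<Longrightarrow> log_branch G \<Longrightarrow> inverse_iterate (Suc n) (\<lambda>w. \<phi> (G w))"

lemma a_less_R1: "a < R1"
  using R1 pi_gt_zero unfolding a_def by linarith

lemma inverse_iterate_holomorphic: "inverse_iterate n \<phi> \<Longrightarrow> \<phi> holomorphic_on H"
proof (induction rule: inverse_iterate.induct)
  case (inverse_iterate_Suc n \<phi> G)
  have "(\<phi> \<circ> G) holomorphic_on H"
  proof (rule holomorphic_on_compose_gen)
    show "G holomorphic_on H" using inverse_iterate_Suc by (simp add: log_branch_def)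
    show "\<phi> holomorphic_on H" by fact
    show "G ` H \<subseteq> H" using log_branch_in_H inverse_iterate_Suc by blast
  qed
  then show ?case by (simp add: o_def)
qed (simp add: holomorphic_on_ident)

lemma inverse_iterate_inj: "inverse_iterate n \<phi> \<Longrightarrow> inj_on \<phi> H"
proof (induction rule: inverse_iterate.induct)
  case (inverse_iterate_Suc n \<phi> G)
  show ?case
  proof (rule inj_onI)
    fix u v assume uv: "u \<in> H" "v \<in> H" "\<phi> (G u) = \<phi> (G v)"
    have "G u = G v"
      using inj_onD[OF inverse_iterate_Suc.IH uv(3)] log_branch_in_H inverse_iterate_Suc uv by blast
    then show "u = v"
      using inj_onD[OF log_branch_inj[OF \<open>log_branch G\<close>]] uv by blast
  qed
qed simp

lemma inverse_iterate_eq: "inverse_iterate n \<phi> \<Longrightarrow> w \<in> H \<Longrightarrow> (f ^^ n) (exp (\<phi> w)) = exp w"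
proof (induction arbitrary: w rule: inverse_iterate.induct)
  case (inverse_iterate_Suc n \<phi> G)
  then have "(f ^^ n) (exp (\<phi> (G w))) = exp (G w)" using log_branch_in_H by blast
  then show ?case using inverse_iterate_Suc by (simp add: log_branch_def)
qed simp

lemma inverse_iterate_contraction:
  "inverse_iterate n \<phi> \<Longrightarrow> a \<le> Re u \<Longrightarrow> a \<le> Re v \<Longrightarrow> norm (\<phi> u - \<phi> v) \<le> (3/8) ^ n * norm (u - v)"
proof (induction arbitrary: u v rule: inverse_iterate.induct)
  case (inverse_iterate_Suc n \<phi> G)
  have G: "a \<le> Re (G u)" "a \<le> Re (G v)"
    using log_branch_range[OF \<open>log_branch G\<close> halfplane_subset_H] inverse_iterate_Suc.prems a_less_R1
    by (meson less_imp_le less_trans)+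
  have "norm (\<phi> (G u) - \<phi> (G v)) \<le> (3/8) ^ n * norm (G u - G v)"
    by (rule inverse_iterate_Suc.IH[OF G])
  also have "\<dots> \<le> (3/8) ^ n * (3/8 * norm (u - v))"
    by (intro mult_left_mono log_branch_contraction inverse_iterate_Suc) auto
  finally show ?case by simp
qed simp

text \<open>While the orbit avoids the disc of radius \<open>c\<close>, each new value has a
  logarithm in \<open>H\<close>; the next branch is the one that sends it to the logarithm
  \<open>w\<close> found before.\<close>

lemma inverse_iterate_exists:
  assumes "\<And>k. k \<le> n \<Longrightarrow> c < norm ((f ^^ k) (exp z))"
  shows "\<exists>\<phi> w. inverse_iterate n \<phi> \<and> w \<in> H \<and> \<phi> w = z \<and> exp w = (f ^^ n) (exp z)"
  using assms
proof (induction n)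
  case 0
  then have "c < exp (Re z)" by simp
  then have "ln c < ln (exp (Re z))" using c_pos by (subst ln_less_cancel_iff) auto
  then have "z \<in> H" by (simp add: H_def)
  then show ?case using inverse_iterate_0 by (intro exI[of _ "\<lambda>w. w"] exI[of _ z]) simp
next
  case (Suc n)
  then obtain \<phi> w where \<phi>: "inverse_iterate n \<phi>" "w \<in> H" "\<phi> w = z" "exp w = (f ^^ n) (exp z)"
    by (metis le_Suc_eq)
  define v where "v = f (exp w)"
  have v: "v = (f ^^ Suc n) (exp z)" by (simp add: v_def \<phi>(4))
  then have "c < norm v" using Suc.prems[of "Suc n"] by simp
  then have "v \<noteq> 0" using c_pos by auto
  have "Ln v \<in> H"
    using \<open>c < norm v\<close> \<open>v \<noteq> 0\<close> c_pos by (simp add: H_def)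
  moreover have "f (exp w) = exp (Ln v)" using \<open>v \<noteq> 0\<close> by (simp add: v_def[symmetric])
  ultimately obtain G where G: "log_branch G" "G (Ln v) = w"
    using log_branch_exists by blast
  show ?case
    by (intro exI[of _ "\<lambda>w. \<phi> (G w)"] exI[of _ "Ln v"] conjI inverse_iterate_Suc)
      (use \<phi> G v \<open>v \<noteq> 0\<close> \<open>Ln v \<in> H\<close> in auto)
qed

text \<open>Both maps lift \<open>exp\<close> through the n-th iterate of \<open>f\<close> after
  \<open>exp\<close>, up to a shift by a multiple of 2 pi i. This is what makes the tiles
  disjoint.\<close>

lemma inverse_iterate_unique:
  assumes \<phi>: "inverse_iterate n \<phi>" and \<psi>: "inverse_iterate n \<psi>"
    and w: "w \<in> H" "v \<in> H" "\<phi> w = \<psi> v"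
  obtains l :: int where "v = w + 2 * pi * of_int l * \<i>" "\<And>u. u \<in> H \<Longrightarrow> \<phi> u = \<psi> (u + 2 * pi * of_int l * \<i>)"
proof -
  have "exp v = exp w" using inverse_iterate_eq[OF \<phi> w(1)] inverse_iterate_eq[OF \<psi> w(2)] w(3) by simp
  then obtain l :: int where "v = w + (of_int (2 * l) * pi) * \<i>" using exp_eq by blast
  then have l: "v = w + 2 * pi * of_int l * \<i>" by simp
  define P where "P = 2 * pi * of_int l * \<i>"
  have PH: "u + P \<in> H" if "u \<in> H" for u using that by (simp add: H_def P_def)
  have expP: "exp (u + P) = exp u" for u
    unfolding P_def exp_eq by (intro exI[of _ l]) simp
  define p where "p = (\<lambda>z. (f ^^ n) (exp z))"
  have holp: "p holomorphic_on UNIV"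
  proof -
    have "(f ^^ n) holomorphic_on UNIV" by (rule holomorphic_on_funpow[OF entire_f])
    then have "((f ^^ n) \<circ> exp) holomorphic_on UNIV"
      by (rule holomorphic_on_compose_gen[rotated]) (auto intro: holomorphic_on_exp)
    then show ?thesis by (simp add: p_def o_def)
  qed
  have "\<phi> u = \<psi> (u + P)" if "u \<in> H" for u
  proof (rule lift_unique[OF holp open_H connected_H inverse_iterate_holomorphic[OF \<phi>], of "\<lambda>u. \<psi> (u + P)" w u])
    have "(\<psi> \<circ> (\<lambda>u. u + P)) holomorphic_on H"
      by (rule holomorphic_on_compose_gen[OF _ inverse_iterate_holomorphic[OF \<psi>]])
        (use PH in \<open>auto intro!: holomorphic_intros\<close>)
    then show "(\<lambda>u. \<psi> (u + P)) holomorphic_on H" by (simp add: o_def)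
    show "p (\<phi> z) = p (\<psi> (z + P))" if "z \<in> H" for z
      using inverse_iterate_eq[OF \<phi> that] inverse_iterate_eq[OF \<psi> PH[OF that]] expP by (simp add: p_def)
    show "\<phi> w = \<psi> (w + P)" using w l by (simp add: P_def)
    \<comment> \<open>\<open>p\<close> after \<phi> is \<open>exp\<close>, whose derivative never
      vanishes, so the chain rule excludes a zero.\<close>
    show "deriv p (\<phi> w) \<noteq> 0"
    proof
      assume d0: "deriv p (\<phi> w) = 0"
      have "(\<phi> has_field_derivative deriv \<phi> w) (at w)"
        using holomorphic_derivI[OF inverse_iterate_holomorphic[OF \<phi>] open_H w(1)] .
      moreover have "(p has_field_derivative deriv p (\<phi> w)) (at (\<phi> w))"
        using holomorphic_derivI[OF holp open_UNIV] by simp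
      ultimately have "((\<lambda>u. p (\<phi> u)) has_field_derivative deriv p (\<phi> w) * deriv \<phi> w) (at w)"
        using DERIV_chain2 by blast
      then have "(exp has_field_derivative deriv p (\<phi> w) * deriv \<phi> w) (at w)"
        by (rule has_field_derivative_transform_within_open[OF _ open_H w(1)])
          (use inverse_iterate_eq[OF \<phi>] in \<open>simp add: p_def\<close>)
      then have "exp w = deriv p (\<phi> w) * deriv \<phi> w"
        using DERIV_unique DERIV_exp by blast
      then show False using d0 by simp
    qed
  qed (use w that in auto)
  then show ?thesis using that l P_def by blast
qed

text \<open>The segment from \<open>v\<close> to \<open>u\<close> is covered by \<open>M\<close>
  steps of length at most 8 pi, a quarter of the radius 32 pi of the discs available in
  \<open>H\<close>. The constant does not depend on the level n.\<close>

lemma inverse_iterate_distortion: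
  obtains K where "K \<ge> 1"
    "\<And>n \<phi> u v M. inverse_iterate n \<phi> \<Longrightarrow> a \<le> Re u \<Longrightarrow> a \<le> Re v \<Longrightarrow> norm (u - v) \<le> 8 * pi * real M \<Longrightarrow>
      norm (deriv \<phi> u) \<le> K ^ M * norm (deriv \<phi> v)"
proof -
  obtain K :: real where "K \<ge> 1" and K:
    "\<And>\<phi> w \<rho> u. \<phi> holomorphic_on ball w \<rho> \<Longrightarrow> inj_on \<phi> (ball w \<rho>) \<Longrightarrow> 0 < \<rho> \<Longrightarrow>
       dist w u \<le> \<rho> / 4 \<Longrightarrow> norm (deriv \<phi> u) \<le> K * norm (deriv \<phi> w)"
    using univalent_deriv_distortion by metis
  have "norm (deriv \<phi> u) \<le> K ^ M * norm (deriv \<phi> v)"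
    if \<phi>: "inverse_iterate n \<phi>" and "a \<le> Re u" "a \<le> Re v" "norm (u - v) \<le> 8 * pi * real M" for n \<phi> u v M
    using that(2-)
  proof (induction M arbitrary: u)
    case 0
    then show ?case by simp
  next
    case (Suc M)
    \<comment> \<open>The point \<open>w\<close> at this fraction of the segment leaves one step of
      length at most 8 pi and is within reach of the induction hypothesis.\<close>
    define t where "t = real M / (real M + 1)"
    have t: "0 \<le> t" "t \<le> 1" by (simp_all add: t_def)
    define w where "w = v + of_real t * (u - v)"
    have "Re w = (1 - t) * Re v + t * Re u" by (simp add: w_def algebra_simps)
    also have "\<dots> \<ge> (1 - t) * a + t * a"
      using t Suc.prems by (intro add_mono mult_left_mono) auto
    finally have aw: "a \<le> Re w" by (simp add: algebra_simps)
    have "norm (w - v) = t * norm (u - v)" using t by (simp add: w_def norm_mult)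
    also have "\<dots> \<le> t * (8 * pi * real (Suc M))" using Suc.prems t by (intro mult_left_mono) auto
    also have "\<dots> = 8 * pi * real M" by (simp add: t_def field_simps)
    finally have wv: "norm (w - v) \<le> 8 * pi * real M" .
    have "u - w = of_real (1 - t) * (u - v)" by (simp add: w_def algebra_simps)
    then have "norm (u - w) = \<bar>1 - t\<bar> * norm (u - v)" by (metis norm_mult norm_of_real)
    also have "\<dots> = (1 - t) * norm (u - v)" using t by simp
    also have "\<dots> \<le> (1 - t) * (8 * pi * real (Suc M))" using Suc.prems t by (intro mult_left_mono) auto
    also have "\<dots> = 8 * pi" by (simp add: t_def field_simps)
    finally have uw: "norm (u - w) \<le> 8 * pi" .
    have sub: "ball w (32 * pi) \<subseteq> H"
    proof
      fix z assume "z \<in> ball w (32 * pi)"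
      then have "\<bar>Re (w - z)\<bar> < 32 * pi" using abs_Re_le_cmod[of "w - z"] by (simp add: dist_norm)
      then show "z \<in> H" using aw by (simp add: a_def H_def)
    qed
    have "norm (deriv \<phi> u) \<le> K * norm (deriv \<phi> w)"
    proof (rule K[of \<phi> w "32 * pi"])
      show "\<phi> holomorphic_on ball w (32 * pi)"
        using inverse_iterate_holomorphic[OF \<phi>] sub by (rule holomorphic_on_subset)
      show "inj_on \<phi> (ball w (32 * pi))"
        using inverse_iterate_inj[OF \<phi>] sub by (rule inj_on_subset)
      show "dist w u \<le> 32 * pi / 4" using uw by (simp add: dist_norm norm_minus_commute)
    qed simp
    also have "\<dots> \<le> K * (K ^ M * norm (deriv \<phi> v))"
      using Suc.IH[OF aw Suc.prems(2) wv] \<open>K \<ge> 1\<close> by (intro mult_left_mono) auto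
    finally show ?case by simp
  qed
  then show ?thesis using that \<open>K \<ge> 1\<close> by blast
qed

text \<open>Half-open, so that the cells partition the half-plane; of height 2 pi, so that the
  periods of \<open>exp\<close> permute them.\<close>

definition cell :: "real \<Rightarrow> nat \<Rightarrow> int \<Rightarrow> complex set" where
  "cell \<omega> j k = {w. a + real j * \<omega> \<le> Re w \<and> Re w < a + real (j + 1) * \<omega> \<and>
     2 * pi * real_of_int k \<le> Im w \<and> Im w < 2 * pi * (real_of_int k + 1)}"

text \<open>A set rather than an indexed family: maps that differ by a period yield the same tiles
  from shifted cells, and each tile is to count once.\<close>

definition tiles :: "real \<Rightarrow> nat \<Rightarrow> complex set set" where
  "tiles \<omega> n = {\<phi> ` cell \<omega> j k |\<phi> j k. inverse_iterate n \<phi>}"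

lemma cell_halfplane: "0 < \<omega> \<Longrightarrow> w \<in> cell \<omega> j k \<Longrightarrow> a \<le> Re w"
  unfolding cell_def mem_Collect_eq by (smt (verit) mult_nonneg_nonneg of_nat_0_le_iff)

lemma cell_subset_H: "0 < \<omega> \<Longrightarrow> cell \<omega> j k \<subseteq> H"
  using cell_halfplane halfplane_subset_H by blast

lemma cell_cover:
  assumes "0 < \<omega>" "a \<le> Re w"
  obtains j k where "w \<in> cell \<omega> j k"
proof -
  define j where "j = nat \<lfloor>(Re w - a) / \<omega>\<rfloor>"
  define k where "k = \<lfloor>Im w / (2 * pi)\<rfloor>"
  have "0 \<le> (Re w - a) / \<omega>" using assms by simp
  then have "real j = of_int \<lfloor>(Re w - a) / \<omega>\<rfloor>" by (simp add: j_def)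
  then have "real j \<le> (Re w - a) / \<omega>" "(Re w - a) / \<omega> < real j + 1"
    by linarith+
  then have 1: "real j * \<omega> \<le> Re w - a" "Re w - a < (real j + 1) * \<omega>"
    using assms by (simp_all add: pos_le_divide_eq pos_divide_less_eq)
  have "of_int k \<le> Im w / (2 * pi)" "Im w / (2 * pi) < of_int k + 1"
    unfolding k_def by linarith+
  then have "2 * pi * of_int k \<le> Im w" "Im w < 2 * pi * (of_int k + 1)"
    by (simp_all add: pos_le_divide_eq pos_divide_less_eq mult.commute)
  then have "w \<in> cell \<omega> j k" using 1 by (simp add: cell_def algebra_simps)
  then show ?thesis by (rule that)
qed

lemma cell_unique:
  assumes "0 < \<omega>" "w \<in> cell \<omega> j k" "w \<in> cell \<omega> j' k'"
  shows "j = j' \<and> k = k'"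
proof
  have "real j * \<omega> < real (j' + 1) * \<omega>" "real j' * \<omega> < real (j + 1) * \<omega>"
    using assms(2,3) unfolding cell_def mem_Collect_eq by linarith+
  then show "j = j'" using assms(1) by simp
  have "2 * pi * real_of_int k < 2 * pi * (real_of_int k' + 1)" "2 * pi * real_of_int k' < 2 * pi * (real_of_int k + 1)"
    using assms(2,3) unfolding cell_def mem_Collect_eq by linarith+
  then have "real_of_int k < real_of_int k' + 1" "real_of_int k' < real_of_int k + 1"
    using pi_gt_zero by (simp_all only: mult_less_cancel_left_pos zero_less_mult_iff zero_less_numeral simp_thms)
  then show "k = k'" by linarith
qed

lemma cell_shift: "(\<lambda>u. u + 2 * pi * of_int l * \<i>) ` cell \<omega> j k = cell \<omega> j (k + l)"
proof (intro equalityI subsetI)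
  fix w assume "w \<in> cell \<omega> j (k + l)"
  then have "w - 2 * pi * of_int l * \<i> \<in> cell \<omega> j k"
    by (simp add: cell_def algebra_simps)
  then show "w \<in> (\<lambda>u. u + 2 * pi * of_int l * \<i>) ` cell \<omega> j k" by force
qed (auto simp: cell_def algebra_simps)

text \<open>Maps with a common value agree after a period shift. That shift carries one cell to the
  other, so tiles that meet are equal.\<close>

lemma disjoint_tiles: "0 < \<omega> \<Longrightarrow> pairwise disjnt (tiles \<omega> n)"
  unfolding pairwise_def
proof (intro ballI impI)
  fix S T assume "0 < \<omega>" "S \<in> tiles \<omega> n" "T \<in> tiles \<omega> n" "S \<noteq> T"
  then obtain \<phi> j k \<psi> j' k' where S: "inverse_iterate n \<phi>" "S = \<phi> ` cell \<omega> j k"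
    and T: "inverse_iterate n \<psi>" "T = \<psi> ` cell \<omega> j' k'"
    unfolding tiles_def by blast
  show "disjnt S T"
  proof (rule ccontr)
    assume "\<not> disjnt S T"
    then obtain w v where w: "w \<in> cell \<omega> j k" "v \<in> cell \<omega> j' k'" "\<phi> w = \<psi> v"
      using S(2) T(2) by (auto simp: disjnt_def)
    have wH: "w \<in> H" "v \<in> H" using w cell_subset_H[OF \<open>0 < \<omega>\<close>] by blast+
    obtain l :: int where l: "v = w + 2 * pi * of_int l * \<i>"
      "\<And>u. u \<in> H \<Longrightarrow> \<phi> u = \<psi> (u + 2 * pi * of_int l * \<i>)"
      using inverse_iterate_unique[OF S(1) T(1) wH w(3)] by blast
    have "v \<in> cell \<omega> j (k + l)" using w(1) l(1) cell_shift by blast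
    then have "j' = j" "k' = k + l" using cell_unique[OF \<open>0 < \<omega>\<close>] w(2) by blast+
    then have "T = \<psi> ` (\<lambda>u. u + 2 * pi * of_int l * \<i>) ` cell \<omega> j k"
      unfolding T(2) cell_shift by simp
    then have "T = (\<lambda>u. \<psi> (u + 2 * pi * of_int l * \<i>)) ` cell \<omega> j k"
      unfolding image_image .
    also have "\<dots> = S"
      unfolding S(2)
    proof (rule image_cong[OF refl])
      fix u assume "u \<in> cell \<omega> j k"
      then have "u \<in> H" using cell_subset_H[OF \<open>0 < \<omega>\<close>] by blast
      then show "\<psi> (u + 2 * pi * of_int l * \<i>) = \<phi> u" using l(2) by simp
    qed
    finally show False using \<open>S \<noteq> T\<close> by simp
  qed
qed

text \<open>The branches need not be enumerated: disjoint sets with nonempty interior are countably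
  many.\<close>

lemma countable_tiles:
  assumes "0 < \<omega>"
  shows "countable (tiles \<omega> n)"
proof (rule countable_disjoint_nonempty_interior_subsets[OF disjoint_tiles[OF assms]])
  fix T assume "T \<in> tiles \<omega> n" "interior T = {}"
  then obtain \<phi> j k where T: "inverse_iterate n \<phi>" "T = \<phi> ` cell \<omega> j k"
    by (auto simp: tiles_def)
  define B where "B = box (Complex (a + real j * \<omega>) (2 * pi * real_of_int k))
      (Complex (a + real (j + 1) * \<omega>) (2 * pi * (real_of_int k + 1)))"
  have B: "open B" "B \<subseteq> cell \<omega> j k"
    by (auto simp: B_def cell_def in_box_complex_iff)
  then have BH: "B \<subseteq> H" using cell_subset_H[OF assms] by blast
  have "open (\<phi> ` B)"
    by (rule open_mapping_thm3) (use B BH T(1) inverse_iterate_holomorphic inverse_iterate_inj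
        holomorphic_on_subset inj_on_subset in blast)+
  then have "\<phi> ` B \<subseteq> interior T" using B T(2) by (intro interior_maximal) auto
  moreover have "Complex (a + (real j + 1/2) * \<omega>) (2 * pi * (real_of_int k + 1/2)) \<in> B"
    using assms by (simp add: B_def in_box_complex_iff algebra_simps)
  ultimately show "T = {}" using \<open>interior T = {}\<close> by blast
qed

lemma borel_cell [measurable]: "cell \<omega> j k \<in> sets borel"
proof -
  have "cell \<omega> j k = Re -` {a + real j * \<omega>..<a + real (j + 1) * \<omega>} \<inter> Im -` {2 * pi * real_of_int k..<2 * pi * (real_of_int k + 1)}"
    by (auto simp: cell_def)
  moreover have "Re -` {a + real j * \<omega>..<a + real (j + 1) * \<omega>} \<in> sets (borel :: complex measure)"
    by (rule measurable_sets_borel[OF borel_measurable_Re]) simp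
  moreover have "Im -` {2 * pi * real_of_int k..<2 * pi * (real_of_int k + 1)} \<in> sets (borel :: complex measure)"
    by (rule measurable_sets_borel[OF borel_measurable_Im]) simp
  ultimately show ?thesis by simp
qed

lemma emeasure_cell_le:
  assumes "0 < \<omega>"
  shows "emeasure lborel (cell \<omega> j k) \<le> ennreal (2 * pi * \<omega>)"
proof -
  define l u where "l = Complex (a + real j * \<omega>) (2 * pi * real_of_int k)"
    and "u = Complex (a + real (j + 1) * \<omega>) (2 * pi * (real_of_int k + 1))"
  have "cell \<omega> j k \<subseteq> cbox l u" by (auto simp: cell_def in_cbox_complex_iff l_def u_def)
  then have "emeasure lborel (cell \<omega> j k) \<le> emeasure lborel (cbox l u)"
    by (intro emeasure_mono) auto
  also have "\<dots> = (\<Prod>b\<in>Basis. (u - l) \<bullet> b)"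
    using assms by (intro emeasure_lborel_cbox) (auto simp: Basis_complex_def l_def u_def algebra_simps)
  also have "(\<Prod>b\<in>Basis. (u - l) \<bullet> b) = 2 * pi * \<omega>"
    by (simp add: Basis_complex_def l_def u_def algebra_simps)
  finally show ?thesis by simp
qed

lemma cell_diameter:
  assumes "0 < \<omega>" "u \<in> cell \<omega> j k" "v \<in> cell \<omega> j k"
  shows "norm (u - v) \<le> \<omega> + 2 * pi"
proof -
  have "\<bar>Re (u - v)\<bar> \<le> \<omega>" "\<bar>Im (u - v)\<bar> \<le> 2 * pi"
    using assms(2,3) unfolding cell_def by (auto simp: algebra_simps abs_le_iff)
  then show ?thesis using cmod_le[of "u - v"] by linarith
qed

end

section \<open>Loss of area\<close>

context log_coordinates
begin

lemma tile_borel: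
  assumes "0 < \<omega>" "T \<in> tiles \<omega> n"
  shows "T \<in> sets borel"
proof -
  obtain \<phi> j k where T: "inverse_iterate n \<phi>" "T = \<phi> ` cell \<omega> j k"
    using assms(2) unfolding tiles_def by blast
  show ?thesis unfolding T(2)
    by (rule holomorphic_injective_image_borel[OF inverse_iterate_holomorphic[OF T(1)] open_H
        inverse_iterate_inj[OF T(1)] borel_cell cell_subset_H[OF assms(1)]])
qed

text \<open>This set lives in the coordinate of the cells, \<open>survivors\<close> in that of the
  tiles; on a cell, an inverse iterate carries the complement of the former into the latter.\<close>

definition excluded :: "complex set" where
  "excluded = {w. norm (f (exp w)) \<le> c}"

definition survivors :: "nat \<Rightarrow> complex set" where
  "survivors n = {z. c < norm ((f ^^ n) (exp z))}"

lemma continuous_iterate: "continuous_on A (\<lambda>z. (f ^^ n) (exp z))"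
  by (rule continuous_on_compose2[OF holomorphic_on_imp_continuous_on[OF holomorphic_on_funpow[OF entire_f]]])
    (auto intro!: continuous_intros)

lemma borel_excluded [measurable]: "excluded \<in> sets borel"
proof -
  have "closed excluded"
    unfolding excluded_def using continuous_iterate[of UNIV 1]
    by (intro closed_Collect_le continuous_intros) simp
  then show ?thesis by simp
qed

lemma borel_survivors [measurable]: "survivors n \<in> sets borel"
proof -
  have "open (survivors n)"
    unfolding survivors_def by (intro open_Collect_less continuous_intros continuous_iterate)
  then show ?thesis by simp
qed

text \<open>With \<open>d\<close> the modulus of the derivative at one point of the cell, the tile
  has area at most \<open>(L d)\<^sup>2\<close> times that of the cell, the lost part at least
  \<open>(d / L)\<^sup>2\<close> times that of the excluded part. The quotient of the factors is the
  fourth power of L.\<close>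

lemma tile_loss:
  assumes \<omega>: "0 < \<omega>" and \<phi>: "inverse_iterate n \<phi>" and "L \<ge> 1"
    and dist: "\<And>u v. u \<in> cell \<omega> j k \<Longrightarrow> v \<in> cell \<omega> j k \<Longrightarrow> norm (deriv \<phi> u) \<le> L * norm (deriv \<phi> v)"
    and \<tau>: "0 \<le> \<tau>" "\<tau> \<le> 1"
    and loss: "ennreal \<tau> * emeasure lborel (cell \<omega> j k) \<le> emeasure lborel (cell \<omega> j k \<inter> excluded)"
  shows "emeasure lborel (\<phi> ` cell \<omega> j k \<inter> survivors (Suc n)) \<le> ennreal (1 - \<tau> / L ^ 4) * emeasure lborel (\<phi> ` cell \<omega> j k)"
proof -
  define Q where "Q = cell \<omega> j k"
  define N where "N = Q \<inter> excluded"
  have QH: "Q \<subseteq> H" unfolding Q_def by (rule cell_subset_H[OF \<omega>])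
  have Qb: "Q \<in> sets borel" "N \<in> sets borel" by (simp_all add: Q_def N_def)
  have NQ: "N \<subseteq> Q" by (simp add: N_def)
  have hol: "\<phi> holomorphic_on H" by (rule inverse_iterate_holomorphic[OF \<phi>])
  have inj: "inj_on \<phi> H" by (rule inverse_iterate_inj[OF \<phi>])
  \<comment> \<open>The lower left corner, which belongs to the half-open cell.\<close>
  define v0 where "v0 = Complex (a + real j * \<omega>) (2 * pi * real_of_int k)"
  have v0: "v0 \<in> Q" using \<omega> by (simp add: v0_def Q_def cell_def algebra_simps)
  define d where "d = norm (deriv \<phi> v0)"
  have "d > 0"
    using holomorphic_injective_imp_regular[OF hol open_H inj, of v0] v0 QH by (auto simp: d_def)
  have Qfin: "emeasure lborel Q < \<infinity>"
    unfolding Q_def using le_less_trans[OF emeasure_cell_le[OF \<omega>] ennreal_less_top] by simp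
  have Nfin: "emeasure lborel N < \<infinity>"
    using emeasure_mono[OF NQ, of lborel] Qb Qfin by (simp add: le_less_trans)
  have le: "emeasure lborel (\<phi> ` Q) \<le> ennreal ((L * d)\<^sup>2) * emeasure lborel Q"
    by (rule emeasure_holomorphic_image_le[OF hol open_H inj Qb(1) QH Qfin])
      (use dist v0 in \<open>auto simp: d_def Q_def\<close>)
  have ge: "ennreal ((d / L)\<^sup>2) * emeasure lborel N \<le> emeasure lborel (\<phi> ` N)"
  proof (rule emeasure_holomorphic_image_ge[OF hol open_H inj Qb(2)])
    show "N \<subseteq> H" using NQ QH by blast
    show "0 < d / L" using \<open>d > 0\<close> \<open>L \<ge> 1\<close> by simp
    show "d / L \<le> norm (deriv \<phi> x)" if "x \<in> N" for x
      using dist[of v0 x] that v0 NQ \<open>L \<ge> 1\<close> by (auto simp: d_def Q_def pos_divide_le_eq mult.commute)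
  qed
  have Tfin: "emeasure lborel (\<phi> ` Q) < \<infinity>"
    using le Qfin by (simp add: ennreal_mult_less_top le_less_trans)
  have Tb: "\<phi> ` Q \<in> sets borel" "\<phi> ` N \<in> sets borel"
    using holomorphic_injective_image_borel[OF hol open_H inj] Qb QH NQ by blast+
  have sub: "\<phi> ` N \<subseteq> \<phi> ` Q" using NQ by blast
  have Pfin: "emeasure lborel (\<phi> ` N) < \<infinity>"
    using emeasure_mono[OF sub, of lborel] Tb Tfin by (simp add: le_less_trans)
  define mT mQ mN mP where "mT = measure lborel (\<phi> ` Q)" and "mQ = measure lborel Q"
    and "mN = measure lborel N" and "mP = measure lborel (\<phi> ` N)"
  have nonneg: "0 \<le> mT" "0 \<le> mQ" "0 \<le> mN" "0 \<le> mP"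
    by (simp_all add: mT_def mQ_def mN_def mP_def)
  have m: "emeasure lborel (\<phi> ` Q) = ennreal mT" "emeasure lborel Q = ennreal mQ"
    "emeasure lborel N = ennreal mN" "emeasure lborel (\<phi> ` N) = ennreal mP"
    unfolding mT_def mQ_def mN_def mP_def
    using Tfin Qfin Nfin Pfin by (simp_all add: emeasure_eq_ennreal_measure less_top)
  have 1: "mT \<le> (L * d)\<^sup>2 * mQ"
    using le nonneg unfolding m by (simp flip: ennreal_mult)
  have 2: "(d / L)\<^sup>2 * mN \<le> mP"
    using ge nonneg unfolding m by (simp flip: ennreal_mult)
  have 3: "\<tau> * mQ \<le> mN"
    using loss nonneg \<tau> unfolding Q_def[symmetric] N_def[symmetric] m by (simp flip: ennreal_mult)
  have "\<tau> / L ^ 4 * mT \<le> \<tau> / L ^ 4 * ((L * d)\<^sup>2 * mQ)"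
    using 1 \<tau> \<open>L \<ge> 1\<close> by (intro mult_left_mono) auto
  also have "\<dots> = (d / L)\<^sup>2 * (\<tau> * mQ)"
    using \<open>L \<ge> 1\<close> by (simp add: field_simps power2_eq_square power4_eq_xxxx)
  also have "\<dots> \<le> (d / L)\<^sup>2 * mN" using 3 by (intro mult_left_mono) auto
  also have "\<dots> \<le> mP" by (rule 2)
  finally have main: "mT - mP \<le> (1 - \<tau> / L ^ 4) * mT" by (simp add: algebra_simps)
  have "\<tau> / L ^ 4 \<le> 1"
  proof -
    have "1 \<le> L ^ 4" using \<open>L \<ge> 1\<close> by (rule one_le_power)
    then show ?thesis using \<tau> by (simp add: divide_le_eq)
  qed
  have "\<phi> ` Q \<inter> survivors (Suc n) = \<phi> ` Q - \<phi> ` N"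
  proof -
    have surv: "\<phi> w \<in> survivors (Suc n) \<longleftrightarrow> w \<notin> excluded" if "w \<in> Q" for w
    proof -
      have "(f ^^ Suc n) (exp (\<phi> w)) = f (exp w)"
        using inverse_iterate_eq[OF \<phi>, of w] that QH by auto
      then show ?thesis by (simp add: survivors_def excluded_def not_le)
    qed
    have image: "\<phi> w \<in> \<phi> ` N \<longleftrightarrow> w \<in> excluded" if "w \<in> Q" for w
    proof -
      have "\<phi> w \<in> \<phi> ` N \<longleftrightarrow> w \<in> N"
        using inj_on_image_mem_iff[OF inj] that QH NQ by blast
      then show ?thesis using that by (simp add: N_def)
    qed
    have "y \<in> \<phi> ` Q \<inter> survivors (Suc n) \<longleftrightarrow> y \<in> \<phi> ` Q - \<phi> ` N" for y
    proof (cases "y \<in> \<phi> ` Q")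
      case True
      then obtain w where "w \<in> Q" "y = \<phi> w" by blast
      then show ?thesis using surv[of w] image[of w] by simp
    qed simp
    then show ?thesis by (rule set_eqI)
  qed
  then have "emeasure lborel (\<phi> ` Q \<inter> survivors (Suc n)) = emeasure lborel (\<phi> ` Q) - emeasure lborel (\<phi> ` N)"
    using emeasure_Diff[of lborel "\<phi> ` N" "\<phi> ` Q"] Pfin Tb sub by simp
  also have "\<dots> = ennreal (mT - mP)" unfolding m using nonneg by (simp add: ennreal_minus)
  also have "\<dots> \<le> ennreal ((1 - \<tau> / L ^ 4) * mT)" using main by (rule ennreal_leI)
  also have "\<dots> = ennreal (1 - \<tau> / L ^ 4) * ennreal mT"
    using \<open>\<tau> / L ^ 4 \<le> 1\<close> nonneg by (intro ennreal_mult) auto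
  finally show ?thesis unfolding m(1)[symmetric] Q_def .
qed

definition tiles_in :: "real \<Rightarrow> nat \<Rightarrow> complex set \<Rightarrow> complex set set" where
  "tiles_in \<omega> n B = {T \<in> tiles \<omega> n. T \<subseteq> B}"

lemma tile_diameter:
  assumes "0 < \<omega>" "T \<in> tiles \<omega> n" "y \<in> T" "z \<in> T"
  shows "norm (y - z) \<le> (3/8) ^ n * (\<omega> + 2 * pi)"
proof -
  obtain \<phi> j k where T: "inverse_iterate n \<phi>" "T = \<phi> ` cell \<omega> j k"
    using assms(2) unfolding tiles_def by blast
  then obtain u v where uv: "u \<in> cell \<omega> j k" "v \<in> cell \<omega> j k" "y = \<phi> u" "z = \<phi> v"
    using assms(3,4) by blast
  have "norm (y - z) \<le> (3/8) ^ n * norm (u - v)"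
    unfolding uv by (rule inverse_iterate_contraction[OF T(1)]) (use uv assms(1) cell_halfplane in blast)+
  also have "\<dots> \<le> (3/8) ^ n * (\<omega> + 2 * pi)"
    using cell_diameter[OF assms(1) uv(1,2)] by (intro mult_left_mono) auto
  finally show ?thesis .
qed

text \<open>A tile of level \<open>Suc n\<close> need not lie in one tile of level \<open>n\<close>,
  but each of its points lies in the surviving part of such a tile. The step from \<open>B'\<close>
  to \<open>B\<close> leaves room for that tile's diameter.\<close>

lemma tiles_in_step:
  assumes \<omega>: "0 < \<omega>"
    and B: "\<And>y z. z \<in> B' \<Longrightarrow> norm (y - z) \<le> (3/8) ^ n * (\<omega> + 2 * pi) \<Longrightarrow> y \<in> B"
    and loss: "\<And>T. T \<in> tiles_in \<omega> n B \<Longrightarrow> emeasure lborel (T \<inter> survivors (Suc n)) \<le> s * emeasure lborel T"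
  shows "emeasure lborel (\<Union> (tiles_in \<omega> (Suc n) B')) \<le> s * emeasure lborel (\<Union> (tiles_in \<omega> n B))"
proof -
  have cnt: "countable (tiles_in \<omega> n B)"
    using countable_tiles[OF \<omega>, of n] by (rule countable_subset[rotated]) (auto simp: tiles_in_def)
  have brl: "T \<in> sets borel" if "T \<in> tiles_in \<omega> n B" for T
    using tile_borel[OF \<omega>] that by (auto simp: tiles_in_def)
  have disj: "disjoint_family_on (\<lambda>T. T) (tiles_in \<omega> n B)"
    using disjoint_tiles[OF \<omega>, of n] unfolding pairwise_def disjoint_family_on_def disjnt_def tiles_in_def by blast
  have sub: "\<Union> (tiles_in \<omega> (Suc n) B') \<subseteq> (\<Union>T\<in>tiles_in \<omega> n B. T \<inter> survivors (Suc n))"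
  proof
    fix z assume "z \<in> \<Union> (tiles_in \<omega> (Suc n) B')"
    then obtain \<Phi> j k where \<Phi>: "inverse_iterate (Suc n) \<Phi>" "z \<in> \<Phi> ` cell \<omega> j k" "\<Phi> ` cell \<omega> j k \<subseteq> B'"
      unfolding tiles_in_def tiles_def by blast
    then obtain w where w: "w \<in> cell \<omega> j k" "z = \<Phi> w" by blast
    have wH: "w \<in> H" using w cell_subset_H[OF \<omega>] by blast
    obtain \<phi> G where \<phi>: "inverse_iterate n \<phi>" "log_branch G" "\<Phi> = (\<lambda>w. \<phi> (G w))"
      using \<Phi>(1) by (cases rule: inverse_iterate.cases) auto
    have "a \<le> Re (G w)" using log_branch_range[OF \<phi>(2) wH] a_less_R1 by linarith
    then obtain j' k' where c: "G w \<in> cell \<omega> j' k'" using cell_cover[OF \<omega>] by blast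
    define T where "T = \<phi> ` cell \<omega> j' k'"
    have T: "T \<in> tiles \<omega> n" using \<phi>(1) unfolding tiles_def T_def by blast
    have zT: "z \<in> T" using c w(2) \<phi>(3) by (simp add: T_def)
    have "z \<in> B'" using \<Phi> by blast
    then have "T \<subseteq> B" using B tile_diameter[OF \<omega> T _ zT] by blast
    moreover have "z \<in> survivors (Suc n)"
      using inverse_iterate_eq[OF \<Phi>(1) wH] norm_exp_gt[OF wH] w(2) unfolding survivors_def by simp
    ultimately show "z \<in> (\<Union>T\<in>tiles_in \<omega> n B. T \<inter> survivors (Suc n))"
      using T zT unfolding tiles_in_def by blast
  qed
  have "emeasure lborel (\<Union> (tiles_in \<omega> (Suc n) B')) \<le> emeasure lborel (\<Union>T\<in>tiles_in \<omega> n B. T \<inter> survivors (Suc n))"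
  proof (rule emeasure_mono[OF sub])
    show "(\<Union>T\<in>tiles_in \<omega> n B. T \<inter> survivors (Suc n)) \<in> sets lborel"
      by (rule sets.countable_UN'[OF cnt]) (use brl in auto)
  qed
  also have "\<dots> = (\<integral>\<^sup>+T. emeasure lborel (T \<inter> survivors (Suc n)) \<partial>count_space (tiles_in \<omega> n B))"
    by (rule emeasure_UN_countable[OF _ cnt]) (use brl disj in \<open>auto simp: disjoint_family_on_def\<close>)
  also have "\<dots> \<le> (\<integral>\<^sup>+T. s * emeasure lborel T \<partial>count_space (tiles_in \<omega> n B))"
    by (rule nn_integral_mono) (use loss in auto)
  also have "\<dots> = s * (\<integral>\<^sup>+T. emeasure lborel T \<partial>count_space (tiles_in \<omega> n B))"
    by (rule nn_integral_cmult) simp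
  also have "(\<integral>\<^sup>+T. emeasure lborel T \<partial>count_space (tiles_in \<omega> n B)) = emeasure lborel (\<Union>T\<in>tiles_in \<omega> n B. T)"
    by (rule emeasure_UN_countable[symmetric, OF _ cnt disj]) (use brl in auto)
  finally show ?thesis by simp
qed

end

section \<open>The set of trapped points\<close>

lemma prod_one_minus_le_exp:
  fixes t :: "nat \<Rightarrow> real"
  assumes "\<And>i. t i \<le> 1"
  shows "(\<Prod>i<n. 1 - t i) \<le> exp (- (\<Sum>i<n. t i))"
proof -
  have "(\<Prod>i<n. 1 - t i) \<le> (\<Prod>i<n. exp (- t i))"
    using assms exp_ge_add_one_self[of "- t _"] by (intro prod_mono) auto
  also have "\<dots> = exp (- (\<Sum>i<n. t i))" by (simp add: exp_sum flip: sum_negf)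
  finally show ?thesis .
qed

context log_coordinates
begin

definition trapped :: "complex set" where
  "trapped = {z. \<forall>n. exp R1 \<le> norm ((f ^^ n) (exp z))}"

lemma closed_trapped: "closed trapped"
proof -
  have "trapped = (\<Inter>n. {z. exp R1 \<le> norm ((f ^^ n) (exp z))})" by (auto simp: trapped_def)
  then show ?thesis
    by (auto intro!: closed_INT closed_Collect_le continuous_on_norm continuous_iterate continuous_on_const)
qed

lemma trapped_subset_tiles:
  assumes \<omega>: "0 < \<omega>" and z: "z \<in> trapped"
    and B: "\<And>y. norm (y - z) \<le> (3/8) ^ n * (\<omega> + 2 * pi) \<Longrightarrow> y \<in> B"
  shows "z \<in> \<Union> (tiles_in \<omega> n B)"
proof -
  have ex: "exp R1 \<le> norm ((f ^^ k) (exp z))" for k using z by (simp add: trapped_def)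
  have "ln c < R1" using R1 pi_gt_zero by linarith
  then have "c < exp R1" using c_pos by (metis exp_less_mono exp_ln)
  then have "c < norm ((f ^^ k) (exp z))" for k using ex[of k] by linarith
  then obtain \<phi> w where \<phi>: "inverse_iterate n \<phi>" "w \<in> H" "\<phi> w = z" "exp w = (f ^^ n) (exp z)"
    using inverse_iterate_exists by blast
  have "exp R1 \<le> exp (Re w)" using ex[of n] \<phi>(4) by (metis norm_exp_eq_Re)
  then have "a \<le> Re w" using a_less_R1 by simp
  then obtain j k where w: "w \<in> cell \<omega> j k" using cell_cover[OF \<omega>] by blast
  define T where "T = \<phi> ` cell \<omega> j k"
  have T: "T \<in> tiles \<omega> n" "z \<in> T" using \<phi> w unfolding tiles_def T_def by blast+
  then have "T \<subseteq> B" using B tile_diameter[OF \<omega> T(1) _ T(2)] by blast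
  then show ?thesis using T unfolding tiles_in_def by blast
qed

text \<open>The radii \<open>1 + 2 (\<omega> + 2 \<pi>) (3/8)\<^sup>n\<close> shrink by at least the diameter of a tile of level \<open>n\<close>,
  so that tiles meeting the next ball lie in the current one.\<close>

lemma trapped_local_null:
  assumes \<omega>: "0 < \<omega>" and \<tau>: "\<And>n. 0 \<le> \<tau> n" "\<And>n. \<tau> n \<le> 1"
    and loss: "\<And>n \<phi> j k v. inverse_iterate n \<phi> \<Longrightarrow> v \<in> cell \<omega> j k \<Longrightarrow>
      norm (\<phi> v - z0) \<le> 1 + 2 * (\<omega> + 2 * pi) \<Longrightarrow>
      ennreal (\<tau> n) * emeasure lborel (cell \<omega> j k) \<le> emeasure lborel (cell \<omega> j k \<inter> excluded)"
    and div: "filterlim (\<lambda>n. \<Sum>i<n. \<tau> i) at_top sequentially"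
  shows "emeasure lborel (trapped \<inter> ball z0 1) = 0"
proof -
  define \<delta> where "\<delta> = \<omega> + 2 * pi"
  have "\<delta> > 0" using \<omega> pi_gt_zero by (simp add: \<delta>_def add_pos_pos)
  obtain K where "K \<ge> 1" and K:
    "\<And>n \<phi> u v M. inverse_iterate n \<phi> \<Longrightarrow> a \<le> Re u \<Longrightarrow> a \<le> Re v \<Longrightarrow> norm (u - v) \<le> 8 * pi * real M \<Longrightarrow>
      norm (deriv \<phi> u) \<le> K ^ M * norm (deriv \<phi> v)"
    using inverse_iterate_distortion by metis
  \<comment> \<open>\<open>M\<close> chain steps span a cell, so \<open>L\<close> bounds the
    distortion on all cells at every level.\<close>
  obtain M :: nat where "\<delta> / (8 * pi) \<le> real M" using real_arch_simple by blast
  then have M: "\<delta> \<le> 8 * pi * real M" by (simp add: pos_divide_le_eq mult.commute)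
  define L where "L = K ^ M"
  have "L \<ge> 1" unfolding L_def using \<open>K \<ge> 1\<close> by (rule one_le_power)
  define B where "B = (\<lambda>n::nat. ball z0 (1 + 2 * \<delta> * (3/8) ^ n))"
  define t where "t = (\<lambda>n. \<tau> n / L ^ 4)"
  have L4: "1 \<le> L ^ 4" using \<open>L \<ge> 1\<close> by (rule one_le_power)
  have t: "t n \<le> 1" for n using \<tau>(2)[of n] L4 by (simp add: t_def divide_le_eq)
  have tile: "emeasure lborel (T \<inter> survivors (Suc n)) \<le> ennreal (1 - t n) * emeasure lborel T"
    if T: "T \<in> tiles_in \<omega> n (B n)" for T n
  proof -
    obtain \<phi> j k where \<phi>: "inverse_iterate n \<phi>" "T = \<phi> ` cell \<omega> j k"
      using T unfolding tiles_in_def tiles_def by blast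
    define v where "v = Complex (a + real j * \<omega>) (2 * pi * real_of_int k)"
    have v: "v \<in> cell \<omega> j k" using \<omega> by (simp add: v_def cell_def algebra_simps)
    then have "\<phi> v \<in> B n" using T \<phi>(2) unfolding tiles_in_def by blast
    then have "norm (\<phi> v - z0) \<le> 1 + 2 * \<delta> * (3/8) ^ n"
      by (simp add: B_def dist_norm norm_minus_commute)
    also have "\<dots> \<le> 1 + 2 * \<delta> * 1"
      using \<open>\<delta> > 0\<close> by (intro add_left_mono mult_left_mono power_le_one) auto
    finally have near: "norm (\<phi> v - z0) \<le> 1 + 2 * (\<omega> + 2 * pi)" by (simp add: \<delta>_def)
    show ?thesis
      unfolding \<phi>(2) t_def
    proof (rule tile_loss[OF \<omega> \<phi>(1) \<open>L \<ge> 1\<close> _ \<tau> loss[OF \<phi>(1) v near]])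
      fix x y assume xy: "x \<in> cell \<omega> j k" "y \<in> cell \<omega> j k"
      have "norm (x - y) \<le> 8 * pi * real M"
        using cell_diameter[OF \<omega> xy] M by (simp add: \<delta>_def)
      then show "norm (deriv \<phi> x) \<le> L * norm (deriv \<phi> y)"
        unfolding L_def using K[OF \<phi>(1)] cell_halfplane[OF \<omega>] xy by blast
    qed
  qed
  have step: "emeasure lborel (\<Union> (tiles_in \<omega> (Suc n) (B (Suc n)))) \<le>
      ennreal (1 - t n) * emeasure lborel (\<Union> (tiles_in \<omega> n (B n)))" for n
  proof (rule tiles_in_step[OF \<omega> _ tile])
    fix y z assume z: "z \<in> B (Suc n)" "norm (y - z) \<le> (3/8) ^ n * (\<omega> + 2 * pi)"
    have "norm (y - z0) \<le> norm (y - z) + norm (z - z0)"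
      using norm_triangle_ineq[of "y - z" "z - z0"] by simp
    also have "\<dots> < (3/8) ^ n * \<delta> + (1 + 2 * \<delta> * (3/8) ^ Suc n)"
      using z by (simp add: B_def dist_norm norm_minus_commute \<delta>_def)
    \<comment> \<open>The factor 2 in the radii suffices because 1 + 2 * 3/8 = 7/4.\<close>
    also have "\<dots> = 1 + 7/4 * \<delta> * (3/8) ^ n" by (simp add: algebra_simps)
    also have "\<dots> \<le> 1 + 2 * \<delta> * (3/8) ^ n"
      using \<open>\<delta> > 0\<close> by (intro add_left_mono mult_right_mono) auto
    finally show "y \<in> B n" by (simp add: B_def dist_norm norm_minus_commute)
  qed
  define V where "V = measure lborel (ball z0 (1 + 2 * \<delta>))"
  have V: "emeasure lborel (ball z0 (1 + 2 * \<delta>)) = ennreal V"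
    unfolding V_def using emeasure_lborel_ball_finite[of z0 "1 + 2 * \<delta>"]
    by (simp add: emeasure_eq_ennreal_measure less_top)
  have "V \<ge> 0" by (simp add: V_def)
  have prod_nonneg: "0 \<le> (\<Prod>i<n. 1 - t i)" for n using t by (intro prod_nonneg) auto
  have area: "emeasure lborel (\<Union> (tiles_in \<omega> n (B n))) \<le> ennreal ((\<Prod>i<n. 1 - t i) * V)" for n
  proof (induction n)
    case 0
    have "\<Union> (tiles_in \<omega> 0 (B 0)) \<subseteq> ball z0 (1 + 2 * \<delta>)" by (auto simp: tiles_in_def B_def)
    then show ?case using emeasure_mono[of _ "ball z0 (1 + 2 * \<delta>)" lborel] V by simp
  next
    case (Suc n)
    have "emeasure lborel (\<Union> (tiles_in \<omega> (Suc n) (B (Suc n)))) \<le> ennreal (1 - t n) * ennreal ((\<Prod>i<n. 1 - t i) * V)"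
      using step[of n] Suc by (meson mult_left_mono order_trans zero_le)
    also have "\<dots> = ennreal ((\<Prod>i<Suc n. 1 - t i) * V)"
      using t[of n] prod_nonneg[of n] \<open>V \<ge> 0\<close> by (subst ennreal_mult[symmetric]) (auto simp: mult_ac)
    finally show ?case .
  qed
  have sub: "trapped \<inter> ball z0 1 \<subseteq> \<Union> (tiles_in \<omega> n (B n))" for n
  proof
    fix z assume z: "z \<in> trapped \<inter> ball z0 1"
    show "z \<in> \<Union> (tiles_in \<omega> n (B n))"
    proof (rule trapped_subset_tiles[OF \<omega>])
      fix y assume y: "norm (y - z) \<le> (3/8) ^ n * (\<omega> + 2 * pi)"
      have "norm (y - z0) \<le> norm (y - z) + norm (z - z0)"
        using norm_triangle_ineq[of "y - z" "z - z0"] by simp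
      also have "\<dots> < (3/8) ^ n * \<delta> + 1"
        using z y by (simp add: dist_norm norm_minus_commute \<delta>_def)
      also have "\<dots> \<le> 1 + 2 * \<delta> * (3/8) ^ n" using \<open>\<delta> > 0\<close> by simp
      finally show "y \<in> B n" by (simp add: B_def dist_norm norm_minus_commute)
    qed (use z in auto)
  qed
  have bound: "emeasure lborel (trapped \<inter> ball z0 1) \<le> ennreal (exp (- ((\<Sum>i<n. \<tau> i) / L ^ 4)) * V)" for n
  proof -
    have mT: "\<Union> (tiles_in \<omega> n (B n)) \<in> sets lborel"
    proof -
      have "countable (tiles_in \<omega> n (B n))"
        using countable_tiles[OF \<omega>, of n] by (rule countable_subset[rotated]) (auto simp: tiles_in_def)
      then show ?thesis
        using tile_borel[OF \<omega>] by (intro sets.countable_Union) (auto simp: tiles_in_def)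
    qed
    have "emeasure lborel (trapped \<inter> ball z0 1) \<le> emeasure lborel (\<Union> (tiles_in \<omega> n (B n)))"
      by (rule emeasure_mono[OF sub mT])
    also have "\<dots> \<le> ennreal ((\<Prod>i<n. 1 - t i) * V)" by (rule area)
    also have "\<dots> \<le> ennreal (exp (- (\<Sum>i<n. t i)) * V)"
      using prod_one_minus_le_exp[of t n] t \<open>V \<ge> 0\<close> by (intro ennreal_leI mult_right_mono) auto
    also have "(\<Sum>i<n. t i) = (\<Sum>i<n. \<tau> i) / L ^ 4" by (simp add: t_def sum_divide_distrib)
    finally show ?thesis .
  qed
  have "(\<lambda>n. exp (- ((\<Sum>i<n. \<tau> i) / L ^ 4)) * V) \<longlonglongrightarrow> 0 * V"
  proof (intro tendsto_mult tendsto_const filterlim_compose[OF exp_at_bot])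
    have "filterlim (\<lambda>n. (1 / L ^ 4) * (\<Sum>i<n. \<tau> i)) at_top sequentially"
      using L4 div by (intro filterlim_tendsto_pos_mult_at_top[OF tendsto_const]) auto
    then show "filterlim (\<lambda>n. - ((\<Sum>i<n. \<tau> i) / L ^ 4)) at_bot sequentially"
      by (simp add: filterlim_uminus_at_top)
  qed
  then have "(\<lambda>n. ennreal (exp (- ((\<Sum>i<n. \<tau> i) / L ^ 4)) * V)) \<longlonglongrightarrow> ennreal 0"
    by (intro tendsto_ennrealI) simp
  then have "emeasure lborel (trapped \<inter> ball z0 1) \<le> ennreal 0"
    by (rule LIMSEQ_le_const) (use bound in auto)
  then show ?thesis by simp
qed

text \<open>The leftmost column starts below the range where \<theta>0 is a bound, but contains a
  strip that \<open>f\<close> after \<open>exp\<close> maps entirely into the disc of radius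
  \<open>c\<close>. In the other columns each vertical slice loses at least
  \<open>\<theta>0 (exp X)\<close>.\<close>

lemma cell_loss:
  assumes \<omega>: "0 < \<omega>" "R1 - a \<le> \<omega>" and \<theta>: "\<And>r. exp (a + \<omega>) \<le> r \<Longrightarrow>
      \<theta>0 r \<le> measure lebesgue {t \<in> {0..2*pi}. norm (f (of_real r * exp (\<i> * of_real t))) < c}"
    and anti: "antimono_on {0<..} \<theta>0" and pos: "\<And>r. 0 < r \<Longrightarrow> 0 < \<theta>0 r"
    and \<kappa>: "0 \<le> \<kappa>" "\<kappa> \<le> 1 / (2 * pi)" "\<kappa> * \<theta>0 1 * \<omega> \<le> R1 - a"
    and v: "v \<in> cell \<omega> j k" "Re v \<le> X - \<omega>" and "0 \<le> X"
  shows "ennreal (\<kappa> * \<theta>0 (exp X)) * emeasure lborel (cell \<omega> j k) \<le> emeasure lborel (cell \<omega> j k \<inter> excluded)"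
proof -
  let ?Q = "cell \<omega> j k \<inter> excluded"
  have Qb: "?Q \<in> sets borel" by simp
  have \<theta>X: "0 < \<theta>0 (exp X)" using pos by simp
  have "ennreal (\<kappa> * \<theta>0 (exp X)) * emeasure lborel (cell \<omega> j k) \<le>
      ennreal (\<kappa> * \<theta>0 (exp X)) * ennreal (2 * pi * \<omega>)"
    by (intro mult_left_mono emeasure_cell_le[OF \<omega>(1)]) simp
  also have "\<dots> = ennreal (\<kappa> * \<theta>0 (exp X) * (2 * pi * \<omega>))"
    using \<kappa> \<theta>X \<omega> by (intro ennreal_mult[symmetric]) auto
  also have "\<dots> \<le> emeasure lborel ?Q"
  proof (cases "j = 0")
    case True
    have "\<kappa> * \<theta>0 (exp X) * (2 * pi * \<omega>) \<le> \<kappa> * \<theta>0 1 * (2 * pi * \<omega>)"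
      using \<kappa>(1) \<omega> anti \<open>0 \<le> X\<close>
      by (intro mult_right_mono mult_left_mono) (auto simp: monotone_on_def)
    also have "\<dots> = 2 * pi * (\<kappa> * \<theta>0 1 * \<omega>)" by simp
    also have "\<dots> \<le> 2 * pi * (R1 - a)" using \<kappa>(3) by (intro mult_left_mono) auto
    finally have "ennreal (\<kappa> * \<theta>0 (exp X) * (2 * pi * \<omega>)) \<le> ennreal (2 * pi) * ennreal (R1 - a)"
      using a_less_R1 by (simp flip: ennreal_mult)
    also have "\<dots> \<le> emeasure lborel ?Q"
    proof (rule emeasure_complex_ge_slices[OF Qb])
      fix x assume x: "a \<le> x" "x < R1"
      have "norm (f (exp (Complex x y))) \<le> c" for y
        using norm_f_ball[of "exp (Complex x y)"] x by simp
      then have "{2 * pi * real_of_int k..<2 * pi * (real_of_int k + 1)} \<subseteq> {y. Complex x y \<in> ?Q}"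
        using x True \<omega> by (auto simp: cell_def excluded_def)
      moreover have "{y. Complex x y \<in> ?Q} \<in> sets lborel"
      proof -
        have "continuous_on UNIV (\<lambda>y. Complex x y)" unfolding Complex_eq by (intro continuous_intros)
        then have "(\<lambda>y. Complex x y) \<in> borel_measurable borel" by (rule borel_measurable_continuous_onI)
        from measurable_sets[OF this Qb] show ?thesis by (simp add: vimage_def)
      qed
      ultimately have "emeasure lborel {2 * pi * real_of_int k..<2 * pi * (real_of_int k + 1)} \<le> emeasure lborel {y. Complex x y \<in> ?Q}"
        by (rule emeasure_mono)
      then show "ennreal (2 * pi) \<le> emeasure lborel {y. Complex x y \<in> ?Q}"
        by (simp add: algebra_simps)
    qed (use a_less_R1 in simp)
    finally show ?thesis .
  next
    case False
    define p q where "p = a + real j * \<omega>" and "q = a + real (j + 1) * \<omega>"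
    \<comment> \<open>Leaving the room \<omega> at one point puts the whole cell to the left of
      \<open>X\<close>, so monotonicity of \<theta>0 applies to all its slices.\<close>
    have qX: "q \<le> X" using v by (simp add: cell_def q_def algebra_simps)
    have "1 * \<omega> \<le> real j * \<omega>" using False \<omega> by (intro mult_right_mono) auto
    then have p: "a + \<omega> \<le> p" by (simp add: p_def)
    have "\<kappa> * \<theta>0 (exp X) * (2 * pi * \<omega>) = (\<kappa> * (2 * pi)) * (\<theta>0 (exp X) * \<omega>)" by simp
    also have "\<dots> \<le> 1 * (\<theta>0 (exp X) * \<omega>)"
      using \<kappa>(2) \<theta>X \<omega> by (intro mult_right_mono) (auto simp: pos_le_divide_eq)
    finally have "ennreal (\<kappa> * \<theta>0 (exp X) * (2 * pi * \<omega>)) \<le> ennreal (\<theta>0 (exp X)) * ennreal (q - p)"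
      using \<theta>X \<omega> by (simp add: p_def q_def algebra_simps flip: ennreal_mult)
    also have "\<dots> \<le> emeasure lborel ?Q"
    proof (rule emeasure_complex_ge_slices[OF Qb])
      show "p \<le> q" using \<omega> by (simp add: p_def q_def algebra_simps)
      fix x assume x: "p \<le> x" "x < q"
      have "\<theta>0 (exp X) \<le> \<theta>0 (exp x)"
        using anti x qX by (auto simp: monotone_on_def)
      also have "\<dots> \<le> measure lebesgue {t \<in> {0..2*pi}. norm (f (of_real (exp x) * exp (\<i> * of_real t))) < c}"
        using x p by (intro \<theta>) auto
      finally have "ennreal (\<theta>0 (exp X)) \<le> ennreal (measure lebesgue {t \<in> {0..2*pi}. norm (f (of_real (exp x) * exp (\<i> * of_real t))) < c})"
        by (rule ennreal_leI)
      also have "\<dots> \<le> emeasure lborel {y. 2 * pi * real_of_int k \<le> y \<and> y < 2 * pi * (real_of_int k + 1) \<and> norm (f (exp (Complex x y))) \<le> c}"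
        by (rule emeasure_vertical_slice_ge[OF holomorphic_on_imp_continuous_on[OF entire_f]])
      also have "{y. 2 * pi * real_of_int k \<le> y \<and> y < 2 * pi * (real_of_int k + 1) \<and> norm (f (exp (Complex x y))) \<le> c} = {y. Complex x y \<in> ?Q}"
        using x by (auto simp: cell_def excluded_def p_def q_def)
      finally show "ennreal (\<theta>0 (exp X)) \<le> emeasure lborel {y. Complex x y \<in> ?Q}" .
    qed
    finally show ?thesis .
  qed
  finally show ?thesis .
qed

end

text \<open>A value of \<theta>0 that is not positive would make all later terms nonpositive and the
  partial sums bounded above.\<close>

lemma divergent_antimono_pos:
  fixes \<theta>0 :: "real \<Rightarrow> real"
  assumes anti: "antimono_on {0<..} \<theta>0"
    and div: "filterlim (\<lambda>n. \<Sum>k=1..n. \<theta>0 (iter_exp k)) at_top sequentially"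
    and "0 < r"
  shows "0 < \<theta>0 r"
proof (rule ccontr)
  assume "\<not> 0 < \<theta>0 r"
  obtain N :: nat where N: "r \<le> real N" using real_arch_simple by blast
  have neg: "\<theta>0 (iter_exp k) \<le> 0" if "N \<le> k" for k
  proof -
    have "r \<le> iter_exp k" using N that iter_exp_ge[of k] by (meson of_nat_le_iff order_trans)
    then have "\<theta>0 (iter_exp k) \<le> \<theta>0 r" using anti \<open>0 < r\<close> by (auto simp: monotone_on_def)
    then show ?thesis using \<open>\<not> 0 < \<theta>0 r\<close> by simp
  qed
  define S where "S = (\<lambda>n. \<Sum>k=1..n. \<theta>0 (iter_exp k))"
  have bound: "S n \<le> S N" if "N \<le> n" for n
    using that
  proof (induction rule: dec_induct)
    case (step n)
    then show ?case using neg[of "Suc n"] by (simp add: S_def)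
  qed simp
  have "eventually (\<lambda>n. S N + 1 \<le> S n) sequentially"
    using div unfolding filterlim_at_top S_def by blast
  then obtain n where "N \<le> n" "S N + 1 \<le> S n"
    by (metis eventually_sequentially nat_le_linear)
  then show False using bound by fastforce
qed

theorem theorem3p1:
  fixes f :: "complex \<Rightarrow> complex" and r0 R1 :: real and \<theta>0 :: "real \<Rightarrow> real"
  assumes "class_B f"
    and "transcendental_entire f"
    and "finite_order f"
    and "r0 > 0"
    and "singular_values f \<subseteq> cball 0 r0"
    and "R1 > max (2 * ln r0) (ln r0 + 64 * pi)"
    and "{z. exp z \<in> f -` {w. norm w > r0}} \<subseteq> {z. Re z > R1}"
    and "\<forall>\<^sub>F r in at_top.
           \<theta>0 r \<le> measure lebesgue {t \<in> {0..2*pi}. norm (f (of_real r * exp (\<i> * of_real t))) < r0}"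
    and "antimono_on {0<..} \<theta>0"
    and "filterlim (\<lambda>n. \<Sum>k=1..n. \<theta>0 (iter_exp k)) at_top sequentially"
  shows "julia_set f \<in> null_sets lebesgue"
proof -
  have holf: "f holomorphic_on UNIV" and transc: "\<not> (\<exists>p. \<forall>z. f z = poly p z)"
    using assms(2) by (auto simp: transcendental_entire_def entire_def)
  have "critical_values f \<union> asymptotic_values f \<subseteq> cball 0 r0"
    using assms(5) closure_subset unfolding singular_values_def by blast
  then have regular: "{w. r0 < norm w} \<inter> (critical_values f \<union> asymptotic_values f) = {}"
    by (auto simp: subset_iff)
  interpret log_coordinates f r0 R1
    by unfold_locales (use holf transc assms(4,6,7) regular in auto)
  note anti = assms(9) and div = assms(10)
  have pos: "0 < \<theta>0 r" if "0 < r" for r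
    using divergent_antimono_pos[OF anti div that] .
  obtain r\<^sub>\<theta> where r\<theta>: "\<And>r. r\<^sub>\<theta> \<le> r \<Longrightarrow>
      \<theta>0 r \<le> measure lebesgue {t \<in> {0..2*pi}. norm (f (of_real r * exp (\<i> * of_real t))) < r0}"
    using assms(8) unfolding eventually_at_top_linorder by blast
  \<comment> \<open>The first entry moves all columns but the leftmost beyond the radius
    \<open>r\<^sub>\<theta>\<close>; the second makes the leftmost column contain the strip between
    \<open>a\<close> and \<open>R1\<close>.\<close>
  define \<omega> where "\<omega> = max (ln (max 1 r\<^sub>\<theta>) - a) (R1 - a)"
  have \<omega>: "0 < \<omega>" "R1 - a \<le> \<omega>" using a_less_R1 by (auto simp: \<omega>_def)
  have "ln (max 1 r\<^sub>\<theta>) \<le> a + \<omega>" by (simp add: \<omega>_def)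
  then have large: "max 1 r\<^sub>\<theta> \<le> exp (a + \<omega>)"
    by (metis exp_le_cancel_iff exp_ln less_max_iff_disj zero_less_one)
  have \<theta>: "\<theta>0 r \<le> measure lebesgue {t \<in> {0..2*pi}. norm (f (of_real r * exp (\<i> * of_real t))) < r0}"
    if "exp (a + \<omega>) \<le> r" for r
    by (rule r\<theta>) (use large that in linarith)
  \<comment> \<open>The first entry turns the length of a slice into a fraction of the height 2 pi.
    The second treats the leftmost column and, as \<open>R1 - a \<le> \<omega>\<close>, keeps the
    fractions at most 1.\<close>
  define \<kappa> where "\<kappa> = min (1 / (2 * pi)) ((R1 - a) / (\<theta>0 1 * \<omega>))"
  have \<kappa>: "0 < \<kappa>" "\<kappa> \<le> 1 / (2 * pi)" "\<kappa> * \<theta>0 1 * \<omega> \<le> R1 - a"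
  proof -
    have "0 < \<theta>0 1 * \<omega>" using pos[of 1] \<omega> by simp
    then have "\<kappa> * (\<theta>0 1 * \<omega>) \<le> R1 - a"
      by (metis \<kappa>_def min.cobounded2 pos_le_divide_eq)
    then show "\<kappa> * \<theta>0 1 * \<omega> \<le> R1 - a" by (simp add: mult.assoc)
    show "0 < \<kappa>" using \<open>0 < \<theta>0 1 * \<omega>\<close> a_less_R1 by (simp add: \<kappa>_def)
  qed (simp add: \<kappa>_def)
  obtain \<rho> A where \<rho>: "1 \<le> \<rho>" "0 \<le> A"
    "\<And>s u. norm u \<le> exp s \<Longrightarrow> norm (f u) \<le> exp (A + exp (\<rho> * s))"
    using finite_order_growth[OF holf assms(3)] by blast
  have local_null: "trapped \<inter> ball z0 1 \<in> null_sets lborel" for z0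
  proof -
    define R where "R = 1 + 2 * (\<omega> + 2 * pi)"
    obtain m where m: "\<And>n u. norm u \<le> exp (Re z0 + R) \<Longrightarrow> norm ((f ^^ n) u) \<le> exp (iter_exp (n + m) - \<omega>)"
      by (rule iterate_growth[of \<rho> A f "exp (Re z0 + R)" \<omega>, OF \<rho>(1,2)]) (use \<rho>(3) in blast)+
    \<comment> \<open>\<open>iter_exp (n + m)\<close> bounds a real part, so the radius at which
      \<theta>0 is taken is one exponential higher.\<close>
    define \<tau> where "\<tau> = (\<lambda>n. \<kappa> * \<theta>0 (iter_exp (Suc n + m)))"
    have ge1: "1 \<le> iter_exp (Suc k)" for k
      using iter_exp_ge[of "Suc k"] by linarith
    have "emeasure lborel (trapped \<inter> ball z0 1) = 0"
    proof (rule trapped_local_null[OF \<omega>(1)])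
      show "0 \<le> \<tau> n" for n
        using \<kappa>(1) pos[of "iter_exp (Suc (n + m))"] ge1[of "n + m"] by (simp add: \<tau>_def)
      show "\<tau> n \<le> 1" for n
      proof -
        have "\<tau> n \<le> \<kappa> * \<theta>0 1"
          unfolding \<tau>_def using \<kappa>(1) ge1[of "n + m"] anti
          by (intro mult_left_mono) (auto simp: monotone_on_def)
        also have "\<dots> \<le> 1"
        proof -
          have "\<kappa> * \<theta>0 1 * \<omega> \<le> 1 * \<omega>" using \<kappa>(3) \<omega>(2) by simp
          then show ?thesis using \<omega>(1) by (rule mult_right_le_imp_le)
        qed
        finally show ?thesis .
      qed
      show "ennreal (\<tau> n) * emeasure lborel (cell \<omega> j k) \<le> emeasure lborel (cell \<omega> j k \<inter> excluded)"
        if \<phi>: "inverse_iterate n \<phi>" "v \<in> cell \<omega> j k" "norm (\<phi> v - z0) \<le> 1 + 2 * (\<omega> + 2 * pi)" for n \<phi> j k v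
      proof -
        have "Re (\<phi> v) - Re z0 \<le> R"
          using abs_Re_le_cmod[of "\<phi> v - z0"] \<phi>(3) by (simp add: R_def)
        then have "norm (exp (\<phi> v)) \<le> exp (Re z0 + R)" by simp
        then have "norm ((f ^^ n) (exp (\<phi> v))) \<le> exp (iter_exp (n + m) - \<omega>)" by (rule m)
        moreover have "(f ^^ n) (exp (\<phi> v)) = exp v"
          using inverse_iterate_eq[OF \<phi>(1)] \<phi>(2) cell_subset_H[OF \<omega>(1)] by blast
        ultimately have "Re v \<le> iter_exp (n + m) - \<omega>" by simp
        moreover have "0 \<le> iter_exp (n + m)" using iter_exp_ge[of "n + m"] by linarith
        ultimately have "ennreal (\<kappa> * \<theta>0 (exp (iter_exp (n + m)))) * emeasure lborel (cell \<omega> j k)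
            \<le> emeasure lborel (cell \<omega> j k \<inter> excluded)"
          using \<kappa>(1) by (intro cell_loss[OF \<omega> \<theta> anti pos _ \<kappa>(2,3) \<phi>(2)]) auto
        then show ?thesis by (simp add: \<tau>_def iter_exp_Suc)
      qed
      have sums: "(\<Sum>i<n. \<tau> i) = \<kappa> * ((\<Sum>k=1..n+m. \<theta>0 (iter_exp k)) - (\<Sum>k=1..m. \<theta>0 (iter_exp k)))" for n
        by (induction n) (simp_all add: \<tau>_def algebra_simps)
      have "filterlim (\<lambda>n. \<Sum>k=1..n+m. \<theta>0 (iter_exp k)) at_top sequentially"
        using filterlim_compose[OF div filterlim_add_const_nat_at_top] by simp
      then have "filterlim (\<lambda>n. - (\<Sum>k=1..m. \<theta>0 (iter_exp k)) + (\<Sum>k=1..n+m. \<theta>0 (iter_exp k))) at_top sequentially"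
        by (rule filterlim_tendsto_add_at_top[OF tendsto_const])
      then have "filterlim (\<lambda>n. \<kappa> * (- (\<Sum>k=1..m. \<theta>0 (iter_exp k)) + (\<Sum>k=1..n+m. \<theta>0 (iter_exp k)))) at_top sequentially"
        by (rule filterlim_tendsto_pos_mult_at_top[OF tendsto_const \<kappa>(1)])
      then show "filterlim (\<lambda>n. \<Sum>i<n. \<tau> i) at_top sequentially"
        unfolding sums by simp
    qed
    then show ?thesis using closed_trapped by (intro null_setsI) auto
  qed
  \<comment> \<open>Unit discs centred at a countable dense set cover the plane.\<close>
  obtain D :: "complex set" where D: "countable D" "\<And>X. open X \<Longrightarrow> X \<noteq> {} \<Longrightarrow> \<exists>d\<in>D. d \<in> X"
    using countable_dense_exists by blast
  have "(\<Union>q\<in>D. trapped \<inter> ball q 1) \<in> null_sets lborel"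
    using local_null by (intro null_sets_UN' D(1))
  moreover have "trapped \<subseteq> (\<Union>q\<in>D. trapped \<inter> ball q 1)"
  proof
    fix z assume "z \<in> trapped"
    moreover obtain q where "q \<in> D" "q \<in> ball z 1" using D(2)[of "ball z 1"] by auto
    ultimately show "z \<in> (\<Union>q\<in>D. trapped \<inter> ball q 1)" by (auto simp: dist_commute)
  qed
  ultimately have "trapped \<in> null_sets lborel"
    using closed_trapped by (auto intro: null_sets_subset)
  then have "negligible trapped"
    by (simp add: negligible_iff_null_sets null_sets_completionI)
  then have "negligible (exp ` trapped)"
    by (intro negligible_differentiable_image_negligible)
      (auto intro: holomorphic_on_imp_differentiable_on holomorphic_on_exp)
  moreover have "julia_set f \<subseteq> exp ` trapped"
  proof
    fix y assume y: "y \<in> julia_set f"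
    have "ln r0 < R1" using R1 pi_gt_zero by linarith
    then have "r0 < exp R1" using assms(4) by (metis exp_less_mono exp_ln)
    then have ex: "exp R1 \<le> norm ((f ^^ n) y)" for n
      using julia_set_subset_escaping_ball[OF holf norm_f_ball, of "exp R1"] y by blast
    \<comment> \<open>The zeroth iterate already keeps \<open>y\<close> away from 0, so it has a
      logarithm.\<close>
    from ex[of 0] have "y \<noteq> 0" by (auto simp: not_le)
    then show "y \<in> exp ` trapped"
      using ex by (intro image_eqI[of _ _ "Ln y"]) (auto simp: trapped_def)
  qed
  ultimately have "negligible (julia_set f)" by (rule negligible_subset)
  then show ?thesis by (simp add: negligible_iff_null_sets)
qed

end
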